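(* Let $\xi=(\xi_t)_{t\ge 0}$ be a real-valued L\'evy process which drifts to $\infty$, and let the process $\tilde V$, the time-change $T$, the measures $\nu$ on $(0,\infty)$ and $\mathbb{Q}$ on $\Omega$, and the Ornstein-Uhlenbeck type process $U$ be as defined in the context. Then: (i) The measure $\mathbb{Q}$ (respectively, $\nu$) is finite if and only if $\xi_1\in L^1(\mathbb{P})$, and in that case $\mathbb{Q}(\Omega)=\nu((0,\infty))=\mathbb{E}(\xi_1)$. (ii) Under $\mathbb{Q}$, the process $$\tilde U(t)=\frac{1}{\tilde V(T(t))},\qquad t\in\mathbb{R},$$ is a stationary and ergodic Markov process, with one-dimensional marginal $\nu$ and the same semigroup as the Ornstein-Uhlenbeck type process $U$. (iii) For all functions $f,g\in L^1(\nu)$ with $\langle\nu,g\rangle\ne0$, $$\lim_{t\to\infty}\frac{\int_0^t f(\tilde U(s))\,\mathrm{d}s}{\int_0^t g(\tilde U(s))\,\mathrm{d}s}=\frac{\langle\nu,f\rangle}{\langle\nu,g\rangle}\qquad \mathbb{Q}\text{-a.s., and therefore also } \mathbb{P}\text{-a.s.}$$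
   Context: $\xi=(\xi_t)_{t\ge0}$ is a real-valued L\'evy process (started from $0$, with c\`adl\`ag paths) on a probability space $(\Omega,\mathcal{A},\mathbb{P})$, with $\lim_{t\to\infty}\xi_t=\infty$ a.s. ("$\xi$ drifts to $\infty$"). The processes $X$ and $U$: let $I(t)=\int_0^t \exp(\xi_s)\,\mathrm{d}s$, a.s. a bijection of $[0,\infty)$, with inverse $\tau$. Set $X(t)=\exp(\xi_{\tau(t)})$, a Markov process on $(0,\infty)$ started from $1$; the version of $X$ started from $x>0$ is $(xX(t/x))_{t\ge0}$. The Ornstein-Uhlenbeck type process is $U(t)=\mathrm{e}^{-t}X(\mathrm{e}^t-1)$, $t\ge 0$; it is a Markov process on $(0,\infty)$, with semigroup $f\mapsto \mathbb{E}\big[f\big(\mathrm{e}^{-t}xX((\mathrm{e}^t-1)/x)\big)\big]$, $x>0$. The process $\tilde V$: let $\hat\xi$ be an independent copy of $-\xi$, and $\hat I=\int_0^\infty \exp(\hat\xi_s)\,\mathrm{d}s$, which is a.s. finite, with law $\mu$ on $(0,\infty)$. Put $\tilde\xi_t=\xi_t$ for $t\ge0$ and $\tilde\xi_t=\hat\xi_{|t|-}$ (left limit) for $t<0$. For $t\in\mathbb{R}$ set $\tilde I(t)=\int_{-\infty}^t \exp(\tilde\xi_s)\,\mathrm{d}s$ and $\tilde V(t)=\exp(-\tilde\xi_t)\tilde I(t)$, so $\tilde V(0)=\tilde I(0)=\hat I$. Time change: $A(t)=\int_0^t \frac{\mathrm{d}s}{\tilde V(s)}=\ln\tilde I(t)-\ln\tilde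 I(0)$, $t\in\mathbb{R}$, is a bijection $\mathbb{R}\to\mathbb{R}$, and $T$ denotes its inverse. Measures: $\nu$ is the measure on $(0,\infty)$ given by $\langle\nu,f\rangle=\int_{(0,\infty)}\frac1x f(1/x)\,\mu(\mathrm{d}x)$, and $\mathbb{Q}$ is the sigma-finite measure on $(\Omega,\mathcal{A})$, equivalent to $\mathbb{P}$, given by $\mathbb{Q}(\Lambda)=\mathbb{E}\big(\frac{1}{\tilde V(0)}\mathbf{1}_\Lambda\big)$ for $\Lambda\in\mathcal{A}$. Stationarity, the Markov property and ergodicity under the possibly infinite measure $\mathbb{Q}$ are understood as for probability measures: stationary means that the image measure of $\mathbb{Q}$ by $\tilde U$ on path space is invariant under the shifts $\omega\mapsto\omega(t+\cdot)$, $t\in\mathbb{R}$; ergodic means that every measurable set of paths invariant under all these shifts is null or has null complement for that image measure. *)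

theory Defs
  imports "HOL-Probability.Probability"
begin

definition cadlag_on :: "real set \<Rightarrow> (real \<Rightarrow> real) \<Rightarrow> bool" where
  "cadlag_on S w \<longleftrightarrow>
     (\<forall>t\<in>S. (w \<longlongrightarrow> w t) (at t within S \<inter> {t<..}) \<and>
            (\<exists>l. (w \<longlongrightarrow> l) (at t within S \<inter> {..<t})))"

text \<open>Processes are functions of time and of the sample point. A process indexed by \<open>[0,\<infinity>)\<close> is
  given as a function on all of \<open>real\<close>, whose values at negative times are never used.\<close>

definition levy_process :: "'a measure \<Rightarrow> (real \<Rightarrow> 'a \<Rightarrow> real) \<Rightarrow> bool" where
  "levy_process M \<xi> \<longleftrightarrow>
     prob_space M \<and>
     (\<forall>t\<ge>0. \<xi> t \<in> borel_measurable M) \<and>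
     (\<forall>\<omega>\<in>space M. cadlag_on {0..} (\<lambda>t. \<xi> t \<omega>)) \<and>
     (AE \<omega> in M. \<xi> 0 \<omega> = 0) \<and>
     (\<forall>s\<ge>0. \<forall>h\<ge>0. distr M borel (\<lambda>\<omega>. \<xi> (s + h) \<omega> - \<xi> s \<omega>) = distr M borel (\<xi> h)) \<and>
     (\<forall>(n::nat) t. 0 \<le> t 0 \<and> (\<forall>i<n. t i \<le> t (Suc i)) \<longrightarrow>
        prob_space.indep_vars M (\<lambda>_. borel) (\<lambda>i \<omega>. \<xi> (t (Suc i)) \<omega> - \<xi> (t i) \<omega>) {..<n})"

definition drifts_to_infinity :: "'a measure \<Rightarrow> (real \<Rightarrow> 'a \<Rightarrow> real) \<Rightarrow> bool" where
  "drifts_to_infinity M \<xi> \<longleftrightarrow> (AE \<omega> in M. filterlim (\<lambda>t. \<xi> t \<omega>) at_top at_top)"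

definition half_line_path :: "(real \<Rightarrow> 'a \<Rightarrow> real) \<Rightarrow> 'a \<Rightarrow> real \<Rightarrow> real" where
  "half_line_path \<eta> \<omega> = (\<lambda>t\<in>{0..}. \<eta> t \<omega>)"

text \<open>\<open>\<eta>\<close> is an independent copy of \<open>-\<xi>\<close>, again with cadlag paths.\<close>

definition independent_negative_copy ::
    "'a measure \<Rightarrow> (real \<Rightarrow> 'a \<Rightarrow> real) \<Rightarrow> (real \<Rightarrow> 'a \<Rightarrow> real) \<Rightarrow> bool" where
  "independent_negative_copy M \<xi> \<eta> \<longleftrightarrow>
     (\<forall>t\<ge>0. \<eta> t \<in> borel_measurable M) \<and>
     (\<forall>\<omega>\<in>space M. cadlag_on {0..} (\<lambda>t. \<eta> t \<omega>)) \<and>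
     distr M (PiM {0..} (\<lambda>_. borel)) (half_line_path \<eta>) =
       distr M (PiM {0..} (\<lambda>_. borel)) (half_line_path (\<lambda>t \<omega>. - \<xi> t \<omega>)) \<and>
     prob_space.indep_var M
       (PiM {0..} (\<lambda>_. borel)) (half_line_path \<xi>) (PiM {0..} (\<lambda>_. borel)) (half_line_path \<eta>)"


definition exp_functional :: "(real \<Rightarrow> 'a \<Rightarrow> real) \<Rightarrow> real \<Rightarrow> 'a \<Rightarrow> real" where
  "exp_functional \<xi> t \<omega> = (LBINT s=0..ereal t. exp (\<xi> s \<omega>))"

definition lamperti_clock :: "(real \<Rightarrow> 'a \<Rightarrow> real) \<Rightarrow> real \<Rightarrow> 'a \<Rightarrow> real" where
  "lamperti_clock \<xi> t \<omega> = inv_into {0..} (\<lambda>s. exp_functional \<xi> s \<omega>) t"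

definition lamperti :: "(real \<Rightarrow> 'a \<Rightarrow> real) \<Rightarrow> real \<Rightarrow> 'a \<Rightarrow> real" where
  "lamperti \<xi> t \<omega> = exp (\<xi> (lamperti_clock \<xi> t \<omega>) \<omega>)"

definition lamperti_from :: "(real \<Rightarrow> 'a \<Rightarrow> real) \<Rightarrow> real \<Rightarrow> real \<Rightarrow> 'a \<Rightarrow> real" where
  "lamperti_from \<xi> x t \<omega> = x * lamperti \<xi> (t / x) \<omega>"

text \<open>The Ornstein-Uhlenbeck type process \<open>U\<close> started from \<open>x > 0\<close>, and the action of its
  semigroup on nonnegative measurable functions.\<close>

definition ou_from :: "(real \<Rightarrow> 'a \<Rightarrow> real) \<Rightarrow> real \<Rightarrow> real \<Rightarrow> 'a \<Rightarrow> real" where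
  "ou_from \<xi> x t \<omega> = exp (- t) * lamperti_from \<xi> x (exp t - 1) \<omega>"

definition ou_semigroup ::
    "'a measure \<Rightarrow> (real \<Rightarrow> 'a \<Rightarrow> real) \<Rightarrow> real \<Rightarrow> (real \<Rightarrow> ennreal) \<Rightarrow> real \<Rightarrow> ennreal" where
  "ou_semigroup M \<xi> t f x = (\<integral>\<^sup>+ \<omega>. f (ou_from \<xi> x t \<omega>) \<partial>M)"


text \<open>In the following definitions \<open>\<eta>\<close> is the independent copy of \<open>-\<xi>\<close>.\<close>

definition I_hat :: "(real \<Rightarrow> 'a \<Rightarrow> real) \<Rightarrow> 'a \<Rightarrow> real" where
  "I_hat \<eta> \<omega> = (LBINT s=0..\<infinity>. exp (\<eta> s \<omega>))"

definition xi_tilde :: "(real \<Rightarrow> 'a \<Rightarrow> real) \<Rightarrow> (real \<Rightarrow> 'a \<Rightarrow> real) \<Rightarrow> real \<Rightarrow> 'a \<Rightarrow> real" where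
  "xi_tilde \<xi> \<eta> t \<omega> = (if 0 \<le> t then \<xi> t \<omega> else Lim (at_left \<bar>t\<bar>) (\<lambda>s. \<eta> s \<omega>))"

definition I_tilde :: "(real \<Rightarrow> 'a \<Rightarrow> real) \<Rightarrow> (real \<Rightarrow> 'a \<Rightarrow> real) \<Rightarrow> real \<Rightarrow> 'a \<Rightarrow> real" where
  "I_tilde \<xi> \<eta> t \<omega> = (LBINT s=-\<infinity>..ereal t. exp (xi_tilde \<xi> \<eta> s \<omega>))"

definition V_tilde :: "(real \<Rightarrow> 'a \<Rightarrow> real) \<Rightarrow> (real \<Rightarrow> 'a \<Rightarrow> real) \<Rightarrow> real \<Rightarrow> 'a \<Rightarrow> real" where
  "V_tilde \<xi> \<eta> t \<omega> = exp (- xi_tilde \<xi> \<eta> t \<omega>) * I_tilde \<xi> \<eta> t \<omega>"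

text \<open>For \<open>t < 0\<close> the interval integral from \<open>0\<close> to \<open>t\<close> is minus the integral over \<open>(t,0)\<close>.\<close>

definition A_clock :: "(real \<Rightarrow> 'a \<Rightarrow> real) \<Rightarrow> (real \<Rightarrow> 'a \<Rightarrow> real) \<Rightarrow> real \<Rightarrow> 'a \<Rightarrow> real" where
  "A_clock \<xi> \<eta> t \<omega> = (LBINT s=0..ereal t. 1 / V_tilde \<xi> \<eta> s \<omega>)"

definition T_clock :: "(real \<Rightarrow> 'a \<Rightarrow> real) \<Rightarrow> (real \<Rightarrow> 'a \<Rightarrow> real) \<Rightarrow> real \<Rightarrow> 'a \<Rightarrow> real" where
  "T_clock \<xi> \<eta> t \<omega> = inv (\<lambda>s. A_clock \<xi> \<eta> s \<omega>) t"

definition U_tilde :: "(real \<Rightarrow> 'a \<Rightarrow> real) \<Rightarrow> (real \<Rightarrow> 'a \<Rightarrow> real) \<Rightarrow> real \<Rightarrow> 'a \<Rightarrow> real" where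
  "U_tilde \<xi> \<eta> t \<omega> = 1 / V_tilde \<xi> \<eta> (T_clock \<xi> \<eta> t \<omega>) \<omega>"

definition mu_law :: "'a measure \<Rightarrow> (real \<Rightarrow> 'a \<Rightarrow> real) \<Rightarrow> real measure" where
  "mu_law M \<eta> = distr M borel (I_hat \<eta>)"

text \<open>\<open>\<nu>\<close> is represented as a measure on \<open>real\<close> that does not charge the complement of \<open>(0,\<infinity>)\<close>.\<close>

definition nu_measure :: "'a measure \<Rightarrow> (real \<Rightarrow> 'a \<Rightarrow> real) \<Rightarrow> real measure" where
  "nu_measure M \<eta> =
     distr (density (mu_law M \<eta>) (\<lambda>x. ennreal (1 / x) * indicator {0<..} x)) borel (\<lambda>x. 1 / x)"

definition Q_measure ::
    "'a measure \<Rightarrow> (real \<Rightarrow> 'a \<Rightarrow> real) \<Rightarrow> (real \<Rightarrow> 'a \<Rightarrow> real) \<Rightarrow> 'a measure" where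
  "Q_measure M \<xi> \<eta> = density M (\<lambda>\<omega>. ennreal (1 / V_tilde \<xi> \<eta> 0 \<omega>))"


text \<open>Path space consists of the cadlag functions on the whole line, with the sigma-algebra of the
  coordinate maps. It cannot be replaced by the full product space: a set in the product
  sigma-algebra depends on countably many coordinates only, so the sets there that are invariant
  under all real shifts are trivial, and ergodicity would hold for every process.\<close>

definition path_space :: "(real \<Rightarrow> real) measure" where
  "path_space = restrict_space (PiM UNIV (\<lambda>_. borel)) {w. cadlag_on UNIV w}"

definition shift :: "real \<Rightarrow> (real \<Rightarrow> real) \<Rightarrow> real \<Rightarrow> real" where
  "shift h w = (\<lambda>t. w (h + t))"

text \<open>A process whose paths are almost everywhere cadlag. The exceptional paths are not
  in path space, so the image measure sends them to the zero path; they form a null set, and the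
  completion makes this modification measurable.\<close>

definition cadlag_process :: "'a measure \<Rightarrow> (real \<Rightarrow> 'a \<Rightarrow> real) \<Rightarrow> bool" where
  "cadlag_process N Y \<longleftrightarrow>
     (\<forall>t. Y t \<in> borel_measurable N) \<and> (AE \<omega> in N. cadlag_on UNIV (\<lambda>t. Y t \<omega>))"

definition path_law :: "'a measure \<Rightarrow> (real \<Rightarrow> 'a \<Rightarrow> real) \<Rightarrow> (real \<Rightarrow> real) measure" where
  "path_law N Y = distr (completion N) path_space
     (\<lambda>\<omega>. if cadlag_on UNIV (\<lambda>t. Y t \<omega>) then (\<lambda>t. Y t \<omega>) else (\<lambda>_. 0))"

definition stationary_process :: "'a measure \<Rightarrow> (real \<Rightarrow> 'a \<Rightarrow> real) \<Rightarrow> bool" where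
  "stationary_process N Y \<longleftrightarrow>
     cadlag_process N Y \<and> (\<forall>h. distr (path_law N Y) path_space (shift h) = path_law N Y)"

definition ergodic_process :: "'a measure \<Rightarrow> (real \<Rightarrow> 'a \<Rightarrow> real) \<Rightarrow> bool" where
  "ergodic_process N Y \<longleftrightarrow>
     cadlag_process N Y \<and>
     (\<forall>B\<in>sets path_space. (\<forall>h. shift h -` B \<inter> space path_space = B) \<longrightarrow>
        B \<in> null_sets (path_law N Y) \<or> space path_space - B \<in> null_sets (path_law N Y))"

definition past :: "'a measure \<Rightarrow> (real \<Rightarrow> 'a \<Rightarrow> real) \<Rightarrow> real \<Rightarrow> 'a measure" where
  "past N Y s = sigma (space N) {Y r -` B \<inter> space N | r B. r \<le> s \<and> B \<in> sets borel}"

text \<open>The Markov property with respect to the natural filtration. The measure need not be finite;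
  its sigma-finiteness on each past is what makes the conditional expectations meaningful.\<close>

definition markov_process_with_semigroup ::
    "'a measure \<Rightarrow> (real \<Rightarrow> 'a \<Rightarrow> real) \<Rightarrow>
     (real \<Rightarrow> (real \<Rightarrow> ennreal) \<Rightarrow> real \<Rightarrow> ennreal) \<Rightarrow> bool" where
  "markov_process_with_semigroup N Y P \<longleftrightarrow>
     (\<forall>t. Y t \<in> borel_measurable N) \<and>
     (\<forall>s. sigma_finite_subalgebra N (past N Y s)) \<and>
     (\<forall>s. \<forall>t\<ge>0. \<forall>f\<in>borel_measurable borel.
        AE \<omega> in N. nn_cond_exp N (past N Y s) (\<lambda>\<omega>'. f (Y (s + t) \<omega>')) \<omega> = P t f (Y s \<omega>))"

end

theory Submission
  imports Defs
begin

text \<open>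
  The two-sided process \<open>\<xi>\<close>-tilde has stationary increments, and its flow (restart at \<open>h\<close>, subtract the
  value at \<open>h\<close>) preserves its law \<open>W\<close> on path space. The process \<open>V\<close> and the clock \<open>A\<close> are
  functionals of the path that are compatible with this flow, and \<open>A\<close> increases at speed \<open>1 / V\<close>. Running
  the path by the inverse of \<open>A\<close> is therefore the time change of a measure preserving flow, for which the
  measure with density \<open>1 / V\<close> at time \<open>0\<close> is invariant. This is why \<open>Q\<close> has that density. Stationarity
  (\<open>distr_mu_U_shift\<close>) comes from averaging over a long stretch of original time: a shift of the
  time-changed path by \<open>h\<close> moves an interval of integration by \<open>h\<close>, which costs at most
  \<open>\<bar>h\<bar>\<close>, while both integrals grow linearly. The argument never subtracts infinite quantities, so that \<open>Q\<close> may be infinite.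

  A shift-invariant set of time-changed paths pulls back to an invariant set of the flow. The flow is
  ergodic (\<open>ergodic_rebase\<close>), because the past and the future of the increments at any time are independent and
  the flow is mixing. For the ratio theorem the time change is undone: the integral of
  \<open>f (U s)\<close> over clock time equals the integral of \<open>f (1 / V s) / V s\<close> over original time. The latter is an additive
  functional of an ergodic flow with a finite invariant measure, so the theorem of Birkhoff applies to numerator and
  denominator, both taken relative to the elapsed original time (\<open>time_average\<close>).

  The total mass of \<open>Q\<close> is the mean of the clock gain over one unit of time, and this gain is
  \<open>\<xi> 1 + log V 1 - log V 0\<close>. It differs from the increment of \<open>\<xi>\<close> by a coboundary of the flow. A function
  that lies below a coboundary has nonpositive mean (\<open>integral_nonpos_of_le_coboundary\<close>), even if the
  coboundary is not integrable; applied to truncations in both directions, this gives \<open>mass_eq_mean\<close> and, together with the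
  independence of \<open>\<xi> 1\<close> and \<open>V 0\<close>, the converse \<open>integrable_of_finite_mass\<close>.

  For the Markov property stationarity moves the present to time \<open>0\<close>. There the past of the time-changed path is a
  function of \<open>\<eta>\<close>, and its future is a function of \<open>\<xi>\<close> and of the value \<open>x\<close> at time \<open>0\<close>, namely the
  Ornstein-Uhlenbeck type process started from \<open>x\<close> (\<open>ou_from_eq_U_path\<close>). Integrating out \<open>\<xi>\<close> first gives the semigroup.

  All of this needs that the exponential functional of \<open>\<eta>\<close> is finite. The drift of \<open>\<xi>\<close> may be
  infinite or undefined, so no law of large numbers is at hand. Instead a last-exit
  decomposition bounds the expected time spent in unit intervals uniformly (\<open>sum_prob_unit_interval\<close>), and the
  exponential weights of these intervals are summable.
\<close>

section \<open>Cadlag paths\<close>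

lemma cadlag_on_UNIV_iff:
  "cadlag_on UNIV w \<longleftrightarrow> (\<forall>t. (w \<longlongrightarrow> w t) (at_right t) \<and> (\<exists>l. (w \<longlongrightarrow> l) (at_left t)))"
  by (simp add: cadlag_on_def)

lemma cadlag_on_half_line_iff:
  "cadlag_on {0..} w \<longleftrightarrow>
     (\<forall>t\<ge>0. (w \<longlongrightarrow> w t) (at_right t)) \<and> (\<forall>t>0. \<exists>l. (w \<longlongrightarrow> l) (at_left t))"
proof -
  have 1: "{0..} \<inter> {t<..} = {t<..}" if "0 \<le> t" for t :: real using that by auto
  have 2: "{0..} \<inter> {..<t} = {0..<t}" for t :: real by auto
  have 3: "at t within {0..<t} = (if 0 < t then at_left t else bot)" if "0 \<le> t" for t :: real
  proof (cases "0 < t")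
    case True
    then have "at t within {0..<t} = at_left t"
      by (intro at_within_nhd[of _ "{0<..}"]) auto
    then show ?thesis using True by simp
  qed (use that in auto)
  show ?thesis
    unfolding cadlag_on_def 2
    by (auto simp: 1 3) (metis atLeast_iff less_eq_real_def)
qed

lemma cadlag_locally_bounded:
  fixes a b :: real
  assumes "cadlag_on UNIV w"
  shows "\<exists>K. \<forall>s\<in>{a..b}. \<bar>w s\<bar> \<le> K"
proof (cases "a \<le> b")
  case True
  then show ?thesis
  proof (induction rule: Bolzano)
    case (trans a b c)
    then obtain K L where "\<forall>s\<in>{a..b}. \<bar>w s\<bar> \<le> K" "\<forall>s\<in>{b..c}. \<bar>w s\<bar> \<le> L" by auto
    then have "\<forall>s\<in>{a..c}. \<bar>w s\<bar> \<le> max K L"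
      by (metis atLeastAtMost_iff le_max_iff_disj nle_le)
    then show ?case by blast
  next
    case (local x)
    obtain l where l: "(w \<longlongrightarrow> l) (at_left x)" and r: "(w \<longlongrightarrow> w x) (at_right x)"
      using assms by (auto simp: cadlag_on_UNIV_iff)
    have "eventually (\<lambda>s. \<bar>w s - l\<bar> < 1) (at_left x)"
      using tendstoD[OF l, of 1] by (simp add: dist_real_def)
    then obtain p where p: "p < x" "\<And>s. p < s \<Longrightarrow> s < x \<Longrightarrow> \<bar>w s - l\<bar> < 1"
      by (auto simp: eventually_at_left[of "x - 1"])
    have "eventually (\<lambda>s. \<bar>w s - w x\<bar> < 1) (at_right x)"
      using tendstoD[OF r, of 1] by (simp add: dist_real_def)
    then obtain q where q: "x < q" "\<And>s. x < s \<Longrightarrow> s < q \<Longrightarrow> \<bar>w s - w x\<bar> < 1"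
      by (auto simp: eventually_at_right[of x "x + 1"])
    have bound: "\<bar>w s\<bar> \<le> \<bar>l\<bar> + \<bar>w x\<bar> + 1" if "p < s" "s < q" for s
    proof -
      consider "s < x" | "s = x" | "x < s" by linarith
      then show ?thesis
      proof cases
        case 1 with p(2)[of s] that show ?thesis by linarith
      next
        case 2 then show ?thesis by simp
      next
        case 3 with q(2)[of s] that show ?thesis by linarith
      qed
    qed
    show ?case
    proof (rule exI[of _ "min (x - p) (q - x)"], intro conjI allI impI)
      show "0 < min (x - p) (q - x)" using p(1) q(1) by simp
      show "\<exists>K. \<forall>s\<in>{u..v}. \<bar>w s\<bar> \<le> K" if "u \<le> x \<and> x \<le> v \<and> v - u < min (x - p) (q - x)" for u v
        using that by (intro exI[of _ "\<bar>l\<bar> + \<bar>w x\<bar> + 1"] ballI bound) (auto simp: min_def split: if_splits)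
    qed
  qed
qed auto

lemma filterlim_dyadic_at_right:
  "filterlim (\<lambda>n. (real_of_int \<lfloor>t * real (Suc n)\<rfloor> + 1) / real (Suc n)) (at_right t) sequentially"
proof -
  let ?r = "\<lambda>n. (real_of_int \<lfloor>t * real (Suc n)\<rfloor> + 1) / real (Suc n)"
  have lower: "t < ?r n" for n
  proof -
    have "t * real (Suc n) < real_of_int \<lfloor>t * real (Suc n)\<rfloor> + 1" by linarith
    then show ?thesis by (simp add: pos_less_divide_eq del: of_nat_Suc)
  qed
  have upper: "?r n \<le> t + 1 / real (Suc n)" for n
  proof -
    have "real_of_int \<lfloor>t * real (Suc n)\<rfloor> + 1 \<le> t * real (Suc n) + 1" by linarith
    then have "?r n \<le> (t * real (Suc n) + 1) / real (Suc n)"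
      by (intro divide_right_mono) auto
    then show ?thesis by (simp add: add_divide_distrib del: of_nat_Suc)
  qed
  have "(\<lambda>n. t + 1 / real (Suc n)) \<longlonglongrightarrow> t + 0"
    by (intro tendsto_intros LIMSEQ_Suc[OF lim_1_over_n])
  then have lim: "(\<lambda>n. t + 1 / real (Suc n)) \<longlonglongrightarrow> t" by simp
  have "?r \<longlonglongrightarrow> t"
    by (rule tendsto_sandwich[OF _ _ tendsto_const lim])
       (rule always_eventually, rule allI, rule less_imp_le, rule lower, rule always_eventually, rule allI, rule upper)
  moreover have "?r n \<noteq> t" for n using lower[of n] by (rule less_imp_neq[THEN not_sym])
  ultimately show ?thesis
    unfolding filterlim_at using lower by (intro conjI always_eventually allI) (auto simp del: of_nat_Suc)
qed

text \<open>A right-continuous process is the pointwise limit of processes that are constant in time on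
  the cells of a grid, which makes it measurable jointly in time and in the sample point.\<close>

lemma right_continuous_jointly_measurable:
  fixes Z :: "real \<Rightarrow> 'a \<Rightarrow> real"
  assumes meas: "\<And>t. Z t \<in> borel_measurable N"
    and rc: "\<And>\<omega> t. \<omega> \<in> space N \<Longrightarrow> ((\<lambda>s. Z s \<omega>) \<longlongrightarrow> Z t \<omega>) (at_right t)"
  shows "(\<lambda>p. Z (fst p) (snd p)) \<in> borel_measurable (borel \<Otimes>\<^sub>M N)"
proof (rule borel_measurable_LIMSEQ_real)
  let ?r = "\<lambda>n t. (real_of_int \<lfloor>t * real (Suc n)\<rfloor> + 1) / real (Suc n)"
  show "(\<lambda>n. Z (?r n (fst p)) (snd p)) \<longlonglongrightarrow> Z (fst p) (snd p)" if "p \<in> space (borel \<Otimes>\<^sub>M N)" for p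
  proof -
    have "snd p \<in> space N" using that by (auto simp: space_pair_measure)
    from filterlim_compose[OF rc[OF this, of "fst p"] filterlim_dyadic_at_right]
    show ?thesis .
  qed
  show "(\<lambda>p. Z (?r n (fst p)) (snd p)) \<in> borel_measurable (borel \<Otimes>\<^sub>M N)" for n
  proof (rule measurable_compose_countable[where f = "\<lambda>i p. Z ((real_of_int i + 1) / real (Suc n)) (snd p)"
        and g = "\<lambda>p. \<lfloor>fst p * real (Suc n)\<rfloor>"])
    show "(\<lambda>p. Z ((real_of_int i + 1) / real (Suc n)) (snd p)) \<in> borel_measurable (borel \<Otimes>\<^sub>M N)" for i
      by (rule measurable_compose[OF measurable_snd meas])
    show "(\<lambda>p. \<lfloor>fst p * real (Suc n)\<rfloor>) \<in> (borel :: real measure) \<Otimes>\<^sub>M N \<rightarrow>\<^sub>M count_space UNIV"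
      by measurable
  qed
qed

lemma space_path_space: "space path_space = {w. cadlag_on UNIV w}"
  by (simp add: path_space_def space_restrict_space space_PiM)

lemma measurable_path_space_iff:
  "Z \<in> N \<rightarrow>\<^sub>M path_space \<longleftrightarrow>
     (\<forall>t. (\<lambda>\<omega>. Z \<omega> t) \<in> borel_measurable N) \<and> (\<forall>\<omega>\<in>space N. cadlag_on UNIV (Z \<omega>))"
proof safe
  assume Z: "Z \<in> N \<rightarrow>\<^sub>M path_space"
  fix t
  have "(\<lambda>w. w t) \<in> borel_measurable path_space"
    unfolding path_space_def by (intro measurable_restrict_space1 measurable_component_singleton) simp
  from measurable_compose[OF Z this] show "(\<lambda>\<omega>. Z \<omega> t) \<in> borel_measurable N" .
next
  fix \<omega> assume "Z \<in> N \<rightarrow>\<^sub>M path_space" "\<omega> \<in> space N"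
  then have "Z \<omega> \<in> space path_space" by (rule measurable_space)
  then show "cadlag_on UNIV (Z \<omega>)" by (simp add: space_path_space)
next
  assume "\<forall>t. (\<lambda>\<omega>. Z \<omega> t) \<in> borel_measurable N" "\<forall>\<omega>\<in>space N. cadlag_on UNIV (Z \<omega>)"
  then show "Z \<in> N \<rightarrow>\<^sub>M path_space"
    unfolding path_space_def
    by (intro measurable_restrict_space2 measurable_PiM_single') auto
qed

lemma eval_measurable: "(\<lambda>w. w t) \<in> borel_measurable path_space"
  using measurable_path_space_iff[of "\<lambda>w. w" path_space] by auto

lemma eval_jointly_measurable:
  assumes Z: "Z \<in> N \<rightarrow>\<^sub>M path_space" and t: "t \<in> borel_measurable N"
  shows "(\<lambda>\<omega>. Z \<omega> (t \<omega>)) \<in> borel_measurable N"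
proof -
  have "(\<lambda>p. (snd p) (fst p)) \<in> borel_measurable (borel \<Otimes>\<^sub>M path_space)"
    by (rule right_continuous_jointly_measurable[where Z = "\<lambda>t w. w t"])
       (auto simp: space_path_space cadlag_on_UNIV_iff intro: eval_measurable)
  from measurable_compose[OF measurable_Pair[OF t Z] this] show ?thesis by simp
qed

lemma cadlag_borel_measurable:
  assumes "cadlag_on UNIV w" shows "w \<in> borel_measurable borel"
proof -
  have "(\<lambda>_. w) \<in> (borel :: real measure) \<rightarrow>\<^sub>M path_space"
    using assms by (intro measurable_const) (simp add: space_path_space)
  from eval_jointly_measurable[OF this measurable_ident] show ?thesis by (simp add: id_def)
qed

lemma filterlim_plus_at_right:
  fixes h t :: real shows "filterlim (\<lambda>s. h + s) (at_right (h + t)) (at_right t)"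
proof -
  have "((\<lambda>s. h + s) \<longlongrightarrow> h + t) (at_right t)" by (intro tendsto_intros)
  then show ?thesis by (simp add: filterlim_at eventually_at_filter)
qed

lemma filterlim_plus_at_left:
  fixes h t :: real shows "filterlim (\<lambda>s. h + s) (at_left (h + t)) (at_left t)"
proof -
  have "((\<lambda>s. h + s) \<longlongrightarrow> h + t) (at_left t)" by (intro tendsto_intros)
  then show ?thesis by (simp add: filterlim_at eventually_at_filter)
qed

lemma cadlag_shift: "cadlag_on UNIV w \<Longrightarrow> cadlag_on UNIV (\<lambda>t. w (h + t))"
  unfolding cadlag_on_UNIV_iff
  using filterlim_compose[OF _ filterlim_plus_at_left] filterlim_compose[OF _ filterlim_plus_at_right]
  by fast

lemma cadlag_diff_const: "cadlag_on UNIV w \<Longrightarrow> cadlag_on UNIV (\<lambda>t. w t - c)"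
  unfolding cadlag_on_UNIV_iff using tendsto_diff[OF _ tendsto_const] by fast

lemma shift_jointly_measurable:
  assumes Z: "Z \<in> N \<rightarrow>\<^sub>M path_space" and h: "h \<in> borel_measurable N"
  shows "(\<lambda>\<omega>. shift (h \<omega>) (Z \<omega>)) \<in> N \<rightarrow>\<^sub>M path_space"
  unfolding measurable_path_space_iff[of _ N] shift_def
proof safe
  show "(\<lambda>\<omega>. Z \<omega> (h \<omega> + t)) \<in> borel_measurable N" for t
    by (rule eval_jointly_measurable[OF Z]) (use h in measurable)
  show "cadlag_on UNIV (\<lambda>t. Z \<omega> (h \<omega> + t))" if "\<omega> \<in> space N" for \<omega>
    using measurable_space[OF Z that] by (simp add: space_path_space cadlag_shift)
qed

lemma shift_measurable[measurable]: "shift h \<in> path_space \<rightarrow>\<^sub>M path_space"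
  using shift_jointly_measurable[of "\<lambda>w. w" path_space "\<lambda>_. h"] by simp

text \<open>The flow of the increments: the path is restarted at \<open>h\<close> and its value there is subtracted.\<close>

definition rebase :: "real \<Rightarrow> (real \<Rightarrow> real) \<Rightarrow> real \<Rightarrow> real" where
  "rebase h w = (\<lambda>t. w (h + t) - w h)"

lemma rebase_rebase: "rebase h (rebase k w) = rebase (k + h) w"
  by (auto simp: rebase_def add.assoc)

lemma rebase_jointly_measurable:
  assumes Z: "Z \<in> N \<rightarrow>\<^sub>M path_space" and h: "h \<in> borel_measurable N"
  shows "(\<lambda>\<omega>. rebase (h \<omega>) (Z \<omega>)) \<in> N \<rightarrow>\<^sub>M path_space"
  unfolding measurable_path_space_iff[of _ N] rebase_def
proof safe
  show "(\<lambda>\<omega>. Z \<omega> (h \<omega> + t) - Z \<omega> (h \<omega>)) \<in> borel_measurable N" for t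
    by (intro borel_measurable_diff eval_jointly_measurable[OF Z]) (use h in measurable)
  show "cadlag_on UNIV (\<lambda>t. Z \<omega> (h \<omega> + t) - Z \<omega> (h \<omega>))" if "\<omega> \<in> space N" for \<omega>
    using measurable_space[OF Z that] by (simp add: space_path_space cadlag_shift cadlag_diff_const)
qed

lemma rebase_measurable[measurable]: "rebase h \<in> path_space \<rightarrow>\<^sub>M path_space"
  using rebase_jointly_measurable[of "\<lambda>w. w" path_space "\<lambda>_. h"] by simp

section \<open>Path functionals\<close>

text \<open>The processes of the statement depend on the sample point only through the path of the two-sided
  process. As functionals of a path they can be studied one path at a time.\<close>

definition past_exp :: "(real \<Rightarrow> real) \<Rightarrow> real \<Rightarrow> real" where
  "past_exp w t = (LBINT s=-\<infinity>..ereal t. exp (w s))"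

definition V_path :: "(real \<Rightarrow> real) \<Rightarrow> real \<Rightarrow> real" where
  "V_path w t = exp (- w t) * past_exp w t"

definition A_path :: "(real \<Rightarrow> real) \<Rightarrow> real \<Rightarrow> real" where
  "A_path w t = (LBINT s=0..ereal t. 1 / V_path w s)"

definition T_path :: "(real \<Rightarrow> real) \<Rightarrow> real \<Rightarrow> real" where
  "T_path w t = inv (A_path w) t"

definition U_path :: "(real \<Rightarrow> real) \<Rightarrow> real \<Rightarrow> real" where
  "U_path w t = 1 / V_path w (T_path w t)"

lemma past_exp_eq_integral: "past_exp w t = (LINT s|lborel. indicator {..<t} s * exp (w s))"
proof -
  have "einterval (-\<infinity>) (ereal t) = {..<t}" by (auto simp: einterval_def)
  then show ?thesis
    unfolding past_exp_def by (simp add: interval_lebesgue_integral_le_eq set_lebesgue_integral_def)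
qed

lemma past_exp_cong: "(\<And>s. s < t \<Longrightarrow> w s = w' s) \<Longrightarrow> past_exp w t = past_exp w' t"
  unfolding past_exp_eq_integral
  by (intro Bochner_Integration.integral_cong refl) (simp add: indicator_def)

lemma V_path_cong:
  assumes "\<And>s. s \<le> t \<Longrightarrow> w s = w' s" shows "V_path w t = V_path w' t"
  using past_exp_cong[of t w w'] assms by (simp add: V_path_def)

lemma past_exp_nonneg: "0 \<le> past_exp w t"
  unfolding past_exp_eq_integral by (rule Bochner_Integration.integral_nonneg) (simp add: indicator_def)

lemma past_exp_rebase: "past_exp (rebase h w) t = exp (- w h) * past_exp w (h + t)"
proof -
  have "past_exp w (h + t) = (LINT s|lborel. indicator {..<h + t} (h + s) * exp (w (h + s)))"
    unfolding past_exp_eq_integral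
    by (subst lborel_integral_real_affine[where c = 1 and t = h]) auto
  moreover have "(\<lambda>s. indicator {..<h + t} (h + s) :: real) = indicator {..<t}"
    by (auto simp: indicator_def)
  ultimately have "past_exp w (h + t) = (LINT s|lborel. indicator {..<t} s * exp (w (h + s)))"
    by (simp add: fun_eq_iff)
  then show ?thesis
    unfolding past_exp_eq_integral rebase_def
    by (simp add: exp_diff exp_minus field_simps)
qed

lemma V_path_rebase: "V_path (rebase h w) t = V_path w (h + t)"
  by (simp add: V_path_def past_exp_rebase) (simp add: rebase_def flip: exp_add)

lemma past_exp_measurable:
  assumes Z: "Z \<in> N \<rightarrow>\<^sub>M path_space" and t[measurable]: "t \<in> borel_measurable N"
  shows "(\<lambda>\<omega>. past_exp (Z \<omega>) (t \<omega>)) \<in> borel_measurable N"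
  unfolding past_exp_eq_integral
proof (rule lborel.borel_measurable_lebesgue_integral)
  have [measurable]: "(\<lambda>p. Z (fst p) (snd p)) \<in> borel_measurable (N \<Otimes>\<^sub>M lborel)"
    by (rule eval_jointly_measurable[where Z = "\<lambda>p. Z (fst p)"]) (use Z in measurable)
  have "(\<lambda>p. indicator {..<t (fst p)} (snd p) * exp (Z (fst p) (snd p)))
      = (\<lambda>p. (if snd p < t (fst p) then 1 else 0) * exp (Z (fst p) (snd p)))"
    by (auto simp: indicator_def)
  also have "\<dots> \<in> borel_measurable (N \<Otimes>\<^sub>M lborel)" by measurable
  finally show "(\<lambda>(\<omega>, s). indicator {..<t \<omega>} s * exp (Z \<omega> s)) \<in> borel_measurable (N \<Otimes>\<^sub>M lborel)"
    by (simp add: split_beta')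
qed

lemma V_path_measurable:
  assumes Z: "Z \<in> N \<rightarrow>\<^sub>M path_space" and t: "t \<in> borel_measurable N"
  shows "(\<lambda>\<omega>. V_path (Z \<omega>) (t \<omega>)) \<in> borel_measurable N"
proof -
  note [measurable] = past_exp_measurable[OF Z t] eval_jointly_measurable[OF Z t]
  show ?thesis unfolding V_path_def by measurable
qed

text \<open>A quadratic bound on the increments makes the derivative vanish.\<close>

lemma square_bound_imp_constant:
  fixes H :: "real \<Rightarrow> real"
  assumes "a \<le> b" and bound: "\<And>s t. a \<le> s \<Longrightarrow> s \<le> t \<Longrightarrow> t \<le> b \<Longrightarrow> \<bar>H t - H s\<bar> \<le> C * (t - s)\<^sup>2"
  shows "H b = H a"
proof -
  have "(H has_derivative (\<lambda>_. 0)) (at x within {a..b})" if x: "x \<in> {a..b}" for x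
  proof (rule has_derivativeI_sandwich[where e = 1 and H = "\<lambda>y. C * \<bar>y - x\<bar>"])
    show "norm (H y - H x - 0) / norm (y - x) \<le> C * \<bar>y - x\<bar>" if "y \<in> {a..b}" "y \<noteq> x" for y
    proof -
      have "\<bar>H y - H x\<bar> \<le> C * (y - x)\<^sup>2"
      proof (cases "x \<le> y")
        case True then show ?thesis using bound[of x y] x that by auto
      next
        case False
        then show ?thesis using bound[of y x] x that by (auto simp: abs_minus_commute power2_commute)
      qed
      also have "\<dots> = C * \<bar>y - x\<bar> * \<bar>y - x\<bar>" by (simp add: power2_eq_square mult.assoc flip: abs_mult)
      finally show ?thesis using that by (simp add: divide_le_eq)
    qed
    have "((\<lambda>y. C * \<bar>y - x\<bar>) \<longlongrightarrow> C * \<bar>x - x\<bar>) (at x within {a..b})" by (intro tendsto_intros)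
    then show "((\<lambda>y. C * \<bar>y - x\<bar>) \<longlongrightarrow> 0) (at x within {a..b})" by simp
  qed auto
  from has_derivative_zero_constant[OF _ this] obtain c where "\<And>x. x \<in> {a..b} \<Longrightarrow> H x = c"
    by (auto simp: convex_box)
  then show ?thesis using \<open>a \<le> b\<close> by simp
qed

lemma cadlag_exp_integrable_Ioc:
  assumes "cadlag_on UNIV w" shows "set_integrable lborel {a<..b} (\<lambda>s. exp (w s))"
proof -
  obtain K where K: "\<forall>s\<in>{a..b}. \<bar>w s\<bar> \<le> K" using cadlag_locally_bounded[OF assms] by blast
  have [measurable]: "w \<in> borel_measurable borel" by (rule cadlag_borel_measurable[OF assms])
  show ?thesis
    unfolding set_integrable_def
  proof (rule integrableI_bounded_set_indicator[where B = "exp K"])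
    show "emeasure lborel {a<..b} < \<infinity>" by (cases "a \<le> b") auto
  qed (use K in \<open>auto simp: abs_le_iff\<close>)
qed

text \<open>Paths for which \<open>V\<close> is finite and positive at all times.\<close>

locale summable_past =
  fixes w :: "real \<Rightarrow> real"
  assumes cadlag: "cadlag_on UNIV w"
    and integrable_past_0: "set_integrable lborel {..0} (\<lambda>s. exp (w s))"
begin

lemma w_measurable[measurable]: "w \<in> borel_measurable borel"
  by (rule cadlag_borel_measurable[OF cadlag])

lemma set_integrable_Ioc_of_bounded:
  fixes f :: "real \<Rightarrow> real"
  assumes [measurable]: "f \<in> borel_measurable borel" and K: "\<And>s. s \<in> {a..b} \<Longrightarrow> \<bar>f s\<bar> \<le> K"
  shows "set_integrable lborel {a<..b} f"
  unfolding set_integrable_def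
proof (rule integrableI_bounded_set_indicator[where B = K])
  show "emeasure lborel {a<..b} < \<infinity>"
    by (cases "a \<le> b") auto
qed (use K in auto)

lemmas exp_integrable_Ioc = cadlag_exp_integrable_Ioc[OF cadlag]

lemma exp_integrable_Iic: "set_integrable lborel {..t} (\<lambda>s. exp (w s))"
proof (cases "t \<le> 0")
  case True
  show ?thesis by (rule set_integrable_subset[OF integrable_past_0]) (use True in auto)
next
  case False
  then have "{..t} = {..0} \<union> {0<..t}" by auto
  then show ?thesis using set_integrable_Un[OF integrable_past_0 exp_integrable_Ioc] by simp
qed

lemma past_exp_eq: "past_exp w t = (LINT s:{..t}|lborel. exp (w s))"
proof -
  have "past_exp w t = (LINT s:{..<t}|lborel. exp (w s))"
    by (simp add: past_exp_eq_integral set_lebesgue_integral_def)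
  also have "\<dots> = (LINT s:{..t}|lborel. exp (w s))"
    using AE_lborel_singleton[of t]
    by (intro set_integral_cong_set) (auto simp: set_borel_measurable_def elim!: eventually_mono)
  finally show ?thesis .
qed

lemma past_exp_diff: "a \<le> b \<Longrightarrow> past_exp w b - past_exp w a = (LINT s:{a<..b}|lborel. exp (w s))"
proof -
  assume "a \<le> b"
  then have "{..b} = {..a} \<union> {a<..b}" by auto
  moreover have "{..a} \<inter> {a<..b} = {}" by auto
  ultimately show ?thesis
    using set_integral_Un[OF _ exp_integrable_Iic exp_integrable_Ioc, of a a b] by (simp add: past_exp_eq)
qed

lemma past_exp_local_bounds:
  obtains K where "0 < K"
    and "\<And>a b. c \<le> a \<Longrightarrow> a \<le> b \<Longrightarrow> b \<le> d \<Longrightarrow> (b - a) / K \<le> past_exp w b - past_exp w a"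
    and "\<And>a b. c \<le> a \<Longrightarrow> a \<le> b \<Longrightarrow> b \<le> d \<Longrightarrow> past_exp w b - past_exp w a \<le> K * (b - a)"
proof -
  obtain L where L: "\<forall>s\<in>{c..d}. \<bar>w s\<bar> \<le> L" using cadlag_locally_bounded[OF cadlag] by blast
  have const: "(LINT s:{a<..b}|lborel. C) = C * (b - a)" if "a \<le> b" for a b C :: real
    using that by (simp add: set_lebesgue_integral_def)
  have cint: "set_integrable lborel {a<..b} (\<lambda>_. C)" for a b C :: real
    by (rule set_integrable_Ioc_of_bounded[where K = "\<bar>C\<bar>"]) auto
  have bd: "exp (- L) \<le> exp (w s)" "exp (w s) \<le> exp L" if "c \<le> s" "s \<le> d" for s
    using L that by (auto simp: abs_le_iff minus_le_iff)
  have 1: "(LINT s:{a<..b}|lborel. exp (- L)) \<le> (LINT s:{a<..b}|lborel. exp (w s))"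
    if "c \<le> a" "b \<le> d" for a b
    by (rule set_integral_mono[OF cint exp_integrable_Ioc]) (use bd that in auto)
  have 2: "(LINT s:{a<..b}|lborel. exp (w s)) \<le> (LINT s:{a<..b}|lborel. exp L)"
    if "c \<le> a" "b \<le> d" for a b
    by (rule set_integral_mono[OF exp_integrable_Ioc cint]) (use bd that in auto)
  show thesis
  proof (rule that[of "exp L"])
    show "(b - a) / exp L \<le> past_exp w b - past_exp w a" if "c \<le> a" "a \<le> b" "b \<le> d" for a b
      using 1[of a b] that by (simp add: past_exp_diff const exp_minus field_simps)
    show "past_exp w b - past_exp w a \<le> exp L * (b - a)" if "c \<le> a" "a \<le> b" "b \<le> d" for a b
      using 2[of a b] that by (simp add: past_exp_diff const)
  qed simp
qed

lemma past_exp_strict_mono: "a < b \<Longrightarrow> past_exp w a < past_exp w b"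
proof -
  assume ab: "a < b"
  obtain K where "0 < K" "(b - a) / K \<le> past_exp w b - past_exp w a"
    using past_exp_local_bounds[of a b] ab by (metis order.refl less_imp_le)
  moreover have "0 < (b - a) / K" using ab \<open>0 < K\<close> by simp
  ultimately show ?thesis by linarith
qed

lemma past_exp_mono: "a \<le> b \<Longrightarrow> past_exp w a \<le> past_exp w b"
  using past_exp_strict_mono[of a b] by (cases "a = b") auto

lemma past_exp_pos: "0 < past_exp w t"
  using past_exp_strict_mono[of "t - 1" t] past_exp_nonneg[of w "t - 1"] by simp

lemma past_exp_nonzero[simp]: "past_exp w t \<noteq> 0"
  using past_exp_pos[of t] by simp

lemma isCont_past_exp: "isCont (past_exp w) t"
proof -
  obtain K where K: "0 < K"
    "\<And>a b. t - 1 \<le> a \<Longrightarrow> a \<le> b \<Longrightarrow> b \<le> t + 1 \<Longrightarrow> past_exp w b - past_exp w a \<le> K * (b - a)"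
    using past_exp_local_bounds[of "t - 1" "t + 1"] by metis
  have "\<bar>past_exp w s - past_exp w t\<bar> \<le> K * \<bar>s - t\<bar>" if "\<bar>s - t\<bar> < 1" for s
  proof (cases "s \<le> t")
    case True
    then show ?thesis using K(2)[of s t] past_exp_mono[of s t] that by auto
  next
    case False
    then show ?thesis using K(2)[of t s] past_exp_mono[of t s] that by auto
  qed
  moreover have "eventually (\<lambda>s. \<bar>s - t\<bar> < 1) (at t)"
    by (rule eventually_at_topological[THEN iffD2], rule exI[of _ "ball t 1"])
       (auto simp: dist_real_def)
  ultimately have ev: "eventually (\<lambda>s. norm (past_exp w s - past_exp w t) \<le> K * \<bar>s - t\<bar>) (at t)"
    by (auto elim!: eventually_mono)
  have "((\<lambda>s. K * \<bar>s - t\<bar>) \<longlongrightarrow> K * \<bar>t - t\<bar>) (at t)" by (intro tendsto_intros)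
  then have "((\<lambda>s. K * \<bar>s - t\<bar>) \<longlongrightarrow> 0) (at t)" by simp
  from Lim_null_comparison[OF ev this] show ?thesis
    by (simp add: isCont_def LIM_zero_iff)
qed

lemma past_exp_at_bot: "(past_exp w \<longlongrightarrow> 0) at_bot"
proof -
  have "(\<lambda>n. LINT s:{..- real n}|lborel. exp (w s)) \<longlonglongrightarrow> (LINT s:(\<Inter>n. {..- real n})|lborel. exp (w s))"
    by (rule set_integral_cont_down) (use exp_integrable_Iic in \<open>auto simp: decseq_def\<close>)
  moreover have "(\<Inter>n. {..- real n}) = {}"
  proof -
    have "x \<notin> (\<Inter>n. {..- real n})" for x
      using reals_Archimedean2[of "- x"] by (auto simp: not_le minus_less_iff)
    then show ?thesis by blast
  qed
  ultimately have lim: "(\<lambda>n. past_exp w (- real n)) \<longlonglongrightarrow> 0"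
    by (simp add: past_exp_eq set_lebesgue_integral_def)
  show ?thesis
  proof (rule tendstoI)
    fix e :: real assume "0 < e"
    from tendstoD[OF lim this] obtain n where "\<bar>past_exp w (- real n)\<bar> < e"
      by (auto simp: eventually_sequentially dist_real_def)
    then have n: "past_exp w (- real n) < e" by simp
    have "eventually (\<lambda>s. s \<le> - real n) at_bot" by (rule eventually_le_at_bot)
    then show "eventually (\<lambda>s. dist (past_exp w s) 0 < e) at_bot"
    proof eventually_elim
      case (elim s)
      then show ?case using past_exp_mono[of s "- real n"] n past_exp_nonneg[of w s] by (simp add: dist_real_def)
    qed
  qed
qed

lemma V_path_pos: "0 < V_path w t"
  by (simp add: V_path_def past_exp_pos)

lemma inverse_V_path: "1 / V_path w t = exp (w t) / past_exp w t"
  by (simp add: V_path_def exp_minus field_simps)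

lemma past_exp_measurable_time[measurable]: "past_exp w \<in> borel_measurable borel"
  by (rule borel_measurable_continuous_onI) (simp add: continuous_at_imp_continuous_on isCont_past_exp)

lemma V_path_measurable_time[measurable]: "V_path w \<in> borel_measurable borel"
  unfolding V_path_def[abs_def] by measurable

lemma inverse_V_path_integrable: "set_integrable lborel {a<..b} (\<lambda>s. 1 / V_path w s)"
proof -
  obtain K where K: "\<forall>s\<in>{a..b}. \<bar>w s\<bar> \<le> K" using cadlag_locally_bounded[OF cadlag] by blast
  have "\<bar>1 / V_path w s\<bar> \<le> exp K / past_exp w a" if "s \<in> {a..b}" for s
  proof -
    have "exp (w s) \<le> exp K" using K that by (auto simp: abs_le_iff)
    then have "exp (w s) / past_exp w s \<le> exp K / past_exp w a"
      using past_exp_mono[of a s] past_exp_pos[of a] that by (intro frac_le) auto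
    then show ?thesis using V_path_pos[of s] by (simp add: inverse_V_path past_exp_nonneg)
  qed
  then show ?thesis by (intro set_integrable_Ioc_of_bounded) auto
qed

text \<open>The integrand has jumps, so the two sides are compared through their increments: over a
  short interval both lie between the increment of \<^const>\<open>past_exp\<close> divided by its largest
  and by its smallest value, hence they differ by a quadratic error.\<close>

lemma integral_inverse_V_path:
  assumes "a \<le> b"
  shows "(LINT s:{a<..b}|lborel. 1 / V_path w s) = ln (past_exp w b) - ln (past_exp w a)"
proof -
  let ?I = "past_exp w"
  let ?J = "\<lambda>s t. LINT r:{s<..t}|lborel. 1 / V_path w r"
  let ?H = "\<lambda>t. ?J a t - ln (?I t)"
  obtain K where K: "0 < K" "\<And>s t. a \<le> s \<Longrightarrow> s \<le> t \<Longrightarrow> t \<le> b \<Longrightarrow> ?I t - ?I s \<le> K * (t - s)"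
    using past_exp_local_bounds[of a b] by metis
  have "\<bar>?H t - ?H s\<bar> \<le> (K\<^sup>2 / (?I a)\<^sup>2) * (t - s)\<^sup>2" if st: "a \<le> s" "s \<le> t" "t \<le> b" for s t
  proof -
    have pos: "0 < ?I a" "0 < ?I s" "0 < ?I t" by (rule past_exp_pos)+
    have mono: "?I a \<le> ?I s" "?I s \<le> ?I t" using past_exp_mono st by auto
    have "{a<..t} = {a<..s} \<union> {s<..t}" using st by auto
    then have J: "?J a t - ?J a s = ?J s t"
      using set_integral_Un[OF _ inverse_V_path_integrable inverse_V_path_integrable, of a s s t] by simp
    have "(LINT r:{s<..t}|lborel. exp (w r) / ?I t) \<le> ?J s t"
      by (rule set_integral_mono[OF set_integrable_divide[OF exp_integrable_Ioc] inverse_V_path_integrable])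
         (auto simp: inverse_V_path intro!: divide_left_mono past_exp_mono mult_pos_pos past_exp_pos)
    then have J1: "(?I t - ?I s) / ?I t \<le> ?J s t" using st by (simp add: past_exp_diff)
    have "?J s t \<le> (LINT r:{s<..t}|lborel. exp (w r) / ?I s)"
      by (rule set_integral_mono[OF inverse_V_path_integrable set_integrable_divide[OF exp_integrable_Ioc]])
         (auto simp: inverse_V_path intro!: divide_left_mono past_exp_mono mult_pos_pos past_exp_pos)
    then have J2: "?J s t \<le> (?I t - ?I s) / ?I s" using st by (simp add: past_exp_diff)
    have "ln (?I t / ?I s) \<le> ?I t / ?I s - 1" using pos by (intro ln_le_minus_one) simp
    then have L2: "ln (?I t) - ln (?I s) \<le> (?I t - ?I s) / ?I s"
      using pos by (simp add: ln_div diff_divide_distrib)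
    have "ln (?I s / ?I t) \<le> ?I s / ?I t - 1" using pos by (intro ln_le_minus_one) simp
    then have L1: "(?I t - ?I s) / ?I t \<le> ln (?I t) - ln (?I s)"
      using pos by (simp add: ln_div diff_divide_distrib)
    have "\<bar>?H t - ?H s\<bar> \<le> (?I t - ?I s) / ?I s - (?I t - ?I s) / ?I t"
      using J J1 J2 L1 L2 by linarith
    also have "\<dots> = (?I t - ?I s)\<^sup>2 / (?I s * ?I t)"
      using pos by (simp add: field_simps power2_eq_square)
    also have "\<dots> \<le> (K * (t - s))\<^sup>2 / (?I a * ?I a)"
      using K(2)[OF st] mono pos by (intro frac_le power_mono mult_mono) auto
    finally show ?thesis by (simp add: power2_eq_square field_simps)
  qed
  from square_bound_imp_constant[OF assms this] have "?H b = ?H a" by simp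
  then show ?thesis by (simp add: set_lebesgue_integral_def)
qed

lemma A_path_eq: "A_path w t = ln (past_exp w t) - ln (past_exp w 0)"
proof (cases "0 \<le> t")
  case True
  then have "A_path w t = (LINT s:{0<..t}|lborel. 1 / V_path w s)"
    unfolding A_path_def zero_ereal_def by (rule interval_integral_Ioc)
  then show ?thesis using integral_inverse_V_path[OF True] by simp
next
  case False
  then have "A_path w t = - (LINT s:{t<..0}|lborel. 1 / V_path w s)"
    unfolding A_path_def zero_ereal_def
    by (subst interval_integral_endpoints_reverse, subst interval_integral_Ioc) auto
  then show ?thesis using integral_inverse_V_path[of t 0] False by simp
qed

lemma A_path_strict_mono: "strict_mono (A_path w)"
  by (rule strict_monoI) (simp add: A_path_eq past_exp_strict_mono past_exp_pos)

lemma isCont_A_path: "isCont (A_path w) t"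
proof -
  have "isCont (\<lambda>t. ln (past_exp w t) - ln (past_exp w 0)) t"
    by (intro continuous_intros isCont_past_exp) simp
  then show ?thesis by (simp add: A_path_eq[abs_def])
qed

lemma A_path_unbounded_below: "\<exists>s. A_path w s < t"
proof -
  have "0 < exp t * past_exp w 0" by (simp add: past_exp_pos)
  from order_tendstoD(2)[OF past_exp_at_bot this] obtain s where "past_exp w s < exp t * past_exp w 0"
    using eventually_happens'[OF trivial_limit_at_bot_linorder] by blast
  then have "ln (past_exp w s) < ln (exp t * past_exp w 0)"
    by (simp add: past_exp_pos)
  then have "ln (past_exp w s) < t + ln (past_exp w 0)"
    by (simp add: ln_mult past_exp_pos)
  then show ?thesis by (auto simp: A_path_eq intro!: exI[of _ s])
qed

lemma A_path_attains_iff: "(\<exists>s. A_path w s = t) \<longleftrightarrow> (\<exists>n::nat. t < A_path w (real n))"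
proof
  assume "\<exists>s. A_path w s = t"
  then obtain s where s: "A_path w s = t" by blast
  obtain n :: nat where "s < real n" using reals_Archimedean2 by blast
  then show "\<exists>n::nat. t < A_path w (real n)"
    using s strict_monoD[OF A_path_strict_mono, of s "real n"] by blast
next
  assume "\<exists>n::nat. t < A_path w (real n)"
  then obtain n :: nat where n: "t < A_path w (real n)" by blast
  obtain s where s: "A_path w s < t" using A_path_unbounded_below by blast
  have "s \<le> real n" using n s strict_mono_less[OF A_path_strict_mono, of s "real n"] by linarith
  then show "\<exists>s. A_path w s = t"
    using IVT[of "A_path w" s t "real n"] n s isCont_A_path by auto
qed

lemma T_path_eqI: "A_path w s = t \<Longrightarrow> T_path w t = s"
  unfolding T_path_def
  using strict_mono_imp_inj_on[OF A_path_strict_mono] by (auto simp: inv_f_f)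

end

text \<open>Paths whose clock is a bijection of the real line.\<close>

locale clock_path = summable_past +
  assumes past_exp_at_top: "filterlim (past_exp w) at_top at_top"
begin

lemma A_path_surj: "\<exists>s. A_path w s = t"
proof -
  have "filterlim (\<lambda>n. past_exp w (real n)) at_top sequentially"
    by (rule filterlim_compose[OF past_exp_at_top filterlim_real_sequentially])
  then obtain n :: nat where n: "exp t * past_exp w 0 < past_exp w (real n)"
    by (auto simp: filterlim_at_top_dense eventually_sequentially)
  moreover have "0 < exp t * past_exp w 0" by (simp add: past_exp_pos)
  ultimately have "ln (exp t * past_exp w 0) < ln (past_exp w (real n))"
    by simp
  then have "t < A_path w (real n)" by (simp add: ln_mult past_exp_pos A_path_eq)
  then show ?thesis unfolding A_path_attains_iff by blast
qed

lemma A_T_path[simp]: "A_path w (T_path w t) = t"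
  using A_path_surj[of t] T_path_eqI by metis

lemma T_A_path[simp]: "T_path w (A_path w s) = s"
  by (rule T_path_eqI) simp

lemma A_path_zero[simp]: "A_path w 0 = 0" by (simp add: A_path_eq)

lemma T_path_zero[simp]: "T_path w 0 = 0" by (rule T_path_eqI) simp

lemma T_path_less_iff: "T_path w s < T_path w t \<longleftrightarrow> s < t"
  using strict_mono_less[OF A_path_strict_mono, of "T_path w s" "T_path w t"] by simp

lemma T_path_le_iff: "T_path w s \<le> T_path w t \<longleftrightarrow> s \<le> t"
  by (metis T_path_less_iff not_less)

lemma past_exp_T_path: "past_exp w (T_path w t) = exp t * past_exp w 0"
proof -
  have "ln (past_exp w (T_path w t)) = t + ln (past_exp w 0)"
    using A_T_path[of t] by (simp only: A_path_eq)
  then have "exp (ln (past_exp w (T_path w t))) = exp (t + ln (past_exp w 0))" by simp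
  then show ?thesis by (simp add: exp_add past_exp_pos)
qed

lemma isCont_T_path: "isCont (T_path w) t"
proof -
  have "isCont (T_path w) (A_path w (T_path w t))"
    by (rule isCont_inverse_function2[of "T_path w t - 1" _ "T_path w t + 1"])
       (auto simp: isCont_A_path)
  then show ?thesis by simp
qed

lemma T_path_at_top: "filterlim (T_path w) at_top at_top"
  unfolding filterlim_at_top
proof safe
  fix z
  show "eventually (\<lambda>t. z \<le> T_path w t) at_top"
    using eventually_ge_at_top[of "A_path w z"]
  proof eventually_elim
    case (elim t)
    then show ?case using T_path_le_iff[of "A_path w z" t] by simp
  qed
qed

lemma U_path_eq: "U_path w t = exp (w (T_path w t)) / (exp t * past_exp w 0)"
  by (simp add: U_path_def inverse_V_path past_exp_T_path)

lemma U_path_pos: "0 < U_path w t"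
  by (simp add: U_path_eq past_exp_pos)

lemma U_path_zero: "U_path w 0 = 1 / V_path w 0"
  by (simp add: U_path_def)

lemma U_path_A_path: "U_path w (A_path w s) = 1 / V_path w s"
  by (simp add: U_path_def)

lemma filterlim_T_path_at_right: "filterlim (T_path w) (at_right (T_path w t)) (at_right t)"
proof -
  have "(T_path w \<longlongrightarrow> T_path w t) (at_right t)"
    using isCont_T_path[of t] by (simp add: isCont_def filterlim_at_split)
  moreover have "eventually (\<lambda>s. T_path w s \<in> {T_path w t<..} \<and> T_path w s \<noteq> T_path w t) (at_right t)"
    unfolding eventually_at_filter
    by (rule always_eventually) (auto simp: T_path_less_iff dest: arg_cong[where f = "A_path w"])
  ultimately show ?thesis by (simp add: filterlim_at)
qed

lemma filterlim_T_path_at_left: "filterlim (T_path w) (at_left (T_path w t)) (at_left t)"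
proof -
  have "(T_path w \<longlongrightarrow> T_path w t) (at_left t)"
    using isCont_T_path[of t] by (simp add: isCont_def filterlim_at_split)
  moreover have "eventually (\<lambda>s. T_path w s \<in> {..<T_path w t} \<and> T_path w s \<noteq> T_path w t) (at_left t)"
    unfolding eventually_at_filter
    by (rule always_eventually) (auto simp: T_path_less_iff dest: arg_cong[where f = "A_path w"])
  ultimately show ?thesis by (simp add: filterlim_at)
qed

lemma cadlag_U_path: "cadlag_on UNIV (U_path w)"
proof -
  have U: "U_path w = (\<lambda>t. exp (w (T_path w t)) / (exp t * past_exp w 0))"
    by (simp add: fun_eq_iff U_path_eq)
  have nz: "exp t * past_exp w 0 \<noteq> 0" for t using past_exp_pos[of 0] by simp
  show ?thesis
    unfolding cadlag_on_UNIV_iff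
  proof safe
    fix t
    have "((\<lambda>s. w (T_path w s)) \<longlongrightarrow> w (T_path w t)) (at_right t)"
      using cadlag by (intro filterlim_compose[OF _ filterlim_T_path_at_right]) (simp add: cadlag_on_UNIV_iff)
    then show "(U_path w \<longlongrightarrow> U_path w t) (at_right t)"
      unfolding U by (intro tendsto_intros nz)
    obtain l where "(w \<longlongrightarrow> l) (at_left (T_path w t))" using cadlag by (auto simp: cadlag_on_UNIV_iff)
    from filterlim_compose[OF this filterlim_T_path_at_left]
    have "((\<lambda>s. w (T_path w s)) \<longlongrightarrow> l) (at_left t)" .
    then have "(U_path w \<longlongrightarrow> exp l / (exp t * past_exp w 0)) (at_left t)"
      unfolding U by (intro tendsto_intros nz)
    then show "\<exists>l. (U_path w \<longlongrightarrow> l) (at_left t)" by blast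
  qed
qed

text \<open>The clock is a primitive of \<open>1 / V\<close>, so the image of an interval has the right length. This exchanges
  integrals in original time and in clock time.\<close>

lemma distr_A_path: "distr (density lborel (\<lambda>s. ennreal (1 / V_path w s))) borel (A_path w) = lborel"
proof (rule lborel_eqI[symmetric])
  have A[measurable]: "A_path w \<in> borel_measurable borel"
    by (rule borel_measurable_continuous_onI) (simp add: continuous_at_imp_continuous_on isCont_A_path)
  fix l u :: real assume "\<And>b. b \<in> Basis \<Longrightarrow> l \<bullet> b \<le> u \<bullet> b"
  then have lu: "l \<le> u" by simp
  have pre: "A_path w -` {l<..<u} = {T_path w l<..<T_path w u}"
    using strict_mono_less[OF A_path_strict_mono, of "T_path w l"]
      strict_mono_less[OF A_path_strict_mono, of _ "T_path w u"] by auto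
  have "emeasure (distr (density lborel (\<lambda>s. ennreal (1 / V_path w s))) borel (A_path w)) (box l u)
      = (\<integral>\<^sup>+s. ennreal (1 / V_path w s) * indicator {T_path w l<..<T_path w u} s \<partial>lborel)"
    unfolding box_real by (subst emeasure_distr) (simp_all add: pre emeasure_density)
  also have "\<dots> = (\<integral>\<^sup>+s. ennreal (indicator {T_path w l<..T_path w u} s * (1 / V_path w s)) \<partial>lborel)"
    using AE_lborel_singleton[of "T_path w u"]
    by (intro nn_integral_cong_AE) (auto simp: indicator_def elim!: eventually_mono)
  also have "\<dots> = ennreal (LINT s:{T_path w l<..T_path w u}|lborel. 1 / V_path w s)"
    using inverse_V_path_integrable[of "T_path w l" "T_path w u"] V_path_pos
    unfolding set_integrable_def set_lebesgue_integral_def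
    by (subst nn_integral_eq_integral) (auto simp: less_imp_le)
  also have "(LINT s:{T_path w l<..T_path w u}|lborel. 1 / V_path w s) = u - l"
    using integral_inverse_V_path[of "T_path w l" "T_path w u"] lu
      A_path_eq[of "T_path w u"] A_path_eq[of "T_path w l"] by (simp add: T_path_le_iff)
  finally show "emeasure (distr (density lborel (\<lambda>s. ennreal (1 / V_path w s))) borel (A_path w)) (box l u)
      = ennreal (\<Prod>b\<in>Basis. (u - l) \<bullet> b)" by simp
qed simp

lemma nn_integral_A_path:
  fixes G :: "real \<Rightarrow> ennreal"
  assumes [measurable]: "G \<in> borel_measurable borel"
  shows "(\<integral>\<^sup>+s. ennreal (1 / V_path w s) * G (A_path w s) \<partial>lborel) = (\<integral>\<^sup>+r. G r \<partial>lborel)"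
proof -
  have A[measurable]: "A_path w \<in> borel_measurable borel"
    by (rule borel_measurable_continuous_onI) (simp add: continuous_at_imp_continuous_on isCont_A_path)
  have "(\<integral>\<^sup>+r. G r \<partial>lborel) = (\<integral>\<^sup>+r. G r \<partial>distr (density lborel (\<lambda>s. ennreal (1 / V_path w s))) borel (A_path w))"
    by (simp add: distr_A_path)
  also have "\<dots> = (\<integral>\<^sup>+s. ennreal (1 / V_path w s) * G (A_path w s) \<partial>lborel)"
    by (simp add: nn_integral_distr nn_integral_density)
  finally show ?thesis by simp
qed

end

lemma summable_past_rebase:
  assumes "summable_past w" shows "summable_past (rebase h w)"
proof -
  interpret summable_past w by fact
  show ?thesis
  proof
    show "cadlag_on UNIV (rebase h w)"
      using cadlag_diff_const[OF cadlag_shift[OF cadlag]] by (simp add: rebase_def)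
    have "integrable lborel (\<lambda>s. indicator {..h} (h + 1 * s) *\<^sub>R exp (w (h + 1 * s)))"
      using exp_integrable_Iic[of h] unfolding set_integrable_def
      by (subst lborel_integrable_real_affine_iff) auto
    moreover have "(\<lambda>s. indicator {..h} (h + 1 * s) :: real) = indicator {..0}"
      by (auto simp: indicator_def)
    ultimately have "set_integrable lborel {..0} (\<lambda>s. exp (w (h + s)))"
      unfolding set_integrable_def by (simp add: fun_eq_iff)
    then have "set_integrable lborel {..0} (\<lambda>s. exp (w (h + s)) / exp (w h))"
      by (rule set_integrable_divide)
    then show "set_integrable lborel {..0} (\<lambda>s. exp (rebase h w s))"
      by (simp add: rebase_def exp_diff)
  qed
qed

lemma clock_path_rebase:
  assumes "clock_path w" shows "clock_path (rebase h w)"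
proof -
  interpret clock_path w by fact
  interpret r: summable_past "rebase h w" by (rule summable_past_rebase) unfold_locales
  have "filterlim (\<lambda>t. past_exp w (h + t)) at_top at_top"
    by (rule filterlim_compose[OF past_exp_at_top])
       (simp add: filterlim_tendsto_add_at_top[OF tendsto_const filterlim_ident])
  then have "filterlim (\<lambda>t. exp (- w h) * past_exp w (h + t)) at_top at_top"
    by (intro filterlim_tendsto_pos_mult_at_top[OF tendsto_const]) auto
  then have "filterlim (past_exp (rebase h w)) at_top at_top" by (simp add: past_exp_rebase[abs_def])
  then show ?thesis by unfold_locales
qed

lemma A_path_rebase:
  assumes "summable_past w" shows "A_path (rebase h w) t = A_path w (h + t) - A_path w h"
proof -
  interpret summable_past w by fact
  interpret r: summable_past "rebase h w" by (rule summable_past_rebase) fact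
  show ?thesis
    by (simp add: A_path_eq r.A_path_eq past_exp_rebase ln_mult past_exp_pos)
qed

text \<open>The time change turns the flow of the paths \<open>w\<close>, run for time \<open>h\<close>, into the shift by
  the clock value at \<open>h\<close>.\<close>

lemma U_path_rebase:
  assumes "clock_path w" shows "U_path (rebase h w) = shift (A_path w h) (U_path w)"
proof -
  interpret clock_path w by fact
  interpret r: clock_path "rebase h w" by (rule clock_path_rebase) fact
  have "T_path (rebase h w) t = T_path w (A_path w h + t) - h" for t
    by (rule r.T_path_eqI) (simp add: A_path_rebase[OF summable_past_axioms])
  then show ?thesis
    by (simp add: fun_eq_iff U_path_def shift_def V_path_rebase)
qed

lemma (in summable_past) nn_integral_inverse_V_path:
  assumes "a \<le> b"
  shows "(\<integral>\<^sup>+s. ennreal (1 / V_path w s) * indicator {a<..b} s \<partial>lborel) = ennreal (ln (past_exp w b) - ln (past_exp w a))"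
proof -
  have "(\<integral>\<^sup>+s. ennreal (1 / V_path w s) * indicator {a<..b} s \<partial>lborel)
     = (\<integral>\<^sup>+s. ennreal (indicator {a<..b} s *\<^sub>R (1 / V_path w s)) \<partial>lborel)"
    by (intro nn_integral_cong) (simp add: indicator_def)
  also have "\<dots> = ennreal (LINT s:{a<..b}|lborel. 1 / V_path w s)"
    unfolding set_lebesgue_integral_def
  proof (rule nn_integral_eq_integral)
    show "integrable lborel (\<lambda>s. indicator {a<..b} s *\<^sub>R (1 / V_path w s))"
      using inverse_V_path_integrable[of a b] by (simp only: set_integrable_def)
    show "AE s in lborel. 0 \<le> indicator {a<..b} s *\<^sub>R (1 / V_path w s)"
      using V_path_pos by (intro AE_I2) (simp add: less_imp_le)
  qed
  finally show ?thesis using integral_inverse_V_path[OF assms] by simp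
qed

text \<open>The integrand is eventually at least one, so the integral grows at least linearly.\<close>

lemma clock_path_of_eventually_nonneg:
  assumes "summable_past w" and nonneg: "\<And>s. c \<le> s \<Longrightarrow> 0 \<le> w s" shows "clock_path w"
proof -
  interpret summable_past w by fact
  have "t - c \<le> past_exp w t" if "c \<le> t" for t
  proof -
    have "set_integrable lborel {c<..t} (\<lambda>_. 1 :: real)"
      by (rule set_integrable_Ioc_of_bounded[where K = 1]) auto
    then have "(LINT s:{c<..t}|lborel. 1) \<le> (LINT s:{c<..t}|lborel. exp (w s))"
      by (rule set_integral_mono[OF _ exp_integrable_Ioc]) (simp add: nonneg)
    then have "t - c \<le> past_exp w t - past_exp w c"
      using that by (simp add: past_exp_diff set_lebesgue_integral_def)
    then show ?thesis using past_exp_nonneg[of w c] by linarith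
  qed
  then have "eventually (\<lambda>t. - c + t \<le> past_exp w t) at_top"
    by (intro eventually_at_top_linorderI[of c]) simp
  moreover have "filterlim (\<lambda>t. - c + t) at_top at_top"
    by (rule filterlim_tendsto_add_at_top[OF tendsto_const filterlim_ident])
  ultimately have "filterlim (past_exp w) at_top at_top"
    by (rule filterlim_at_top_mono[rotated])
  then show ?thesis by unfold_locales
qed

lemma U_path_cong_past:
  assumes w: "clock_path w" "clock_path w'" and eq: "\<And>s. s \<le> 0 \<Longrightarrow> w s = w' s" and r: "r \<le> 0"
  shows "U_path w r = U_path w' r"
proof -
  interpret w: clock_path w by fact
  interpret w': clock_path w' by fact
  have A: "A_path w s = A_path w' s" if "s \<le> 0" for s
    using past_exp_cong[of s w w'] past_exp_cong[of 0 w w'] eq that by (simp add: w.A_path_eq w'.A_path_eq)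
  have neg: "T_path w r \<le> 0" using w.T_path_le_iff[of r 0] r by simp
  have "A_path w' (T_path w r) = r" using A[OF neg] by simp
  then have T: "T_path w' r = T_path w r" by (rule w'.T_path_eqI)
  have "V_path w (T_path w r) = V_path w' (T_path w r)" by (rule V_path_cong) (use eq neg in simp)
  then show ?thesis by (simp add: U_path_def T)
qed

text \<open>Countably many conditions on measurable functionals describe these paths, which makes them an event.\<close>

lemma clock_path_iff:
  assumes w: "w \<in> space path_space"
  shows "clock_path w \<longleftrightarrow> (\<integral>\<^sup>+s. ennreal (exp (w s)) * indicator {..0} s \<partial>lborel) < \<infinity> \<and>
    (\<forall>K::nat. \<exists>n::nat. real K < past_exp w (real n))"
proof -
  have cad: "cadlag_on UNIV w" using w by (simp add: space_path_space)
  have [measurable]: "w \<in> borel_measurable borel" by (rule cadlag_borel_measurable[OF cad])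
  have "set_integrable lborel {..0} (\<lambda>s. exp (w s)) \<longleftrightarrow> (\<integral>\<^sup>+s. ennreal (norm (indicator {..0} s *\<^sub>R exp (w s))) \<partial>lborel) < \<infinity>"
    unfolding set_integrable_def integrable_iff_bounded by simp
  also have "(\<integral>\<^sup>+s. ennreal (norm (indicator {..0} s *\<^sub>R exp (w s))) \<partial>lborel) = (\<integral>\<^sup>+s. ennreal (exp (w s)) * indicator {..0} s \<partial>lborel)"
    by (intro nn_integral_cong) (simp add: indicator_def)
  finally have int: "summable_past w \<longleftrightarrow> (\<integral>\<^sup>+s. ennreal (exp (w s)) * indicator {..0} s \<partial>lborel) < \<infinity>"
    using cad by (simp add: summable_past_def)
  have "filterlim (past_exp w) at_top at_top \<longleftrightarrow> (\<forall>K::nat. \<exists>n::nat. real K < past_exp w (real n))"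
    if "summable_past w"
  proof -
    interpret summable_past w by fact
    show ?thesis
    proof safe
      fix K :: nat assume "filterlim (past_exp w) at_top at_top"
      from filterlim_compose[OF this filterlim_real_sequentially]
      have "eventually (\<lambda>n. real K < past_exp w (real n)) sequentially"
        by (simp add: filterlim_at_top_dense)
      then show "\<exists>n::nat. real K < past_exp w (real n)" by (auto simp: eventually_sequentially)
    next
      assume *: "\<forall>K::nat. \<exists>n::nat. real K < past_exp w (real n)"
      show "filterlim (past_exp w) at_top at_top"
        unfolding filterlim_at_top
      proof
        fix Z :: real
        obtain K :: nat where K: "Z \<le> real K" using real_arch_simple by blast
        obtain n :: nat where n: "real K < past_exp w (real n)" using * by blast
        show "eventually (\<lambda>x. Z \<le> past_exp w x) at_top"
          using eventually_ge_at_top[of "real n"]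
        proof eventually_elim
          case (elim x)
          then show ?case using past_exp_mono[of "real n" x] K n by linarith
        qed
      qed
    qed
  qed
  then show ?thesis
    unfolding clock_path_def clock_path_axioms_def using int by blast
qed

lemma past_exp_measurable_path: "(\<lambda>w. past_exp w t) \<in> borel_measurable path_space"
  using past_exp_measurable[of "\<lambda>w. w" path_space "\<lambda>_. t"] by simp

lemma V_path_measurable_path: "(\<lambda>w. V_path w t) \<in> borel_measurable path_space"
  using V_path_measurable[of "\<lambda>w. w" path_space "\<lambda>_. t"] by simp

lemma sets_clock_path: "{w \<in> space path_space. clock_path w} \<in> sets path_space"
proof -
  note [measurable] = past_exp_measurable_path
  have [measurable]: "(\<lambda>p. fst p (snd p)) \<in> borel_measurable (path_space \<Otimes>\<^sub>M lborel)"
    by (rule eval_jointly_measurable[where Z = fst]) measurable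
  have [measurable]: "(\<lambda>w. \<integral>\<^sup>+s. ennreal (exp (w s)) * indicator {..0} s \<partial>lborel) \<in> borel_measurable path_space"
    by (rule lborel.borel_measurable_nn_integral) (simp add: split_beta')
  have "{w \<in> space path_space. (\<integral>\<^sup>+s. ennreal (exp (w s)) * indicator {..0} s \<partial>lborel) < \<infinity> \<and>
    (\<forall>K::nat. \<exists>n::nat. real K < past_exp w (real n))} \<in> sets path_space" by measurable
  moreover have "{w \<in> space path_space. (\<integral>\<^sup>+s. ennreal (exp (w s)) * indicator {..0} s \<partial>lborel) < \<infinity> \<and>
    (\<forall>K::nat. \<exists>n::nat. real K < past_exp w (real n))} = {w \<in> space path_space. clock_path w}"
    using clock_path_iff by blast
  ultimately show ?thesis by (simp only:)
qed

lemma past_exp_eq_0: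
  assumes w: "w \<in> space path_space" and "\<not> summable_past w" shows "past_exp w t = 0"
proof -
  have cad: "cadlag_on UNIV w" using w by (simp add: space_path_space)
  have "\<not> set_integrable lborel {..<t} (\<lambda>s. exp (w s))"
  proof
    assume "set_integrable lborel {..<t} (\<lambda>s. exp (w s))"
    from set_integrable_Un[OF this cadlag_exp_integrable_Ioc[OF cad, of "t - 1" 0]]
    have "set_integrable lborel ({..<t} \<union> {t - 1<..0}) (\<lambda>s. exp (w s))" by simp
    then have "set_integrable lborel {..0} (\<lambda>s. exp (w s))" by (rule set_integrable_subset) auto
    with cad assms(2) show False by (simp add: summable_past_def)
  qed
  then have "\<not> integrable lborel (\<lambda>s. indicator {..<t} s * exp (w s))" by (simp add: set_integrable_def)
  then show ?thesis unfolding past_exp_eq_integral by (rule not_integrable_integral_eq)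
qed

lemma sets_summable_past: "{w \<in> space path_space. summable_past w} \<in> sets path_space"
proof -
  have "summable_past w \<longleftrightarrow> past_exp w 0 \<noteq> 0" if "w \<in> space path_space" for w
    using past_exp_eq_0[OF that, of 0] summable_past.past_exp_nonzero[of w 0] by blast
  then have "{w \<in> space path_space. summable_past w} = {w \<in> space path_space. past_exp w 0 \<noteq> 0}" by blast
  moreover note [measurable] = past_exp_measurable_path
  have "{w \<in> space path_space. past_exp w 0 \<noteq> 0} \<in> sets path_space" by measurable
  ultimately show ?thesis by (simp only:)
qed

text \<open>The inverse of the clock at \<open>t\<close> is a measurable function of the path where the clock
  attains \<open>t\<close>. Elsewhere the choice operator in the definition of the inverse returns the same point for
  all paths, and where the past is not summable the functional \<open>V\<close> vanishes.\<close>

lemma U_path_measurable_path: "(\<lambda>w. U_path w t) \<in> borel_measurable path_space"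
proof -
  note [measurable] = past_exp_measurable_path sets_summable_past
  \<comment> \<open>The value of the inverse at a point that is not attained.\<close>
  define c where "c = (SOME s::real. False)"
  define A where "A s w = ln (past_exp w s) - ln (past_exp w 0)" for s w
  have A_meas[measurable]: "A s \<in> borel_measurable path_space" for s unfolding A_def by measurable
  define S where "S = {w \<in> space path_space. summable_past w \<and> (\<exists>n::nat. t < A (real n) w)}"
  have S[measurable]: "S \<in> sets path_space" unfolding S_def by measurable
  define Tm where "Tm w = (if w \<in> S then T_path w t else c)" for w
  have Tm: "Tm \<in> borel_measurable path_space"
  proof (rule borel_measurableI_le)
    fix x :: real
    have "T_path w t \<le> x \<longleftrightarrow> t \<le> A x w" if "w \<in> S" for w
    proof -
      interpret summable_past w using that by (simp add: S_def)
      have "\<exists>n::nat. t < A_path w (real n)" using that by (simp add: S_def A_def A_path_eq)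
      then obtain s where s: "A_path w s = t" unfolding A_path_attains_iff[symmetric] by blast
      have "s \<le> x \<longleftrightarrow> A_path w s \<le> A_path w x" by (rule strict_mono_less_eq[OF A_path_strict_mono, symmetric])
      moreover have "A x w = A_path w x" by (simp add: A_def A_path_eq)
      ultimately show ?thesis using T_path_eqI[OF s] s by simp
    qed
    then have "{w \<in> space path_space. Tm w \<le> x}
      = {w \<in> space path_space. (w \<in> S \<and> t \<le> A x w) \<or> (w \<notin> S \<and> c \<le> x)}"
      by (auto simp: Tm_def)
    also have "\<dots> \<in> sets path_space" by measurable
    finally show "{w \<in> space path_space. Tm w \<le> x} \<in> sets path_space" .
  qed
  have "U_path w t = 1 / V_path w (Tm w)" if w: "w \<in> space path_space" for w
  proof (cases "summable_past w")
    case False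
    then have "V_path w s = 0" for s by (simp add: V_path_def past_exp_eq_0[OF w])
    then show ?thesis by (simp add: U_path_def)
  next
    case True
    then interpret summable_past w .
    have "T_path w t = c" if "w \<notin> S"
    proof -
      have "\<not> (\<exists>n::nat. t < A_path w (real n))" using that w True by (simp add: S_def A_def A_path_eq)
      then have no: "A_path w s \<noteq> t" for s using A_path_attains_iff by blast
      show ?thesis unfolding T_path_def inv_into_def c_def by (simp add: no)
    qed
    then show ?thesis by (simp add: U_path_def Tm_def)
  qed
  moreover have "(\<lambda>w. 1 / V_path w (Tm w)) \<in> borel_measurable path_space"
    using V_path_measurable[of "\<lambda>w. w" path_space Tm] Tm by simp
  ultimately show ?thesis by (subst measurable_cong) simp_all
qed

text \<open>The zero path is a placeholder on paths whose clock is not a bijection.\<close>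

definition U_map :: "(real \<Rightarrow> real) \<Rightarrow> real \<Rightarrow> real" where
  "U_map w = (if clock_path w then U_path w else (\<lambda>_. 0))"

lemma U_map_measurable: "U_map \<in> path_space \<rightarrow>\<^sub>M path_space"
  unfolding measurable_path_space_iff[of _ path_space]
proof safe
  fix t
  have "(\<lambda>w. if w \<in> {w \<in> space path_space. clock_path w} then U_path w t else 0) \<in> borel_measurable path_space"
    by (intro measurable_If_set U_path_measurable_path measurable_const) (use sets_clock_path in auto)
  moreover have "U_map w t = (if w \<in> {w \<in> space path_space. clock_path w} then U_path w t else 0)"
    if "w \<in> space path_space" for w using that by (simp add: U_map_def)
  ultimately show "(\<lambda>w. U_map w t) \<in> borel_measurable path_space" by (subst measurable_cong) simp_all
next
  fix w
  have "cadlag_on UNIV (\<lambda>_::real. 0 :: real)" unfolding cadlag_on_UNIV_iff by auto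
  then show "cadlag_on UNIV (U_map w)" by (simp add: U_map_def clock_path.cadlag_U_path)
qed

lemma U_map_rebase: "clock_path w \<Longrightarrow> U_map (rebase h w) = shift (A_path w h) (U_map w)"
  by (simp add: U_map_def clock_path_rebase U_path_rebase)

lemma shift_shift: "shift h (shift k u) = shift (k + h) u"
  by (simp add: shift_def add.assoc)

lemma clock_path_rebase_iff:
  assumes w: "cadlag_on UNIV w" shows "clock_path (rebase h w) \<longleftrightarrow> clock_path w"
proof
  assume "clock_path (rebase h w)"
  from clock_path_rebase[OF this, of "- h"] have c0: "clock_path (rebase 0 w)" by (simp add: rebase_rebase)
  then interpret r: clock_path "rebase 0 w" .
  have "set_integrable lborel {..0} (\<lambda>s. exp (w 0) * exp (rebase 0 w s))"
    using r.integrable_past_0 by simp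
  then have int: "set_integrable lborel {..0} (\<lambda>s. exp (w s))"
    by (simp add: rebase_def flip: exp_add)
  have eq: "past_exp w t = exp (w 0) * past_exp (rebase 0 w) t" for t
    by (simp add: past_exp_rebase flip: exp_add mult.assoc)
  have "filterlim (\<lambda>t. exp (w 0) * past_exp (rebase 0 w) t) at_top at_top"
    by (rule filterlim_tendsto_pos_mult_at_top[OF tendsto_const _ r.past_exp_at_top]) simp
  then have "filterlim (past_exp w) at_top at_top" by (simp only: eq[abs_def])
  with w int show "clock_path w" by (simp add: clock_path_def summable_past_def clock_path_axioms_def)
qed (rule clock_path_rebase)

lemma V_path_funpow_rebase: "V_path ((rebase 1 ^^ k) w) s = V_path w (real k + s)"
  by (induction k arbitrary: s) (simp_all add: V_path_rebase add_ac)

section \<open>Ergodic maps\<close>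

primrec orbit_sum :: "('a \<Rightarrow> 'a) \<Rightarrow> ('a \<Rightarrow> real) \<Rightarrow> nat \<Rightarrow> 'a \<Rightarrow> real" where
  "orbit_sum T f 0 x = 0"
| "orbit_sum T f (Suc n) x = f x + orbit_sum T f n (T x)"

text \<open>The largest of the orbit sums of length at most \<open>n\<close>, the empty sum included. This recursion is all
  that the maximal inequality needs.\<close>

primrec orbit_max :: "('a \<Rightarrow> 'a) \<Rightarrow> ('a \<Rightarrow> real) \<Rightarrow> nat \<Rightarrow> 'a \<Rightarrow> real" where
  "orbit_max T f 0 x = 0"
| "orbit_max T f (Suc n) x = max 0 (f x + orbit_max T f n (T x))"

lemma orbit_sum_eq_sum: "orbit_sum T f n x = (\<Sum>k<n. f ((T ^^ k) x))"
  by (induction n arbitrary: x) (simp_all add: sum.lessThan_Suc_shift funpow_swap1 del: sum.lessThan_Suc)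

lemma orbit_max_nonneg: "0 \<le> orbit_max T f n x"
  by (cases n) simp_all

lemma orbit_max_Suc: "orbit_max T f n x \<le> orbit_max T f (Suc n) x"
proof (induction n arbitrary: x)
  case (Suc n)
  from Suc.IH[of "T x"] show ?case
    by (simp only: orbit_max.simps(2)[of T f n x] orbit_max.simps(2)[of T f "Suc n" x])
qed simp

lemma orbit_max_mono: "m \<le> n \<Longrightarrow> orbit_max T f m x \<le> orbit_max T f n x"
  using lift_Suc_mono_le[of "\<lambda>n. orbit_max T f n x", OF orbit_max_Suc] by blast

lemma orbit_sum_le_orbit_max: "orbit_sum T f n x \<le> orbit_max T f n x"
proof (induction n arbitrary: x)
  case (Suc n)
  from Suc.IH[of "T x"] show ?case by simp
qed simp

lemma orbit_sum_diff_const: "orbit_sum T (\<lambda>x. f x - c) n x = orbit_sum T f n x - real n * c"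
  by (simp add: orbit_sum_eq_sum sum_subtractf)

lemma orbit_sum_const_diff: "orbit_sum T (\<lambda>x. c - f x) n x = real n * c - orbit_sum T f n x"
  by (simp add: orbit_sum_eq_sum sum_subtractf)

locale measure_preserving_map = prob_space +
  fixes T :: "'a \<Rightarrow> 'a"
  assumes map_measurable[measurable]: "T \<in> M \<rightarrow>\<^sub>M M"
    and distr_map: "distr M M T = M"
begin

lemma funpow_measurable[measurable]: "(T ^^ n) \<in> M \<rightarrow>\<^sub>M M"
proof (induction n)
  case (Suc n)
  have "(T \<circ> (T ^^ n)) \<in> M \<rightarrow>\<^sub>M M" by (rule measurable_comp[OF Suc map_measurable])
  then show ?case by simp
qed (simp add: id_def)

lemma distr_funpow: "distr M M (T ^^ n) = M"
proof (induction n)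
  case (Suc n)
  have "distr M M (T \<circ> (T ^^ n)) = distr (distr M M (T ^^ n)) M T"
    by (rule distr_distr[symmetric]) measurable
  then show ?case by (simp add: Suc distr_map comp_def)
qed (simp add: id_def)

lemma map_space: "x \<in> space M \<Longrightarrow> T x \<in> space M"
  by (rule measurable_space[OF map_measurable])

lemma prob_funpow_vimage: "B \<in> sets M \<Longrightarrow> prob ((T ^^ n) -` B \<inter> space M) = prob B"
  using measure_distr[of "T ^^ n" M M B] by (simp add: distr_funpow)

lemma integrable_funpow:
  fixes f :: "'a \<Rightarrow> real"
  shows "integrable M f \<Longrightarrow> integrable M (\<lambda>x. f ((T ^^ n) x))"
  using integrable_distr[of "T ^^ n" M M f] by (simp add: distr_funpow)

lemma integral_funpow:
  fixes f :: "'a \<Rightarrow> real"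
  shows "f \<in> borel_measurable M \<Longrightarrow> (\<integral>x. f ((T ^^ n) x) \<partial>M) = (\<integral>x. f x \<partial>M)"
  using integral_distr[of "T ^^ n" M M f] by (simp add: distr_funpow)

lemmas integrable_map = integrable_funpow[of _ 1, simplified]
lemmas integral_map = integral_funpow[of _ 1, simplified]

lemma AE_funpow: "(AE x in M. P x) \<Longrightarrow> AE x in M. P ((T ^^ n) x)"
  by (rule AE_distrD[OF funpow_measurable[of n]]) (simp only: distr_funpow)

lemma orbit_max_measurable[measurable]:
  assumes [measurable]: "f \<in> borel_measurable M" shows "orbit_max T f n \<in> borel_measurable M"
proof (induction n)
  case (Suc n)
  note [measurable] = Suc
  have "orbit_max T f (Suc n) = (\<lambda>x. max 0 (f x + orbit_max T f n (T x)))" by (simp add: fun_eq_iff)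
  then show ?case by simp
qed (simp add: orbit_max.simps(1)[abs_def])

lemma integrable_orbit_max: "integrable M f \<Longrightarrow> integrable M (orbit_max T f n)"
proof (induction n)
  case (Suc n)
  have "orbit_max T f (Suc n) = (\<lambda>x. max 0 (f x + orbit_max T f n (T x)))" by (simp add: fun_eq_iff)
  moreover have "integrable M (\<lambda>x. max 0 (f x + orbit_max T f n (T x)))"
    using Suc by (intro integrable_max integrable_zero Bochner_Integration.integrable_add integrable_map) auto
  ultimately show ?case by simp
qed (simp add: orbit_max.simps(1)[abs_def])

text \<open>The maximal ergodic inequality, by Garsia's argument: where the running maximum is positive,
  \<open>f\<close> dominates the increment of the running maximum along the map, and that increment has
  integral zero.\<close>

lemma maximal_inequality:
  assumes f: "integrable M f"
  shows "0 \<le> (\<integral>x. f x * indicator {x. 0 < orbit_max T f n x} x \<partial>M)"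
proof -
  have [measurable]: "f \<in> borel_measurable M" using f by auto
  have le: "orbit_max T f n x - orbit_max T f n (T x) \<le> f x * indicator {x. 0 < orbit_max T f n x} x" for x
  proof (cases "0 < orbit_max T f n x")
    case True
    then obtain m where m: "n = Suc m" by (cases n) auto
    then have "orbit_max T f n x = f x + orbit_max T f m (T x)" using True by (simp add: max_def split: if_splits)
    then show ?thesis using orbit_max_Suc[of T f m "T x"] True m by simp
  next
    case False
    then show ?thesis using orbit_max_nonneg[of T f n "T x"] by simp
  qed
  have "integrable M (\<lambda>x. f x * indicator {x \<in> space M. 0 < orbit_max T f n x} x)"
    by (rule integrable_real_mult_indicator[OF _ f]) measurable
  then have int: "integrable M (\<lambda>x. f x * indicator {x. 0 < orbit_max T f n x} x)"
    by (rule Bochner_Integration.integrable_cong[THEN iffD1, rotated -1]) (auto simp: indicator_def)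
  have "(\<integral>x. orbit_max T f n x - orbit_max T f n (T x) \<partial>M)
      = (\<integral>x. orbit_max T f n x \<partial>M) - (\<integral>x. orbit_max T f n (T x) \<partial>M)"
    by (intro Bochner_Integration.integral_diff integrable_map integrable_orbit_max f)
  also have "\<dots> = 0" by (subst integral_map) auto
  finally have "0 = (\<integral>x. orbit_max T f n x - orbit_max T f n (T x) \<partial>M)" by simp
  also have "\<dots> \<le> (\<integral>x. f x * indicator {x. 0 < orbit_max T f n x} x \<partial>M)"
    by (intro integral_mono int le Bochner_Integration.integrable_diff integrable_map integrable_orbit_max f)
  finally show ?thesis .
qed

end

locale ergodic_map = measure_preserving_map +
  assumes ergodic: "B \<in> sets M \<Longrightarrow> T -` B \<inter> space M = B \<Longrightarrow> prob B = 0 \<or> prob B = 1"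
begin

text \<open>The event that the orbit sums are unbounded above is invariant. If it had probability one,
  the maximal inequality would give a nonnegative mean in the limit.\<close>

lemma orbit_sum_bounded_above:
  assumes f: "integrable M f" and neg: "(\<integral>x. f x \<partial>M) < 0"
  shows "AE x in M. \<exists>K. \<forall>n. orbit_sum T f n x \<le> K"
proof -
  have [measurable]: "f \<in> borel_measurable M" using f by auto
  define D where "D = {x \<in> space M. \<forall>K::nat. \<exists>n. real K < orbit_max T f n x}"
  have D[measurable]: "D \<in> sets M" unfolding D_def by measurable
  have backward: "x \<in> D" if x: "x \<in> space M" "T x \<in> D" for x
  proof -
    have "\<exists>n. real K < orbit_max T f n x" for K :: nat
    proof -
      obtain L :: nat where L: "real K + \<bar>f x\<bar> \<le> real L" using real_arch_simple by blast
      obtain n where "real L < orbit_max T f n (T x)" using x(2) by (auto simp: D_def)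
      then have "real K < orbit_max T f (Suc n) x" using L by simp
      then show ?thesis by blast
    qed
    then show ?thesis using x(1) by (simp add: D_def)
  qed
  have forward: "T x \<in> D" if x: "x \<in> D" for x
  proof -
    have "\<exists>n. real K < orbit_max T f n (T x)" for K :: nat
    proof -
      obtain L :: nat where L: "real K + \<bar>f x\<bar> \<le> real L" using real_arch_simple by blast
      obtain n where n: "real L < orbit_max T f n x" using x by (auto simp: D_def)
      then obtain m where "n = Suc m" by (cases n) auto
      then have "real L < f x + orbit_max T f m (T x)" using n by (simp add: max_def split: if_splits)
      then have "real K < orbit_max T f m (T x)" using L by simp
      then show ?thesis by blast
    qed
    then show ?thesis using x map_space by (simp add: D_def)
  qed
  have "T -` D \<inter> space M = D"
    using backward forward sets.sets_into_space[OF D] by auto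
  from ergodic[OF D this] show ?thesis
  proof
    assume "prob D = 1"
    then have "AE x in M. x \<in> D" by (simp add: prob_eq_1)
    then have ev: "AE x in M. (\<lambda>n. f x * indicator {x. 0 < orbit_max T f n x} x) \<longlonglongrightarrow> f x"
    proof eventually_elim
      case (elim x)
      then obtain m where m: "real 0 < orbit_max T f m x" unfolding D_def by blast
      have "eventually (\<lambda>n. f x * indicator {x. 0 < orbit_max T f n x} x = f x) sequentially"
        using eventually_ge_at_top[of m]
        by eventually_elim (use m orbit_max_mono[of m _ T f x] in \<open>force simp: indicator_def\<close>)
      then show ?case by (rule tendsto_eventually)
    qed
    have "(\<lambda>n. \<integral>x. f x * indicator {x. 0 < orbit_max T f n x} x \<partial>M) \<longlonglongrightarrow> (\<integral>x. f x \<partial>M)"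
    proof (rule integral_dominated_convergence[where w = "\<lambda>x. \<bar>f x\<bar>"])
      show "(\<lambda>x. f x * indicator {x. 0 < orbit_max T f n x} x) \<in> borel_measurable M" for n
      proof -
        have "(\<lambda>x. f x * (if 0 < orbit_max T f n x then 1 else 0)) \<in> borel_measurable M" by measurable
        moreover have "(\<lambda>x. f x * (if 0 < orbit_max T f n x then 1 else 0))
          = (\<lambda>x. f x * indicator {x. 0 < orbit_max T f n x} x)" by (auto simp: fun_eq_iff)
        ultimately show ?thesis by simp
      qed
    qed (use f ev in \<open>auto simp: indicator_def\<close>)
    then have "0 \<le> (\<integral>x. f x \<partial>M)"
      by (rule LIMSEQ_le_const) (use maximal_inequality[OF f] in auto)
    with neg show ?thesis by simp
  next
    assume "prob D = 0"
    then have "AE x in M. x \<notin> D" by (simp add: prob_eq_0)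
    with AE_space show ?thesis
    proof eventually_elim
      case (elim x)
      then have "\<exists>K::nat. \<forall>n. \<not> real K < orbit_max T f n x" unfolding D_def by blast
      then obtain K :: nat where K: "\<forall>n. \<not> real K < orbit_max T f n x" by blast
      have "orbit_sum T f n x \<le> real K" for n
        using K[rule_format, of n] orbit_sum_le_orbit_max[of T f n x] by linarith
      then show ?case by blast
    qed
  qed
qed

text \<open>Subtracting slightly more than the mean leaves a function of negative mean, whose orbit sums are
  bounded above; the same holds for the negative of the function.\<close>

theorem birkhoff:
  assumes f: "integrable M f"
  shows "AE x in M. (\<lambda>n. orbit_sum T f n x / real n) \<longlonglongrightarrow> (\<integral>x. f x \<partial>M)"
proof -
  let ?c = "\<integral>x. f x \<partial>M"
  let ?e = "\<lambda>k. 1 / real (Suc k)"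
  have up: "AE x in M. \<exists>K. \<forall>n. orbit_sum T (\<lambda>x. f x - (?c + ?e k)) n x \<le> K" for k
  proof (rule orbit_sum_bounded_above)
    show "(\<integral>x. f x - (?c + ?e k) \<partial>M) < 0" using f by (simp add: prob_space)
  qed (use f in auto)
  have low: "AE x in M. \<exists>K. \<forall>n. orbit_sum T (\<lambda>x. (?c - ?e k) - f x) n x \<le> K" for k
  proof (rule orbit_sum_bounded_above)
    show "(\<integral>x. (?c - ?e k) - f x \<partial>M) < 0" using f by (simp add: prob_space)
  qed (use f in auto)
  have "AE x in M. \<forall>k. (\<exists>K. \<forall>n. orbit_sum T (\<lambda>x. f x - (?c + ?e k)) n x \<le> K) \<and>
      (\<exists>K. \<forall>n. orbit_sum T (\<lambda>x. (?c - ?e k) - f x) n x \<le> K)"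
    using up low by (simp add: AE_all_countable)
  then show ?thesis
  proof eventually_elim
    case (elim x)
    show ?case
    proof (rule LIMSEQ_I)
      fix r :: real assume "0 < r"
      then obtain k where k: "?e k < r / 2" using nat_approx_posE[of "r / 2"] by (metis half_gt_zero)
      obtain K L where K: "\<And>n. orbit_sum T f n x - real n * (?c + ?e k) \<le> K"
        and L: "\<And>n. real n * (?c - ?e k) - orbit_sum T f n x \<le> L"
        using elim[rule_format, of k] by (auto simp: orbit_sum_diff_const orbit_sum_const_diff simp del: of_nat_Suc)
      define e where "e = ?e k"
      note K = K[folded e_def] and L = L[folded e_def] and k = k[folded e_def]
      obtain N :: nat where N: "2 * (\<bar>K\<bar> + \<bar>L\<bar>) / r < real N" using reals_Archimedean2 by blast
      show "\<exists>N. \<forall>n\<ge>N. norm (orbit_sum T f n x / real n - ?c) < r"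
      proof (intro exI allI impI)
        fix n assume n: "Suc N \<le> n"
        then have n0: "0 < real n" by simp
        have "2 * (\<bar>K\<bar> + \<bar>L\<bar>) < r * real N" using N \<open>0 < r\<close> by (simp add: divide_less_eq mult.commute)
        also have "\<dots> \<le> r * real n" using n \<open>0 < r\<close> by simp
        finally have KL: "\<bar>K\<bar> + \<bar>L\<bar> < r / 2 * real n" by simp
        have en: "e * real n \<le> r / 2 * real n" using k n0 by (intro mult_right_mono) auto
        have "orbit_sum T f n x - real n * ?c < r * real n"
          using K[of n] KL en by (simp add: algebra_simps)
        moreover have "- (r * real n) < orbit_sum T f n x - real n * ?c"
          using L[of n] KL en by (simp add: algebra_simps)
        ultimately have "\<bar>orbit_sum T f n x - real n * ?c\<bar> < r * real n" by linarith
        moreover have "orbit_sum T f n x / real n - ?c = (orbit_sum T f n x - real n * ?c) / real n"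
          using n0 by (simp add: field_simps)
        ultimately show "norm (orbit_sum T f n x / real n - ?c) < r"
          using n0 by (simp add: pos_divide_less_eq)
      qed
    qed
  qed
qed

text \<open>If \<open>f\<close> had positive mean, its orbit sums would drive \<open>g \<circ> T ^^ n\<close> to infinity, although
  all these functions have the same distribution.\<close>

lemma integral_nonpos_of_le_coboundary:
  fixes f g :: "'a \<Rightarrow> real"
  assumes f: "integrable M f" and g[measurable]: "g \<in> borel_measurable M"
    and le: "AE x in M. f x \<le> g (T x) - g x"
  shows "(\<integral>x. f x \<partial>M) \<le> 0"
proof (rule ccontr)
  assume "\<not> (\<integral>x. f x \<partial>M) \<le> 0"
  then have pos: "0 < (\<integral>x. f x \<partial>M)" by simp
  define c where "c = (\<integral>x. f x \<partial>M) / 2"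
  have c: "0 < c" using pos by (simp add: c_def)
  have b: "AE x in M. \<exists>K. \<forall>n. orbit_sum T (\<lambda>x. c - f x) n x \<le> K"
  proof (rule orbit_sum_bounded_above)
    show "(\<integral>x. c - f x \<partial>M) < 0" using f pos by (simp add: prob_space c_def)
  qed (use f in auto)
  have le': "AE x in M. \<forall>k. f ((T ^^ k) x) \<le> g (T ((T ^^ k) x)) - g ((T ^^ k) x)"
    unfolding AE_all_countable by (intro allI AE_funpow le)
  have lim: "AE x in M. (\<lambda>n. arctan (g ((T ^^ n) x))) \<longlonglongrightarrow> pi / 2"
    using b le'
  proof eventually_elim
    case (elim x)
    then obtain K where K: "\<And>n. real n * c - orbit_sum T f n x \<le> K" by (auto simp: orbit_sum_const_diff)
    have "orbit_sum T f n x \<le> (\<Sum>k<n. g ((T ^^ Suc k) x) - g ((T ^^ k) x))" for n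
      unfolding orbit_sum_eq_sum using elim(2) by (intro sum_mono) simp
    then have "orbit_sum T f n x \<le> g ((T ^^ n) x) - g x" for n
      by (subst (asm) sum_lessThan_telescope) simp
    then have ge: "real n * c - (K - g x) \<le> g ((T ^^ n) x)" for n
    proof -
      assume "\<And>n. orbit_sum T f n x \<le> g ((T ^^ n) x) - g x"
      from this[of n] K[of n] show ?thesis by linarith
    qed
    have "filterlim (\<lambda>n. real n * c) at_top sequentially"
      using filterlim_tendsto_pos_mult_at_top[OF tendsto_const c filterlim_real_sequentially]
      by (simp add: mult.commute)
    then have "filterlim (\<lambda>n. - (K - g x) + real n * c) at_top sequentially"
      by (rule filterlim_tendsto_add_at_top[OF tendsto_const])
    then have "filterlim (\<lambda>n. g ((T ^^ n) x)) at_top sequentially"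
      by (rule filterlim_at_top_mono) (use ge in \<open>auto intro!: always_eventually simp: algebra_simps\<close>)
    from filterlim_compose[OF tendsto_arctan_at_top this] show ?case .
  qed
  have bd: "norm (arctan y) \<le> pi / 2" for y using arctan_bounded[of y] by (simp add: abs_if)
  have "(\<lambda>n. \<integral>x. arctan (g ((T ^^ n) x)) \<partial>M) \<longlonglongrightarrow> (\<integral>x. pi / 2 \<partial>M)"
    by (rule integral_dominated_convergence[where w = "\<lambda>_. pi / 2"]) (use lim bd in auto)
  moreover have "(\<integral>x. arctan (g ((T ^^ n) x)) \<partial>M) = (\<integral>x. arctan (g x) \<partial>M)" for n
    by (rule integral_funpow) measurable
  ultimately have eq: "(\<integral>x. arctan (g x) \<partial>M) = pi / 2"
    by (simp add: prob_space LIMSEQ_const_iff)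
  have int: "integrable M (\<lambda>x. arctan (g x))"
    by (rule integrable_const_bound[where B = "pi / 2"]) (use bd in auto)
  have "(\<integral>x. pi / 2 - arctan (g x) \<partial>M) = 0" using int eq by (simp add: prob_space)
  moreover have "integrable M (\<lambda>x. pi / 2 - arctan (g x))" using int by auto
  ultimately have "AE x in M. pi / 2 - arctan (g x) = 0"
    using arctan_ubound by (subst (asm) integral_nonneg_eq_0_iff_AE) (auto simp: less_imp_le)
  then have "AE x in M. False"
  proof eventually_elim
    case (elim x)
    then show ?case using arctan_ubound[of "g x"] by simp
  qed
  then show False by simp
qed

end

text \<open>Mixing passes from a generating family to arbitrary events in the first argument. Applied
  to an invariant event it says that this event is independent of the generating family, hence
  of itself.\<close>

lemma (in measure_preserving_map) ergodic_map_of_mixing: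
  assumes G: "Int_stable G" "G \<subseteq> Pow (space M)" "sets M = sigma_sets (space M) G"
    and mixing: "\<And>C D. C \<in> G \<Longrightarrow> D \<in> G \<Longrightarrow>
      (\<lambda>n. prob (C \<inter> ((T ^^ n) -` D \<inter> space M))) \<longlonglongrightarrow> prob C * prob D"
  shows "ergodic_map M T"
proof unfold_locales
  fix B assume B: "B \<in> sets M" and inv: "T -` B \<inter> space M = B"
  have G_sets: "D \<in> sets M" if "D \<in> G" for D using that G(3) by auto
  have mix: "(\<lambda>n. prob (C \<inter> ((T ^^ n) -` D \<inter> space M))) \<longlonglongrightarrow> prob C * prob D"
    if D: "D \<in> G" and C: "C \<in> sigma_sets (space M) G" for C D
    using G(1,2) C
  proof (induction rule: sigma_sets_induct_disjoint)
    case (basic C)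
    then show ?case by (rule mixing[OF _ D])
  next
    case empty
    then show ?case by simp
  next
    case (compl A)
    have E: "(T ^^ n) -` D \<inter> space M \<in> sets M" for n using G_sets[OF D] by measurable
    have A: "A \<in> sets M" using compl G(3) by simp
    have "prob ((space M - A) \<inter> ((T ^^ n) -` D \<inter> space M)) = prob D - prob (A \<inter> ((T ^^ n) -` D \<inter> space M))" for n
    proof -
      have "(space M - A) \<inter> ((T ^^ n) -` D \<inter> space M) = ((T ^^ n) -` D \<inter> space M) - A \<inter> ((T ^^ n) -` D \<inter> space M)"
        by auto
      then show ?thesis
        using finite_measure_Diff[OF E[of n] sets.Int[OF A E[of n]] Int_lower2]
        by (simp add: prob_funpow_vimage[OF G_sets[OF D]])
    qed
    moreover have "(\<lambda>n. prob D - prob (A \<inter> ((T ^^ n) -` D \<inter> space M))) \<longlonglongrightarrow> prob D - prob A * prob D"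
      by (intro tendsto_diff tendsto_const compl)
    moreover have "prob D - prob A * prob D = prob (space M - A) * prob D"
      using A by (simp add: prob_compl algebra_simps)
    ultimately show ?case by simp
  next
    case (union A)
    have A: "A i \<in> sets M" for i using union(2) G(3) by auto
    have E: "(T ^^ n) -` D \<inter> space M \<in> sets M" for n using G_sets[OF D] by measurable
    have disj: "disjoint_family (\<lambda>i. A i \<inter> ((T ^^ n) -` D \<inter> space M))" for n
      using union(1) by (auto simp: disjoint_family_on_def)
    have sumsA: "(\<lambda>i. prob (A i)) sums prob (\<Union>i. A i)"
      by (rule finite_measure_UNION) (use A union(1) in auto)
    have sumsE: "(\<lambda>i. prob (A i \<inter> ((T ^^ n) -` D \<inter> space M))) sums prob ((\<Union>i. A i) \<inter> ((T ^^ n) -` D \<inter> space M))" for n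
      using finite_measure_UNION[OF _ disj] A E by (simp add: image_subset_iff Int_UN_distrib2)
    have "(\<lambda>n. \<Sum>i. prob (A i \<inter> ((T ^^ n) -` D \<inter> space M))) \<longlonglongrightarrow> (\<Sum>i. prob (A i) * prob D)"
    proof (rule tannerys_theorem[where M = "\<lambda>i. prob (A i)", THEN conjunct2, THEN conjunct2])
      show "eventually (\<lambda>(k, n). norm (prob (A k \<inter> ((T ^^ n) -` D \<inter> space M))) \<le> prob (A k)) (at_top \<times>\<^sub>F sequentially)"
        using A by (intro always_eventually) (auto intro!: finite_measure_mono)
    qed (use union(3) sumsA in \<open>auto simp: sums_iff\<close>)
    moreover have "(\<Sum>i. prob (A i) * prob D) = prob (\<Union>i. A i) * prob D"
      using sums_mult2[OF sumsA, of "prob D"] by (simp add: sums_iff)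
    ultimately show ?case using sumsE by (simp add: sums_iff)
  qed
  have inv_n: "(T ^^ n) -` B \<inter> space M = B" for n
  proof (induction n)
    case (Suc n)
    have "(T ^^ Suc n) -` B \<inter> space M = (T ^^ n) -` (T -` B \<inter> space M) \<inter> space M"
      using measurable_space[OF funpow_measurable] by (auto simp: funpow_swap1)
    then show ?case using inv Suc by (simp add: comp_def)
  qed (use sets.sets_into_space[OF B] in auto)
  have indep: "prob (B \<inter> D) = prob B * prob D" if D: "D \<in> G" for D
  proof -
    have "B \<inter> ((T ^^ n) -` D \<inter> space M) = (T ^^ n) -` (B \<inter> D) \<inter> space M" for n
      using inv_n[of n] by auto
    then have "prob (B \<inter> ((T ^^ n) -` D \<inter> space M)) = prob (B \<inter> D)" for n
      using prob_funpow_vimage[of "B \<inter> D"] B G_sets[OF D] by simp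
    then show ?thesis using mix[OF D, of B] B G(3) by (simp add: LIMSEQ_const_iff)
  qed
  have "prob (B \<inter> D) = prob B * prob D" if D: "D \<in> sigma_sets (space M) G" for D
    using G(1,2) D
  proof (induction rule: sigma_sets_induct_disjoint)
    case (basic D)
    then show ?case by (rule indep)
  next
    case empty
    then show ?case by simp
  next
    case (compl A)
    have A: "A \<in> sets M" using compl G(3) by simp
    have "B \<inter> (space M - A) = B - B \<inter> A" using sets.sets_into_space[OF B] by auto
    then show ?case using compl A B by (simp add: finite_measure_Diff prob_compl algebra_simps)
  next
    case (union A)
    have A: "A i \<in> sets M" for i using union(2) G(3) by auto
    have sumsA: "(\<lambda>i. prob (A i)) sums prob (\<Union>i. A i)"
      by (rule finite_measure_UNION) (use A union(1) in auto)
    have disj: "disjoint_family (\<lambda>i. B \<inter> A i)"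
      using union(1) by (auto simp: disjoint_family_on_def)
    have "(\<lambda>i. prob (B \<inter> A i)) sums prob (B \<inter> (\<Union>i. A i))"
      using finite_measure_UNION[OF _ disj] A B by (simp add: image_subset_iff)
    then show ?case using sums_mult[OF sumsA, of "prob B"] union(3) by (simp add: sums_iff)
  qed
  then have "prob (B \<inter> B) = prob B * prob B" using B G(3) by blast
  then have "prob B * (prob B - 1) = 0" by (simp add: algebra_simps)
  then show "prob B = 0 \<or> prob B = 1" by simp
qed

section \<open>Auxiliary integrals and limits\<close>

lemma nn_integral_le_of_truncations:
  fixes f :: "'b \<Rightarrow> real"
  assumes [measurable]: "f \<in> borel_measurable N"
    and le: "\<And>K::nat. (\<integral>\<^sup>+x. ennreal (min (f x) (real K)) \<partial>N) \<le> C"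
  shows "(\<integral>\<^sup>+x. ennreal (f x) \<partial>N) \<le> C"
proof -
  have sup: "ennreal (f x) = (SUP K. ennreal (min (f x) (real K)))" for x
  proof (rule antisym)
    obtain K :: nat where "f x \<le> real K" using real_arch_simple by blast
    then have "ennreal (f x) = ennreal (min (f x) (real K))" by (simp add: min_def)
    also have "\<dots> \<le> (SUP K. ennreal (min (f x) (real K)))" by (rule SUP_upper) simp
    finally show "ennreal (f x) \<le> (SUP K. ennreal (min (f x) (real K)))" .
    show "(SUP K. ennreal (min (f x) (real K))) \<le> ennreal (f x)" by (intro SUP_least ennreal_leI) simp
  qed
  have "(\<integral>\<^sup>+x. ennreal (f x) \<partial>N) = (\<integral>\<^sup>+x. (SUP K. ennreal (min (f x) (real K))) \<partial>N)"
    by (simp only: sup[symmetric])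
  also have "\<dots> = (SUP K. \<integral>\<^sup>+x. ennreal (min (f x) (real K)) \<partial>N)"
  proof (rule nn_integral_monotone_convergence_SUP)
    show "incseq (\<lambda>K x. ennreal (min (f x) (real K)))"
      by (intro incseq_SucI le_funI ennreal_leI) (auto simp: min_def)
  qed measurable
  also have "\<dots> \<le> C" by (rule SUP_least) (rule le)
  finally show ?thesis .
qed

text \<open>An integral over time is an integral over the starting points of a grid of a sum along the grid, so
  that bounds for discrete times carry over to continuous time.\<close>

lemma nn_integral_periodize:
  fixes F :: "real \<Rightarrow> ennreal"
  assumes [measurable]: "F \<in> borel_measurable borel" and N: "0 < N"
  shows "(\<integral>\<^sup>+s. F s * indicator {0..} s \<partial>lborel)
    = (\<integral>\<^sup>+u. (\<Sum>k. F (u + real k * N)) * indicator {0..<N} u \<partial>lborel)"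
proof -
  let ?I = "\<lambda>k::nat. {real k * N..<real k * N + N}"
  have floor: "s \<in> ?I k \<longleftrightarrow> 0 \<le> s \<and> k = nat \<lfloor>s / N\<rfloor>" for s k
  proof -
    have "s \<in> ?I k \<longleftrightarrow> real k \<le> s / N \<and> s / N < real k + 1"
      using N by (simp add: le_divide_eq divide_less_eq algebra_simps)
    also have "\<dots> \<longleftrightarrow> \<lfloor>s / N\<rfloor> = int k" by (simp add: floor_eq_iff)
    also have "\<dots> \<longleftrightarrow> 0 \<le> \<lfloor>s / N\<rfloor> \<and> k = nat \<lfloor>s / N\<rfloor>"
    proof -
      have "z = int k \<longleftrightarrow> 0 \<le> z \<and> k = nat z" for z by auto
      then show ?thesis .
    qed
    also have "0 \<le> \<lfloor>s / N\<rfloor> \<longleftrightarrow> 0 \<le> s" using N by (simp add: zero_le_divide_iff)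
    finally show ?thesis .
  qed
  have "m = n" if "s \<in> ?I m" "s \<in> ?I n" for s m n
    using that unfolding floor by simp
  then have disj: "disjoint_family ?I" unfolding disjoint_family_on_def by blast
  have "s \<in> (\<Union>k. ?I k) \<longleftrightarrow> s \<in> {0..}" for s
  proof -
    have "s \<in> (\<Union>k. ?I k) \<longleftrightarrow> (\<exists>k. s \<in> ?I k)" by blast
    then show ?thesis unfolding floor by simp
  qed
  then have "(\<Union>k. ?I k) = {0..}" by blast
  then have ind: "indicator {0..} s = (\<Sum>k. indicator (?I k) s :: ennreal)" for s
    using suminf_indicator[OF disj, of s] by simp
  have "(\<integral>\<^sup>+s. F s * indicator {0..} s \<partial>lborel) = (\<integral>\<^sup>+s. (\<Sum>k. F s * indicator (?I k) s) \<partial>lborel)"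
    unfolding ind by simp
  also have "\<dots> = (\<Sum>k. \<integral>\<^sup>+s. F s * indicator (?I k) s \<partial>lborel)"
    by (rule nn_integral_suminf) measurable
  also have "\<dots> = (\<Sum>k. \<integral>\<^sup>+u. F (u + real k * N) * indicator {0..<N} u \<partial>lborel)"
  proof (intro suminf_cong)
    fix k
    have "(\<integral>\<^sup>+s. F s * indicator (?I k) s \<partial>lborel)
      = (\<integral>\<^sup>+u. F (real k * N + 1 * u) * indicator (?I k) (real k * N + 1 * u) \<partial>lborel)"
      by (subst nn_integral_real_affine[where c = 1 and t = "real k * N"]) auto
    also have "(\<lambda>u. indicator (?I k) (real k * N + 1 * u) :: ennreal) = indicator {0..<N}"
      by (auto simp: indicator_def)
    finally show "(\<integral>\<^sup>+s. F s * indicator (?I k) s \<partial>lborel) = (\<integral>\<^sup>+u. F (u + real k * N) * indicator {0..<N} u \<partial>lborel)"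
      by (simp add: add.commute fun_eq_iff)
  qed
  also have "\<dots> = (\<integral>\<^sup>+u. (\<Sum>k. F (u + real k * N) * indicator {0..<N} u) \<partial>lborel)"
    by (rule nn_integral_suminf[symmetric]) measurable
  finally show ?thesis by simp
qed

lemma exp_negative_half_line:
  "integrable lborel (\<lambda>s::real. indicator {..<0} s * exp s)" "(LINT s|lborel. indicator {..<0} s * exp s) = (1::real)"
proof -
  let ?f = "\<lambda>s::real. indicator {..<0} s * exp s :: real"
  have "(\<integral>\<^sup>+s. ennreal (?f s) \<partial>lborel) = (\<integral>\<^sup>+s. ennreal (?f (0 + - 1 * s)) \<partial>lborel)"
    by (subst nn_integral_real_affine[where c = "- 1" and t = 0]) auto
  also have "\<dots> = (\<integral>\<^sup>+s. ennreal (exp (- s)) * indicator {0..} s \<partial>lborel)"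
    using AE_lborel_singleton[of "0::real"]
    by (intro nn_integral_cong_AE) (auto simp: indicator_def elim!: eventually_mono)
  also have "\<dots> = ennreal (0 - - exp (- 0))"
  proof (rule nn_integral_FTC_atLeast)
    show "((\<lambda>s. - exp (- s)) has_real_derivative exp (- s)) (at s)" for s :: real
      by (auto intro!: derivative_eq_intros)
    have "((\<lambda>s::real. exp (- s)) \<longlongrightarrow> 0) at_top"
      by (rule filterlim_compose[OF exp_at_bot filterlim_uminus_at_bot_at_top])
    from tendsto_minus[OF this] show "((\<lambda>s::real. - exp (- s)) \<longlongrightarrow> 0) at_top" by simp
  qed auto
  finally have "(\<integral>\<^sup>+s. ennreal (?f s) \<partial>lborel) = ennreal 1" by simp
  then have "has_bochner_integral lborel ?f 1"
    by (intro has_bochner_integral_nn_integral) (auto intro!: AE_I2)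
  then show "integrable lborel ?f" "(LINT s|lborel. ?f s) = 1"
    by (auto simp: has_bochner_integral_iff)
qed

text \<open>Monotone interpolation between integer times.\<close>

lemma tendsto_over_real_of_nat:
  fixes a :: "nat \<Rightarrow> real" and b :: "real \<Rightarrow> real"
  assumes lim: "(\<lambda>n. a n / real n) \<longlonglongrightarrow> c"
    and mono: "\<And>s t. 0 \<le> s \<Longrightarrow> s \<le> t \<Longrightarrow> b s \<le> b t" and b: "\<And>n. b (real n) = a n" and nonneg: "\<And>t. 0 \<le> b t"
  shows "((\<lambda>t. b t / t) \<longlongrightarrow> c) at_top"
proof -
  let ?n = "\<lambda>t. nat \<lfloor>t\<rfloor>"
  have n: "filterlim ?n sequentially at_top"
    by (rule filterlim_compose[OF filterlim_nat_sequentially filterlim_floor_sequentially])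
  have "(\<lambda>n. (a n / real n) * (real n / real (Suc n))) \<longlonglongrightarrow> c * 1"
    by (intro tendsto_mult lim LIMSEQ_n_over_Suc_n)
  then have low: "((\<lambda>t. (a (?n t) / real (?n t)) * (real (?n t) / real (Suc (?n t)))) \<longlongrightarrow> c * 1) at_top"
    by (rule filterlim_compose[OF _ n])
  have "(\<lambda>n. (a (Suc n) / real (Suc n)) * (real (Suc n) / real n)) \<longlonglongrightarrow> c * 1"
    by (intro tendsto_mult LIMSEQ_Suc[OF lim] LIMSEQ_Suc_n_over_n)
  then have up: "((\<lambda>t. (a (Suc (?n t)) / real (Suc (?n t))) * (real (Suc (?n t)) / real (?n t))) \<longlongrightarrow> c * 1) at_top"
    by (rule filterlim_compose[OF _ n])
  show ?thesis
  proof (rule tendsto_sandwich[OF _ _ low[unfolded mult_1_right] up[unfolded mult_1_right]])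
    show "eventually (\<lambda>t. (a (?n t) / real (?n t)) * (real (?n t) / real (Suc (?n t))) \<le> b t / t) at_top"
      using eventually_ge_at_top[of 1]
    proof eventually_elim
      case (elim t)
      then have t: "1 \<le> ?n t" "real (?n t) \<le> t" "t \<le> real (Suc (?n t))" by linarith+
      have "(a (?n t) / real (?n t)) * (real (?n t) / real (Suc (?n t))) = b (real (?n t)) / real (Suc (?n t))"
        unfolding b using t(1) elim by simp
      also have "\<dots> \<le> b t / t"
        using t elim nonneg by (intro frac_le mono) auto
      finally show ?case .
    qed
    show "eventually (\<lambda>t. b t / t \<le> (a (Suc (?n t)) / real (Suc (?n t))) * (real (Suc (?n t)) / real (?n t))) at_top"
      using eventually_ge_at_top[of 1]
    proof eventually_elim
      case (elim t)
      then have t: "1 \<le> ?n t" "real (?n t) \<le> t" "t \<le> real (Suc (?n t))" by linarith+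
      have "b t / t \<le> b (real (Suc (?n t))) / real (?n t)"
        using t elim nonneg by (intro frac_le mono) auto
      also have "\<dots> = (a (Suc (?n t)) / real (Suc (?n t))) * (real (Suc (?n t)) / real (?n t))"
        by (simp only: b) simp
      finally show "b t / t \<le> (a (Suc (?n t)) / real (Suc (?n t))) * (real (Suc (?n t)) / real (?n t))" .
    qed
  qed
qed

section \<open>Left limits of cadlag paths\<close>

lemma Lim_at_left_tendsto:
  fixes f :: "real \<Rightarrow> real"
  assumes "cadlag_on {0..} f" "0 < r" shows "(f \<longlongrightarrow> Lim (at_left r) f) (at_left r)"
proof -
  obtain l where "(f \<longlongrightarrow> l) (at_left r)" using assms by (auto simp: cadlag_on_half_line_iff)
  then show ?thesis using tendsto_Lim[of "at_left r" f l] by simp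
qed

lemma abs_Lim_at_left_le:
  fixes f :: "real \<Rightarrow> real"
  assumes "cadlag_on {0..} f" "0 < r" "eventually (\<lambda>s. \<bar>f s - L\<bar> \<le> e) (at_left r)"
  shows "\<bar>Lim (at_left r) f - L\<bar> \<le> e"
proof (rule tendsto_upperbound[where F = "at_left r"])
  show "((\<lambda>s. \<bar>f s - L\<bar>) \<longlongrightarrow> \<bar>Lim (at_left r) f - L\<bar>) (at_left r)"
    by (intro tendsto_intros Lim_at_left_tendsto assms)
qed (use assms(3) in auto)

lemma eventually_at_left_mem_Ioo:
  fixes a b r :: real
  assumes "a < r" "r \<le> b" "\<And>s. a < s \<Longrightarrow> s < b \<Longrightarrow> P s" shows "eventually P (at_left r)"
  unfolding eventually_at_left[OF assms(1)] using assms by (intro exI[of _ a]) auto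

text \<open>A closed neighbourhood that contains the values of \<open>f\<close> on an interval also contains the left limits
  there. Hence passing to left limits turns a path that is continuous from the right into one that is continuous from the left, and
  reversing time turns it back.\<close>

lemma tendsto_Lim_at_left_at_right:
  fixes f :: "real \<Rightarrow> real"
  assumes f: "cadlag_on {0..} f" and a: "0 \<le> a"
  shows "((\<lambda>r. Lim (at_left r) f) \<longlongrightarrow> f a) (at_right a)"
proof (rule tendstoI)
  fix e :: real assume "0 < e"
  have "(f \<longlongrightarrow> f a) (at_right a)" using f a by (simp add: cadlag_on_half_line_iff)
  from tendstoD[OF this, of "e / 2"] \<open>0 < e\<close> obtain b where b: "a < b" "\<And>s. a < s \<Longrightarrow> s < b \<Longrightarrow> \<bar>f s - f a\<bar> < e / 2"
    by (auto simp: dist_real_def eventually_at_right[of a "a + 1"])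
  have "\<bar>Lim (at_left r) f - f a\<bar> \<le> e / 2" if "a < r" "r < b" for r
    by (rule abs_Lim_at_left_le[OF f], use a that in simp, rule eventually_at_left_mem_Ioo[of a r b])
       (use b(2) that in \<open>auto intro: less_imp_le\<close>)
  then show "eventually (\<lambda>r. dist (Lim (at_left r) f) (f a) < e) (at_right a)"
    unfolding eventually_at_right[OF b(1)]
    by (intro exI[of _ b] conjI b(1) allI impI) (use \<open>0 < e\<close> in \<open>force simp: dist_real_def\<close>)
qed

lemma tendsto_Lim_at_left_at_left:
  fixes f :: "real \<Rightarrow> real"
  assumes f: "cadlag_on {0..} f" and a: "0 < a"
  shows "((\<lambda>r. Lim (at_left r) f) \<longlongrightarrow> Lim (at_left a) f) (at_left a)"
proof (rule tendstoI)
  fix e :: real assume "0 < e"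
  from tendstoD[OF Lim_at_left_tendsto[OF f a], of "e / 2"] \<open>0 < e\<close>
  obtain b where b: "b < a" "\<And>s. b < s \<Longrightarrow> s < a \<Longrightarrow> \<bar>f s - Lim (at_left a) f\<bar> < e / 2"
    by (auto simp: dist_real_def eventually_at_left[of "a - 1" a])
  define c where "c = max b 0"
  have c: "c < a" using b a by (simp add: c_def)
  have "\<bar>Lim (at_left r) f - Lim (at_left a) f\<bar> \<le> e / 2" if "c < r" "r < a" for r
    by (rule abs_Lim_at_left_le[OF f], use that in \<open>simp add: c_def\<close>, rule eventually_at_left_mem_Ioo[of c r a])
       (use b(2) that in \<open>auto simp: c_def intro: less_imp_le\<close>)
  then show "eventually (\<lambda>r. dist (Lim (at_left r) f) (Lim (at_left a) f) < e) (at_left a)"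
    unfolding eventually_at_left[OF c]
    by (intro exI[of _ c] conjI c allI impI) (use \<open>0 < e\<close> in \<open>force simp: dist_real_def\<close>)
qed

lemma filterlim_uminus_at_left: "filterlim (\<lambda>s::real. - s) (at_right (- t)) (at_left t)"
proof -
  have "((\<lambda>s::real. - s) \<longlongrightarrow> - t) (at_left t)" by (intro tendsto_intros)
  then show ?thesis by (simp add: filterlim_at eventually_at_filter)
qed

lemma filterlim_uminus_at_right: "filterlim (\<lambda>s::real. - s) (at_left (- t)) (at_right t)"
proof -
  have "((\<lambda>s::real. - s) \<longlongrightarrow> - t) (at_right t)" by (intro tendsto_intros)
  then show ?thesis by (simp add: filterlim_at eventually_at_filter)
qed

lemma cadlag_xi_tilde:
  assumes "cadlag_on {0..} (\<lambda>t. \<xi> t \<omega>)" and \<eta>: "cadlag_on {0..} (\<lambda>t. \<eta> t \<omega>)"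
  shows "cadlag_on UNIV (\<lambda>t. xi_tilde \<xi> \<eta> t \<omega>)"
proof -
  let ?X = "\<lambda>t. xi_tilde \<xi> \<eta> t \<omega>"
  let ?g = "\<lambda>r. Lim (at_left r) (\<lambda>s. \<eta> s \<omega>)"
  have neg: "?X s = ?g (- s)" if "s < 0" for s using that by (simp add: xi_tilde_def)
  have pos: "?X s = \<xi> s \<omega>" if "0 \<le> s" for s using that by (simp add: xi_tilde_def)
  have ev_right: "eventually (\<lambda>s. \<xi> s \<omega> = ?X s) (at_right t)" if "0 \<le> t" for t
    using that by (auto simp: eventually_at_filter pos intro!: always_eventually)
  have ev_left: "eventually (\<lambda>s. \<xi> s \<omega> = ?X s) (at_left t)" if "0 < t" for t
    by (rule eventually_at_left_mem_Ioo[of 0 t t]) (use that pos in auto)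
  have ev_left': "eventually (\<lambda>s. ?g (- s) = ?X s) (at_left t)" if "t \<le> 0" for t
    using that by (auto simp: eventually_at_filter neg intro!: always_eventually)
  have ev_right': "eventually (\<lambda>s. ?g (- s) = ?X s) (at_right t)" if "t < 0" for t
    unfolding eventually_at_right[OF that] using that neg by (intro exI[of _ 0]) auto
  show ?thesis
    unfolding cadlag_on_UNIV_iff
  proof (intro allI conjI)
    fix t
    show "(?X \<longlongrightarrow> ?X t) (at_right t)"
    proof (cases "0 \<le> t")
      case True
      then have "((\<lambda>s. \<xi> s \<omega>) \<longlongrightarrow> \<xi> t \<omega>) (at_right t)" using assms by (simp add: cadlag_on_half_line_iff)
      then show ?thesis using tendsto_cong[OF ev_right[OF True]] pos[OF True] by simp
    next
      case False
      have "((\<lambda>s. ?g (- s)) \<longlongrightarrow> ?g (- t)) (at_right t)"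
        by (rule filterlim_compose[OF tendsto_Lim_at_left_at_left[OF \<eta>] filterlim_uminus_at_right]) (use False in simp)
      then show ?thesis using tendsto_cong[OF ev_right'] neg False by simp
    qed
    show "\<exists>l. (?X \<longlongrightarrow> l) (at_left t)"
    proof (cases "0 < t")
      case True
      then obtain l where "((\<lambda>s. \<xi> s \<omega>) \<longlongrightarrow> l) (at_left t)" using assms by (auto simp: cadlag_on_half_line_iff)
      then show ?thesis using tendsto_cong[OF ev_left[OF True]] by blast
    next
      case False
      have "((\<lambda>s. ?g (- s)) \<longlongrightarrow> \<eta> (- t) \<omega>) (at_left t)"
        by (rule filterlim_compose[OF tendsto_Lim_at_left_at_right[OF \<eta>] filterlim_uminus_at_left]) (use False in simp)
      then show ?thesis using tendsto_cong[OF ev_left'] False by (metis not_less)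
    qed
  qed
qed

lemma xi_tilde_measurable:
  assumes \<xi>: "\<And>t. 0 \<le> t \<Longrightarrow> \<xi> t \<in> borel_measurable N" "\<And>\<omega>. \<omega> \<in> space N \<Longrightarrow> cadlag_on {0..} (\<lambda>t. \<xi> t \<omega>)"
    and \<eta>: "\<And>t. 0 \<le> t \<Longrightarrow> \<eta> t \<in> borel_measurable N" "\<And>\<omega>. \<omega> \<in> space N \<Longrightarrow> cadlag_on {0..} (\<lambda>t. \<eta> t \<omega>)"
  shows "(\<lambda>\<omega> t. xi_tilde \<xi> \<eta> t \<omega>) \<in> N \<rightarrow>\<^sub>M path_space"
  unfolding measurable_path_space_iff[of _ N]
proof safe
  fix t
  show "xi_tilde \<xi> \<eta> t \<in> borel_measurable N"
  proof (cases "0 \<le> t")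
    case True
    then show ?thesis using \<xi>(1) by (simp add: xi_tilde_def[abs_def])
  next
    case False
    let ?r = "\<lambda>n. - t - (- t) / real (Suc (Suc n))"
    have pos: "0 \<le> ?r n" for n
    proof -
      have "(- t) / real (Suc (Suc n)) \<le> (- t) / 1" using False by (intro divide_left_mono) auto
      then show ?thesis by simp
    qed
    have "?r \<longlonglongrightarrow> - t - 0"
      by (intro tendsto_intros LIMSEQ_Suc[where f = "\<lambda>n. (- t) / real (Suc n)"] LIMSEQ_Suc[where f = "\<lambda>n. (- t) / real n"] lim_const_over_n)
    moreover have "?r n < - t" for n
    proof -
      have "0 < (- t) / real (Suc (Suc n))" using False by (intro divide_pos_pos) auto
      then show ?thesis by linarith
    qed
    ultimately have r: "filterlim ?r (at_left (- t)) sequentially"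
      by (simp add: filterlim_at less_imp_neq)
    have "(\<lambda>\<omega>. Lim (at_left (- t)) (\<lambda>s. \<eta> s \<omega>)) \<in> borel_measurable N"
    proof (rule borel_measurable_LIMSEQ_real)
      show "\<eta> (?r n) \<in> borel_measurable N" for n by (rule \<eta>(1)[OF pos])
      show "(\<lambda>n. \<eta> (?r n) \<omega>) \<longlonglongrightarrow> Lim (at_left (- t)) (\<lambda>s. \<eta> s \<omega>)" if "\<omega> \<in> space N" for \<omega>
        by (rule filterlim_compose[OF Lim_at_left_tendsto[OF \<eta>(2)[OF that]] r]) (use False in simp)
    qed
    then show ?thesis using False by (simp add: xi_tilde_def[abs_def])
  qed
next
  fix \<omega> assume "\<omega> \<in> space N"
  then show "cadlag_on UNIV (\<lambda>t. xi_tilde \<xi> \<eta> t \<omega>)" by (intro cadlag_xi_tilde \<xi>(2) \<eta>(2))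
qed

section \<open>Boxes of paths\<close>

definition path_box :: "real set \<Rightarrow> (real \<Rightarrow> real set) \<Rightarrow> (real \<Rightarrow> real) set" where
  "path_box J A = {w \<in> space path_space. \<forall>t\<in>J. w t \<in> A t}"

definition path_boxes :: "(real \<Rightarrow> real) set set" where
  "path_boxes = {path_box J A | J A. finite J \<and> (\<forall>t. A t \<in> sets borel)}"

lemma path_box_sets: "finite J \<Longrightarrow> (\<And>t. A t \<in> sets borel) \<Longrightarrow> path_box J A \<in> sets path_space"
  unfolding path_box_def
proof (rule sets.sets_Collect_finite_All)
  fix t assume "\<And>t. A t \<in> sets borel"
  then have "(\<lambda>w. w t) -` A t \<inter> space path_space \<in> sets path_space"
    by (intro measurable_sets[OF eval_measurable])
  then show "{w \<in> space path_space. w t \<in> A t} \<in> sets path_space"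
    by (simp add: vimage_def Int_def conj_commute)
qed

lemma Int_stable_path_boxes: "Int_stable path_boxes"
proof (rule Int_stableI)
  fix a b assume "a \<in> path_boxes" "b \<in> path_boxes"
  then obtain J A K B where *: "finite J" "finite K" "\<And>t. A t \<in> sets borel" "\<And>t. B t \<in> sets borel"
    "a = path_box J A" "b = path_box K B" unfolding path_boxes_def by blast
  let ?C = "\<lambda>t. (if t \<in> J then A t else UNIV) \<inter> (if t \<in> K then B t else UNIV)"
  have "a \<inter> b = path_box (J \<union> K) ?C" unfolding * path_box_def by auto
  moreover have "\<forall>t. ?C t \<in> sets borel" using * by auto
  ultimately show "a \<inter> b \<in> path_boxes"
    unfolding path_boxes_def using *(1,2) by (intro CollectI exI[of _ "J \<union> K"] exI[of _ ?C]) simp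
qed

lemma path_boxes_Pow: "path_boxes \<subseteq> Pow (space path_space)"
  by (auto simp: path_boxes_def path_box_def)

text \<open>For the sigma-algebra generated by the boxes the coordinate maps are measurable, hence so is the
  identity into path space.\<close>

lemma sets_path_space_boxes: "sets path_space = sigma_sets (space path_space) path_boxes"
proof
  show "sigma_sets (space path_space) path_boxes \<subseteq> sets path_space"
    by (rule sets.sigma_sets_subset) (auto simp: path_boxes_def intro: path_box_sets)
  let ?S = "sigma (space path_space) path_boxes"
  have S: "space ?S = space path_space" "sets ?S = sigma_sets (space path_space) path_boxes"
    using path_boxes_Pow by (simp_all add: space_measure_of sets_measure_of)
  have "(\<lambda>w. w) \<in> ?S \<rightarrow>\<^sub>M path_space"
    unfolding measurable_path_space_iff[of _ ?S]
  proof safe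
    fix t :: real
    show "(\<lambda>w. w t) \<in> borel_measurable ?S"
    proof (rule measurableI)
      fix A :: "real set" assume A: "A \<in> sets borel"
      have "(\<lambda>w. w t) -` A \<inter> space ?S = path_box {t} (\<lambda>_. A)" by (auto simp: S path_box_def)
      also have "\<dots> \<in> path_boxes"
        using A by (auto simp: path_boxes_def intro!: exI[of _ "{t}"] exI[of _ "\<lambda>_. A"])
      finally show "(\<lambda>w. w t) -` A \<inter> space ?S \<in> sets ?S" unfolding S by blast
    qed simp
  next
    fix w assume "w \<in> space ?S"
    then have "w \<in> space path_space" unfolding S(1) .
    then show "cadlag_on UNIV w" by (simp add: space_path_space)
  qed
  then have "B \<in> sets ?S" if "B \<in> sets path_space" for B
    using measurable_sets[OF _ that, of "\<lambda>w. w" ?S] sets.sets_into_space[OF that] by (simp add: S Int_absorb2)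
  then show "sets path_space \<subseteq> sigma_sets (space path_space) path_boxes" unfolding S by blast
qed

lemma path_measure_eqI:
  assumes "finite_measure L" "sets L = sets path_space" "sets L' = sets path_space"
    and eq: "\<And>J A. finite J \<Longrightarrow> (\<And>t. A t \<in> sets borel) \<Longrightarrow> emeasure L (path_box J A) = emeasure L' (path_box J A)"
  shows "L = L'"
proof (rule measure_eqI_generator_eq[OF Int_stable_path_boxes path_boxes_Pow])
  show "emeasure L B = emeasure L' B" if "B \<in> path_boxes" for B
    using that eq by (auto simp: path_boxes_def)
  have "space path_space = path_box {} (\<lambda>_. UNIV)" by (simp add: path_box_def)
  also have "\<dots> \<in> path_boxes" by (auto simp: path_boxes_def intro!: exI[of _ "{}"] exI[of _ "\<lambda>_. UNIV"])
  finally show "range (\<lambda>_::nat. space path_space) \<subseteq> path_boxes" by simp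
  show "emeasure L (space path_space) \<noteq> \<infinity>" using finite_measure.emeasure_finite[OF assms(1)] by simp
qed (use assms sets_path_space_boxes in auto)

text \<open>The values of a function on a grid, relative to its value at the grid point \<open>j\<close>, in terms of
  its increments \<open>d\<close> along the grid.\<close>

definition partial_sums_from :: "nat \<Rightarrow> (nat \<Rightarrow> real) \<Rightarrow> nat \<Rightarrow> real" where
  "partial_sums_from j d k = (if j \<le> k then \<Sum>i=j..<k. d i else - (\<Sum>i=k..<j. d i))"

lemma partial_sums_from_differences:
  "partial_sums_from j (\<lambda>i. f (Suc i) - f i) k = f k - (f j :: real)"
  using sum_Suc_diff'[of j k f] sum_Suc_diff'[of k j f] by (auto simp: partial_sums_from_def)

lemma finite_box_sets:
  fixes f :: "nat \<Rightarrow> 'b \<Rightarrow> real"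
  assumes f: "\<And>i. i < n \<Longrightarrow> f i \<in> borel_measurable N" and A: "\<And>i. A i \<in> sets borel"
  shows "{\<omega> \<in> space N. \<forall>i<n. f i \<omega> \<in> A i} \<in> sets N"
proof -
  have "{\<omega> \<in> space N. f i \<omega> \<in> A i} \<in> sets N" if "i < n" for i
    using measurable_sets[OF f[OF that] A[of i]] by (simp add: vimage_def Int_def conj_commute)
  then have "{\<omega> \<in> space N. \<forall>i\<in>{..<n}. f i \<omega> \<in> A i} \<in> sets N"
    by (intro sets.sets_Collect_finite_All) auto
  then show ?thesis by (simp only: Ball_def lessThan_iff)
qed

lemma partial_sums_from_restrict:
  assumes "j \<le> n" "k \<le> n"
  shows "partial_sums_from j (\<lambda>i\<in>{..<n}. d i) k = partial_sums_from j d k"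
  using assms by (auto simp: partial_sums_from_def intro!: sum.cong)

text \<open>The completion absorbs the null set on which the paths differ from those of a measurable map into
  path space.\<close>

lemma path_law_eq_distr:
  assumes F: "F \<in> N \<rightarrow>\<^sub>M path_space" and ae: "AE \<omega> in N. (\<lambda>t. Y t \<omega>) = F \<omega>"
  shows "path_law N Y = distr N path_space F"
proof -
  define G where "G \<omega> = (if cadlag_on UNIV (\<lambda>t. Y t \<omega>) then (\<lambda>t. Y t \<omega>) else (\<lambda>_. 0))" for \<omega>
  have zero: "cadlag_on UNIV (\<lambda>_::real. 0 :: real)" unfolding cadlag_on_UNIV_iff by auto
  have G_space: "G \<omega> \<in> space path_space" for \<omega> using zero by (simp add: G_def space_path_space)
  have GF: "AE \<omega> in N. G \<omega> = F \<omega>"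
    using ae AE_space
  proof eventually_elim
    case (elim \<omega>)
    have "cadlag_on UNIV (F \<omega>)" using measurable_space[OF F elim(2)] by (simp add: space_path_space)
    then show ?case using elim(1) by (simp add: G_def)
  qed
  have GB: "G -` B \<inter> space (completion N) \<in> sets (completion N)" if B: "B \<in> sets path_space" for B
  proof -
    have "AE \<omega> in N. \<not> ((G \<omega> \<in> B) \<noteq> (F \<omega> \<in> B))" using GF by eventually_elim simp
    from sets_completion_AE[OF this]
    have 1: "{\<omega> \<in> space (completion N). (G \<omega> \<in> B) \<noteq> (F \<omega> \<in> B)} \<in> sets (completion N)" by (simp add: pred_def)
    have 2: "F -` B \<inter> space (completion N) \<in> sets (completion N)"
      by (rule measurable_sets[OF measurable_completion[OF F] B])
    have "G -` B \<inter> space (completion N) = (F -` B \<inter> space (completion N) - {\<omega> \<in> space (completion N). (G \<omega> \<in> B) \<noteq> (F \<omega> \<in> B)})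
      \<union> ({\<omega> \<in> space (completion N). (G \<omega> \<in> B) \<noteq> (F \<omega> \<in> B)} - (F -` B \<inter> space (completion N)))" by blast
    then show ?thesis using 1 2 by (simp only:) (intro sets.Un sets.Diff)
  qed
  then have G: "G \<in> completion N \<rightarrow>\<^sub>M path_space" using G_space by (intro measurableI) auto
  have "path_law N Y = distr (completion N) path_space G"
    by (simp add: path_law_def G_def[abs_def])
  also have "\<dots> = distr (completion N) path_space F"
    by (rule distr_cong_AE[OF refl refl AE_completion[OF GF] G measurable_completion[OF F]])
  also have "\<dots> = distr N path_space F" by (rule distr_completion[OF F])
  finally show ?thesis .
qed

text \<open>By the identity \<open>past_exp_T_path\<close>, the time change on the positive half-line depends on the past only through
  the integral \<open>1 / x\<close>, and it inverts the exponential functional of \<open>\<xi>\<close> at \<open>(exp t - 1) / x\<close>, as in the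
  construction of Lamperti.\<close>

lemma ou_from_eq_U_path:
  assumes w: "clock_path w" and pos: "\<And>s. 0 \<le> s \<Longrightarrow> w s = \<xi> s \<omega>" and t: "0 \<le> t" and x: "x = 1 / past_exp w 0"
  shows "ou_from \<xi> x t \<omega> = U_path w t"
proof -
  interpret clock_path w by fact
  have T0: "0 \<le> T_path w t" using T_path_le_iff[of 0 t] t by simp
  have E: "exp_functional \<xi> s \<omega> = past_exp w s - past_exp w 0" if s: "0 \<le> s" for s
  proof -
    have "exp_functional \<xi> s \<omega> = (LINT r:{0<..s}|lborel. exp (\<xi> r \<omega>))"
      unfolding exp_functional_def zero_ereal_def by (rule interval_integral_Ioc[OF s])
    also have "\<dots> = (LINT r:{0<..s}|lborel. exp (w r))"
      by (rule set_lebesgue_integral_cong) (auto simp: pos)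
    also have "\<dots> = past_exp w s - past_exp w 0" by (rule past_exp_diff[OF s, symmetric])
    finally show ?thesis .
  qed
  have inj: "inj_on (\<lambda>s. exp_functional \<xi> s \<omega>) {0..}"
  proof (rule inj_onI)
    fix a b :: real assume "a \<in> {0..}" "b \<in> {0..}" "exp_functional \<xi> a \<omega> = exp_functional \<xi> b \<omega>"
    then have "past_exp w a = past_exp w b" by (simp add: E)
    then show "a = b" using past_exp_strict_mono[of a b] past_exp_strict_mono[of b a] by linarith
  qed
  have "exp_functional \<xi> (T_path w t) \<omega> = (exp t - 1) / x"
    by (simp add: E[OF T0] past_exp_T_path x algebra_simps)
  then have "lamperti_clock \<xi> ((exp t - 1) / x) \<omega> = T_path w t"
    unfolding lamperti_clock_def by (intro inv_into_f_eq[OF inj]) (use T0 in simp_all)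
  then show ?thesis
    by (simp add: ou_from_def lamperti_from_def lamperti_def U_path_eq x pos[OF T0] exp_minus field_simps)
qed

section \<open>The two-sided Levy process\<close>

locale two_sided_levy =
  fixes M :: "'a measure" and \<xi> \<eta> :: "real \<Rightarrow> 'a \<Rightarrow> real"
  assumes levy: "levy_process M \<xi>"
    and drift: "drifts_to_infinity M \<xi>"
    and copy: "independent_negative_copy M \<xi> \<eta>"
begin

sublocale prob_space M using levy by (simp add: levy_process_def)

abbreviation half_line_space :: "(real \<Rightarrow> real) measure" where
  "half_line_space \<equiv> PiM {0..} (\<lambda>_. borel)"

definition X :: "'a \<Rightarrow> real \<Rightarrow> real" where "X \<omega> t = xi_tilde \<xi> \<eta> t \<omega>"

text \<open>The sigma-algebras generated by the two halves. Keeping both on the sample space lets the functionals of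
  either half be combined without transporting them to laws of paths.\<close>

definition Fxi :: "'a measure" where "Fxi = vimage_algebra (space M) (half_line_path \<xi>) half_line_space"
definition Feta :: "'a measure" where "Feta = vimage_algebra (space M) (half_line_path \<eta>) half_line_space"

lemma xi_measurable[measurable]: "0 \<le> t \<Longrightarrow> \<xi> t \<in> borel_measurable M"
  using levy by (simp add: levy_process_def)

lemma eta_measurable[measurable]: "0 \<le> t \<Longrightarrow> \<eta> t \<in> borel_measurable M"
  using copy by (simp add: independent_negative_copy_def)

lemma xi_cadlag: "\<omega> \<in> space M \<Longrightarrow> cadlag_on {0..} (\<lambda>t. \<xi> t \<omega>)"
  using levy by (simp add: levy_process_def)

lemma eta_cadlag: "\<omega> \<in> space M \<Longrightarrow> cadlag_on {0..} (\<lambda>t. \<eta> t \<omega>)"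
  using copy by (simp add: independent_negative_copy_def)

lemma xi_0: "AE \<omega> in M. \<xi> 0 \<omega> = 0"
  using levy by (simp add: levy_process_def)

lemma half_line_path_measurable:
  "(\<And>t. 0 \<le> t \<Longrightarrow> Z t \<in> borel_measurable N) \<Longrightarrow> half_line_path Z \<in> N \<rightarrow>\<^sub>M half_line_space"
  unfolding half_line_path_def by (intro measurable_restrict) auto

lemma space_F[simp]: "space Fxi = space M" "space Feta = space M"
  by (simp_all add: Fxi_def Feta_def)

lemma half_line_path_funcset: "half_line_path Z \<in> A \<rightarrow> space half_line_space"
  by (auto simp: half_line_path_def space_PiM)

lemma sets_F:
  "sets Fxi = {half_line_path \<xi> -` A \<inter> space M | A. A \<in> sets half_line_space}"
  "sets Feta = {half_line_path \<eta> -` A \<inter> space M | A. A \<in> sets half_line_space}"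
  unfolding Fxi_def Feta_def by (intro sets_vimage_algebra2 half_line_path_funcset)+

lemma sets_F_subset: "sets Fxi \<subseteq> sets M" "sets Feta \<subseteq> sets M"
  unfolding sets_F by (auto intro!: measurable_sets[OF half_line_path_measurable])

lemma xi_measurable_Fxi: "0 \<le> t \<Longrightarrow> \<xi> t \<in> borel_measurable Fxi"
proof -
  assume t: "0 \<le> t"
  have "(\<lambda>\<omega>. half_line_path \<xi> \<omega> t) \<in> borel_measurable Fxi"
    unfolding Fxi_def
    by (rule measurable_compose[OF measurable_vimage_algebra1[OF half_line_path_funcset] measurable_component_singleton])
       (use t in simp)
  then show ?thesis using t by (simp add: half_line_path_def)
qed

lemma eta_measurable_Feta: "0 \<le> t \<Longrightarrow> \<eta> t \<in> borel_measurable Feta"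
proof -
  assume t: "0 \<le> t"
  have "(\<lambda>\<omega>. half_line_path \<eta> \<omega> t) \<in> borel_measurable Feta"
    unfolding Feta_def
    by (rule measurable_compose[OF measurable_vimage_algebra1[OF half_line_path_funcset] measurable_component_singleton])
       (use t in simp)
  then show ?thesis using t by (simp add: half_line_path_def)
qed

lemma id_measurable_F: "(\<lambda>\<omega>. \<omega>) \<in> M \<rightarrow>\<^sub>M Fxi" "(\<lambda>\<omega>. \<omega>) \<in> M \<rightarrow>\<^sub>M Feta"
proof -
  have "(\<lambda>\<omega>. \<omega>) -` A \<inter> space M \<in> sets M" if "A \<in> sets M" for A
    using that by simp
  then show "(\<lambda>\<omega>. \<omega>) \<in> M \<rightarrow>\<^sub>M Fxi" "(\<lambda>\<omega>. \<omega>) \<in> M \<rightarrow>\<^sub>M Feta"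
    using sets_F_subset by (auto intro!: measurableI)
qed

lemma indep_var_F: "indep_var Fxi (\<lambda>\<omega>. \<omega>) Feta (\<lambda>\<omega>. \<omega>)"
proof -
  have id_vimage: "{(\<lambda>\<omega>. \<omega>) -` A \<inter> space M |A. A \<in> sets F} = sets F" if "space F = space M" for F :: "'a measure"
  proof -
    have "(\<lambda>\<omega>. \<omega>) -` A \<inter> space M = A" if "A \<in> sets F" for A
      using sets.sets_into_space[OF that] \<open>space F = space M\<close> by auto
    then show ?thesis by (auto intro!: exI)
  qed
  have "indep_var half_line_space (half_line_path \<xi>) half_line_space (half_line_path \<eta>)"
    using copy by (simp add: independent_negative_copy_def)
  then show ?thesis
    unfolding indep_var_eq id_vimage[OF space_F(1)] id_vimage[OF space_F(2)] sets_F[symmetric]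
    using id_measurable_F by blast
qed

lemma prob_Int_F:
  assumes A: "A \<in> sets Feta" and B: "B \<in> sets Fxi" shows "prob (A \<inter> B) = prob A * prob B"
proof -
  have sub: "A \<subseteq> space M" "B \<subseteq> space M"
    using A B sets.sets_into_space[of _ Feta] sets.sets_into_space[of _ Fxi] by simp_all
  have "prob ((\<lambda>\<omega>. (\<omega>, \<omega>)) -` (B \<times> A) \<inter> space M) = prob ((\<lambda>\<omega>. \<omega>) -` B \<inter> space M) * prob ((\<lambda>\<omega>. \<omega>) -` A \<inter> space M)"
    by (rule indep_varD[OF indep_var_F B A])
  moreover have "(\<lambda>\<omega>. (\<omega>, \<omega>)) -` (B \<times> A) \<inter> space M = A \<inter> B" "(\<lambda>\<omega>. \<omega>) -` B \<inter> space M = B"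
    "(\<lambda>\<omega>. \<omega>) -` A \<inter> space M = A" using sub by auto
  ultimately show ?thesis by (simp add: mult.commute)
qed

text \<open>The diagonal map sends \<open>M\<close> to the product of its restrictions to the two
  sigma-algebras: the two halves of the path may be integrated one after the other.\<close>

lemma nn_integral_decouple:
  assumes \<phi>: "\<phi> \<in> borel_measurable (Fxi \<Otimes>\<^sub>M Feta)"
  shows "(\<integral>\<^sup>+\<omega>. \<phi> (\<omega>, \<omega>) \<partial>M) = (\<integral>\<^sup>+\<omega>1. (\<integral>\<^sup>+\<omega>2. \<phi> (\<omega>2, \<omega>1) \<partial>M) \<partial>M)"
proof -
  note id_measurable_F[measurable]
  let ?Mx = "distr M Fxi (\<lambda>\<omega>. \<omega>)" and ?Me = "distr M Feta (\<lambda>\<omega>. \<omega>)"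
  interpret Mx: prob_space ?Mx by (rule prob_space_distr) simp
  interpret Me: prob_space ?Me by (rule prob_space_distr) simp
  interpret P: pair_sigma_finite ?Mx ?Me ..
  have "sets (?Mx \<Otimes>\<^sub>M ?Me) = sets (Fxi \<Otimes>\<^sub>M Feta)" by (intro sets_pair_measure_cong) auto
  then have \<phi>': "\<phi> \<in> borel_measurable (?Mx \<Otimes>\<^sub>M ?Me)" using \<phi> measurable_cong_sets by blast
  have eq: "?Mx \<Otimes>\<^sub>M ?Me = distr M (Fxi \<Otimes>\<^sub>M Feta) (\<lambda>\<omega>. (\<omega>, \<omega>))"
    using indep_var_F unfolding indep_var_distribution_eq by simp
  have "(\<integral>\<^sup>+\<omega>. \<phi> (\<omega>, \<omega>) \<partial>M) = integral\<^sup>N (?Mx \<Otimes>\<^sub>M ?Me) \<phi>"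
    unfolding eq using \<phi> by (subst nn_integral_distr) auto
  also have "\<dots> = (\<integral>\<^sup>+\<omega>1. (\<integral>\<^sup>+\<omega>2. \<phi> (\<omega>2, \<omega>1) \<partial>?Mx) \<partial>?Me)"
    by (rule P.nn_integral_snd[OF \<phi>', symmetric])
  also have "\<dots> = (\<integral>\<^sup>+\<omega>1. (\<integral>\<^sup>+\<omega>2. \<phi> (\<omega>2, \<omega>1) \<partial>?Mx) \<partial>M)"
    by (subst nn_integral_distr) (use \<phi>' in \<open>auto intro!: Mx.borel_measurable_nn_integral simp: split_beta'\<close>)
  also have "\<dots> = (\<integral>\<^sup>+\<omega>1. (\<integral>\<^sup>+\<omega>2. \<phi> (\<omega>2, \<omega>1) \<partial>M) \<partial>M)"
  proof (intro nn_integral_cong)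
    fix \<omega>1 assume "\<omega>1 \<in> space M"
    then have "(\<lambda>\<omega>2. \<phi> (\<omega>2, \<omega>1)) \<in> borel_measurable Fxi"
      using measurable_compose[OF measurable_Pair2'[of \<omega>1 Feta Fxi] \<phi>] by simp
    then show "(\<integral>\<^sup>+\<omega>2. \<phi> (\<omega>2, \<omega>1) \<partial>?Mx) = (\<integral>\<^sup>+\<omega>2. \<phi> (\<omega>2, \<omega>1) \<partial>M)"
      by (intro nn_integral_distr) auto
  qed
  finally show ?thesis .
qed

lemma X_measurable: "X \<in> M \<rightarrow>\<^sub>M path_space"
  using xi_tilde_measurable[of \<xi> M \<eta>] xi_measurable eta_measurable xi_cadlag eta_cadlag
  by (simp add: X_def[abs_def])

lemma X_component[measurable]: "(\<lambda>\<omega>. X \<omega> t) \<in> borel_measurable M"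
  using X_measurable by (simp add: measurable_path_space_iff)

text \<open>The part of the path before time zero, as a process that is measurable for \<open>\<eta>\<close> alone.\<close>

definition Xpast :: "'a \<Rightarrow> real \<Rightarrow> real" where "Xpast \<omega> t = xi_tilde (\<lambda>_ _. 0) \<eta> t \<omega>"

lemma Xpast_measurable: "Xpast \<in> Feta \<rightarrow>\<^sub>M path_space"
proof -
  have "cadlag_on {0..} (\<lambda>t. 0 :: real)" by (simp add: cadlag_on_def) auto
  then show ?thesis
    using xi_tilde_measurable[of "\<lambda>_ _. 0" Feta \<eta>] eta_measurable_Feta eta_cadlag
    by (simp add: Xpast_def[abs_def])
qed

lemma X_eq_Xpast: "\<xi> 0 \<omega> = 0 \<Longrightarrow> t \<le> 0 \<Longrightarrow> X \<omega> t = Xpast \<omega> t"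
  by (auto simp: X_def Xpast_def xi_tilde_def)

lemma X_nonneg: "0 \<le> t \<Longrightarrow> X \<omega> t = \<xi> t \<omega>"
  by (simp add: X_def xi_tilde_def)

text \<open>Events determined by the values at countably many times have the same probability for \<open>\<eta>\<close> and
  for \<open>- \<xi>\<close>.\<close>

lemma prob_copy:
  assumes P: "{p \<in> space half_line_space. P p} \<in> sets half_line_space"
  shows "prob {\<omega> \<in> space M. P (half_line_path \<eta> \<omega>)} = prob {\<omega> \<in> space M. P (half_line_path (\<lambda>t \<omega>. - \<xi> t \<omega>) \<omega>)}"
proof -
  let ?S = "{p \<in> space half_line_space. P p}"
  have D: "measure (distr M half_line_space (half_line_path Z)) ?S = prob {\<omega> \<in> space M. P (half_line_path Z \<omega>)}"
    if "\<And>t. 0 \<le> t \<Longrightarrow> Z t \<in> borel_measurable M" for Z :: "real \<Rightarrow> 'a \<Rightarrow> real"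
  proof -
    have "half_line_path Z -` ?S \<inter> space M = {\<omega> \<in> space M. P (half_line_path Z \<omega>)}"
      using half_line_path_funcset[of Z UNIV] by auto
    then show ?thesis by (subst measure_distr[OF half_line_path_measurable[OF that] P]) (auto simp del: vimage_Collect_eq)
  qed
  have "distr M half_line_space (half_line_path \<eta>) = distr M half_line_space (half_line_path (\<lambda>t \<omega>. - \<xi> t \<omega>))"
    using copy by (simp add: independent_negative_copy_def)
  then show ?thesis using D[of \<eta>] D[of "\<lambda>t \<omega>. - \<xi> t \<omega>"] by simp
qed

lemma prob_xi_increments:
  assumes t: "0 \<le> t 0" "\<And>i. i < n \<Longrightarrow> t i \<le> t (Suc i)" and A: "\<And>i. A i \<in> sets borel"
  shows "prob {\<omega> \<in> space M. \<forall>i<n. \<xi> (t (Suc i)) \<omega> - \<xi> (t i) \<omega> \<in> A i}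
    = (\<Prod>i<n. prob {\<omega> \<in> space M. \<xi> (t (Suc i) - t i) \<omega> \<in> A i})"
proof (cases "n = 0")
  case True
  then show ?thesis by (simp add: prob_space)
next
  case False
  have nonneg: "0 \<le> t i" if "i \<le> n" for i
    using that
  proof (induction i)
    case (Suc i)
    then show ?case using t(2)[of i] by simp
  qed (use t in simp)
  have "indep_vars (\<lambda>_. borel) (\<lambda>i \<omega>. \<xi> (t (Suc i)) \<omega> - \<xi> (t i) \<omega>) {..<n}"
    using levy t by (auto simp: levy_process_def)
  then have "prob (\<Inter>i\<in>{..<n}. (\<lambda>\<omega>. \<xi> (t (Suc i)) \<omega> - \<xi> (t i) \<omega>) -` A i \<inter> space M)
    = (\<Prod>i<n. prob ((\<lambda>\<omega>. \<xi> (t (Suc i)) \<omega> - \<xi> (t i) \<omega>) -` A i \<inter> space M))"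
    by (rule indep_varsD_finite) (use False A in auto)
  moreover have "(\<Inter>i\<in>{..<n}. (\<lambda>\<omega>. \<xi> (t (Suc i)) \<omega> - \<xi> (t i) \<omega>) -` A i \<inter> space M)
    = {\<omega> \<in> space M. \<forall>i<n. \<xi> (t (Suc i)) \<omega> - \<xi> (t i) \<omega> \<in> A i}"
    using False by auto
  moreover have "prob ((\<lambda>\<omega>. \<xi> (t (Suc i)) \<omega> - \<xi> (t i) \<omega>) -` A i \<inter> space M)
    = prob {\<omega> \<in> space M. \<xi> (t (Suc i) - t i) \<omega> \<in> A i}" if "i < n" for i
  proof -
    have "0 \<le> t i" "0 \<le> t (Suc i) - t i" "0 \<le> t (Suc i)" using nonneg[of i] nonneg[of "Suc i"] t(2)[of i] that by auto
    note [measurable] = this[THEN xi_measurable]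
    have "distr M borel (\<lambda>\<omega>. \<xi> (t i + (t (Suc i) - t i)) \<omega> - \<xi> (t i) \<omega>) = distr M borel (\<xi> (t (Suc i) - t i))"
      using levy \<open>0 \<le> t i\<close> \<open>0 \<le> t (Suc i) - t i\<close> unfolding levy_process_def by blast
    then have "measure (distr M borel (\<lambda>\<omega>. \<xi> (t (Suc i)) \<omega> - \<xi> (t i) \<omega>)) (A i) = measure (distr M borel (\<xi> (t (Suc i) - t i))) (A i)"
      by simp
    then show ?thesis using A
      by (subst (asm) (1 2) measure_distr) (auto simp: vimage_def Int_def conj_commute)
  qed
  ultimately show ?thesis by simp
qed

text \<open>Time reversal: an increment of \<open>\<eta>\<close> backwards in time is distributed as an increment of
  \<open>\<xi>\<close> forwards in time, and the order of the increments is reversed.\<close>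

lemma prob_eta_increments:
  assumes t: "t n \<le> 0" "\<And>i. i < n \<Longrightarrow> t i \<le> t (Suc i)" and A: "\<And>i. A i \<in> sets borel"
  shows "prob {\<omega> \<in> space M. \<forall>i<n. \<eta> (- t (Suc i)) \<omega> - \<eta> (- t i) \<omega> \<in> A i}
    = (\<Prod>i<n. prob {\<omega> \<in> space M. \<xi> (t (Suc i) - t i) \<omega> \<in> A i})"
proof -
  have nonpos: "t i \<le> 0" if "i \<le> n" for i
    using that
  proof (induction rule: inc_induct)
    case (step i)
    then show ?case using t(2)[of i] by simp
  qed (use t in simp)
  let ?P = "\<lambda>p. \<forall>i<n. p (- t (Suc i)) - p (- t i) \<in> A i"
  have meas: "(\<lambda>p. p s) \<in> borel_measurable half_line_space" if "0 \<le> s" for s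
    using that by (intro measurable_component_singleton) simp
  have "{p \<in> space half_line_space. ?P p} \<in> sets half_line_space"
  proof -
    have "{p \<in> space half_line_space. p (- t (Suc i)) - p (- t i) \<in> A i} \<in> sets half_line_space" if "i < n" for i
      by (rule measurable_sets_Collect[OF borel_measurable_diff[OF meas meas]])
         (use nonpos[of i] nonpos[of "Suc i"] that A in auto)
    then have "{p \<in> space half_line_space. \<forall>i\<in>{..<n}. p (- t (Suc i)) - p (- t i) \<in> A i} \<in> sets half_line_space"
      by (intro sets.sets_Collect_finite_All) auto
    then show ?thesis by (simp only: Ball_def lessThan_iff)
  qed
  note copy_eq = prob_copy[OF this]
  have hl: "half_line_path Z \<omega> (- t i) = Z (- t i) \<omega>" if "i \<le> n" for Z :: "real \<Rightarrow> 'a \<Rightarrow> real" and \<omega> i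
    using nonpos[OF that] by (simp add: half_line_path_def)
  have box_eq: "?P (half_line_path Z \<omega>) \<longleftrightarrow> (\<forall>i<n. Z (- t (Suc i)) \<omega> - Z (- t i) \<omega> \<in> A i)" for Z :: "real \<Rightarrow> 'a \<Rightarrow> real" and \<omega>
  proof -
    have "half_line_path Z \<omega> (- t (Suc i)) - half_line_path Z \<omega> (- t i) = Z (- t (Suc i)) \<omega> - Z (- t i) \<omega>" if "i < n" for i
      using hl[of "Suc i" Z \<omega>] hl[of i Z \<omega>] that by simp
    then show ?thesis by simp
  qed
  have "prob {\<omega> \<in> space M. \<forall>i<n. \<eta> (- t (Suc i)) \<omega> - \<eta> (- t i) \<omega> \<in> A i}
    = prob {\<omega> \<in> space M. \<forall>i<n. - \<xi> (- t (Suc i)) \<omega> - - \<xi> (- t i) \<omega> \<in> A i}"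
    by (rule copy_eq[unfolded box_eq])
  also have "\<dots> = prob {\<omega> \<in> space M. \<forall>i<n. \<xi> (- t i) \<omega> - \<xi> (- t (Suc i)) \<omega> \<in> A i}"
    by simp
  also have "\<dots> = prob {\<omega> \<in> space M. \<forall>k<n. \<xi> (- t (n - Suc k)) \<omega> - \<xi> (- t (n - k)) \<omega> \<in> A (n - Suc k)}"
  proof -
    have "(\<forall>i<n. Q i) \<longleftrightarrow> (\<forall>k<n. Q (n - Suc k))" for Q
    proof safe
      fix i assume "\<forall>k<n. Q (n - Suc k)" "i < n"
      moreover from this have "n - Suc i < n" by simp
      ultimately have "Q (n - Suc (n - Suc i))" by blast
      moreover have "n - Suc (n - Suc i) = i" using \<open>i < n\<close> by simp
      ultimately show "Q i" by (simp only:)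
    qed simp
    from this[of "\<lambda>i. \<xi> (- t i) \<omega> - \<xi> (- t (Suc i)) \<omega> \<in> A i" for \<omega>]
    have "(\<forall>i<n. \<xi> (- t i) \<omega> - \<xi> (- t (Suc i)) \<omega> \<in> A i) \<longleftrightarrow>
      (\<forall>k<n. \<xi> (- t (n - Suc k)) \<omega> - \<xi> (- t (n - k)) \<omega> \<in> A (n - Suc k))" for \<omega>
      by (simp add: Suc_diff_Suc)
    then show ?thesis by simp
  qed
  also have "\<dots> = (\<Prod>k<n. prob {\<omega> \<in> space M. \<xi> (- t (n - Suc k) - (- t (n - k))) \<omega> \<in> A (n - Suc k)})"
  proof (rule prob_xi_increments[where t = "\<lambda>k. - t (n - k)" and A = "\<lambda>k. A (n - Suc k)"])
    show "- t (n - i) \<le> - t (n - Suc i)" if "i < n" for i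
      using t(2)[of "n - Suc i"] that by (simp add: Suc_diff_Suc)
  qed (use t A in auto)
  also have "\<dots> = (\<Prod>k<n. prob {\<omega> \<in> space M. \<xi> (t (Suc (n - Suc k)) - t (n - Suc k)) \<omega> \<in> A (n - Suc k)})"
    by (intro prod.cong refl) (simp add: Suc_diff_Suc)
  also have "\<dots> = (\<Prod>i<n. prob {\<omega> \<in> space M. \<xi> (t (Suc i) - t i) \<omega> \<in> A i})"
    by (rule prod.nat_diff_reindex)
  finally show ?thesis .
qed

lemma eta_0: "AE \<omega> in M. \<eta> 0 \<omega> = 0"
proof -
  have meas: "{p \<in> space half_line_space. p 0 \<noteq> 0} \<in> sets half_line_space"
    by (rule measurable_sets_Collect[where P = "\<lambda>x. x \<noteq> 0", OF measurable_component_singleton]) auto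
  have "prob {\<omega> \<in> space M. \<eta> 0 \<omega> \<noteq> 0} = prob {\<omega> \<in> space M. \<xi> 0 \<omega> \<noteq> 0}"
    using prob_copy[OF meas] by (simp add: half_line_path_def)
  also have "\<dots> = 0"
    using xi_0 by (subst prob_eq_0) (auto elim!: eventually_mono)
  finally show ?thesis
    by (subst (asm) prob_eq_0) (auto elim!: eventually_mono AE_mp intro!: AE_I2)
qed

text \<open>A Levy process is continuous in probability, so it has almost surely no jump at a given
  time: on the negative half-line the left limits may be ignored there.\<close>

lemma X_neg:
  assumes t: "t < 0" shows "AE \<omega> in M. X \<omega> t = \<eta> (- t) \<omega>"
proof -
  \<comment> \<open>Bounded, so that dominated convergence applies, and zero only at zero.\<close>
  let ?g = "\<lambda>x::real. min 1 \<bar>x\<bar>"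
  let ?e = "\<lambda>n. (- t) / real (Suc n)"
  have e: "0 < ?e n" "?e n \<le> - t" for n
  proof -
    show "0 < ?e n" using t by (intro divide_pos_pos) auto
    have "(- t) / real (Suc n) \<le> (- t) / 1" using t by (intro divide_left_mono) auto
    then show "?e n \<le> - t" by simp
  qed
  have e0: "?e \<longlonglongrightarrow> 0" by (intro LIMSEQ_Suc[where f = "\<lambda>n. (- t) / real n"] lim_const_over_n)
  have "(\<lambda>n. \<integral>\<omega>. ?g (\<xi> (?e n) \<omega>) \<partial>M) \<longlonglongrightarrow> (\<integral>\<omega>. ?g 0 \<partial>M)"
  proof (rule integral_dominated_convergence[where w = "\<lambda>_. 1"])
    show "AE \<omega> in M. (\<lambda>n. ?g (\<xi> (?e n) \<omega>)) \<longlonglongrightarrow> ?g 0"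
      using xi_0 AE_space
    proof eventually_elim
      case (elim \<omega>)
      have "eventually (\<lambda>n. ?e n \<in> {0<..} \<and> ?e n \<noteq> 0) sequentially"
        using e(1) by (intro always_eventually allI) (metis greaterThan_iff less_irrefl)
      then have "filterlim ?e (at_right 0) sequentially" using e0 by (simp only: filterlim_at)
      moreover have "((\<lambda>s. \<xi> s \<omega>) \<longlongrightarrow> \<xi> 0 \<omega>) (at_right 0)"
        using xi_cadlag[OF elim(2)] by (simp add: cadlag_on_half_line_iff)
      ultimately have "(\<lambda>n. \<xi> (?e n) \<omega>) \<longlonglongrightarrow> \<xi> 0 \<omega>" by (rule filterlim_compose[rotated])
      then have "(\<lambda>n. \<xi> (?e n) \<omega>) \<longlonglongrightarrow> 0" using elim(1) by simp
      then show ?case by (intro tendsto_intros)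
    qed
    show "(\<lambda>\<omega>. ?g (\<xi> (?e n) \<omega>)) \<in> borel_measurable M" for n
      using xi_measurable[OF e(1)[THEN less_imp_le], of n] by measurable
  qed auto
  then have lim0: "(\<lambda>n. \<integral>\<omega>. ?g (\<xi> (?e n) \<omega>) \<partial>M) \<longlonglongrightarrow> 0" by simp
  have eqn: "(\<integral>\<omega>. ?g (\<eta> (- t - ?e n) \<omega> - \<eta> (- t) \<omega>) \<partial>M) = (\<integral>\<omega>. ?g (\<xi> (?e n) \<omega>) \<partial>M)" for n
  proof -
    have [measurable]: "\<eta> (- t - ?e n) \<in> borel_measurable M" "\<eta> (- t) \<in> borel_measurable M" "\<xi> (?e n) \<in> borel_measurable M"
      using e[of n] t by (auto intro!: eta_measurable xi_measurable)
    have meas_diff: "(\<lambda>\<omega>. \<eta> (- t - ?e n) \<omega> - \<eta> (- t) \<omega>) \<in> borel_measurable M" and meas_xi: "\<xi> (?e n) \<in> borel_measurable M"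
      by measurable
    have "distr M borel (\<lambda>\<omega>. \<eta> (- t - ?e n) \<omega> - \<eta> (- t) \<omega>) = distr M borel (\<xi> (?e n))"
    proof (rule measure_eqI)
      fix A assume "A \<in> sets (distr M borel (\<lambda>\<omega>. \<eta> (- t - ?e n) \<omega> - \<eta> (- t) \<omega>))"
      then have A: "A \<in> sets borel" by simp
      let ?s = "\<lambda>i::nat. if i = 0 then t else t + ?e n"
      have "prob {\<omega> \<in> space M. \<forall>i<1. \<eta> (- ?s (Suc i)) \<omega> - \<eta> (- ?s i) \<omega> \<in> A}
        = (\<Prod>i<1. prob {\<omega> \<in> space M. \<xi> (?s (Suc i) - ?s i) \<omega> \<in> A})"
        by (rule prob_eta_increments[where t = ?s and A = "\<lambda>_. A" and n = 1]) (use e[of n] A in auto)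
      then have "prob {\<omega> \<in> space M. \<eta> (- t - ?e n) \<omega> - \<eta> (- t) \<omega> \<in> A} = prob {\<omega> \<in> space M. \<xi> (?e n) \<omega> \<in> A}"
        by simp
      note eq = this
      have E: "emeasure (distr M borel Z) A = ennreal (prob {\<omega> \<in> space M. Z \<omega> \<in> A})"
        if "Z \<in> borel_measurable M" for Z :: "'a \<Rightarrow> real"
        using A that by (simp add: emeasure_distr emeasure_eq_measure vimage_def Int_def conj_commute)
      show "emeasure (distr M borel (\<lambda>\<omega>. \<eta> (- t - ?e n) \<omega> - \<eta> (- t) \<omega>)) A = emeasure (distr M borel (\<xi> (?e n))) A"
        unfolding E[OF meas_diff] E[OF meas_xi] by (simp only: eq)
    qed simp
    moreover have g: "?g \<in> borel_measurable borel" by measurable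
    ultimately show ?thesis
      unfolding integral_distr[OF meas_diff g, symmetric] integral_distr[OF meas_xi g, symmetric] by (simp only:)
  qed
  have [measurable]: "\<eta> (- t) \<in> borel_measurable M" "\<eta> (- t - ?e n) \<in> borel_measurable M" for n
    using e[of n] t by (auto intro!: eta_measurable)
  have "(\<lambda>n. \<integral>\<omega>. ?g (\<eta> (- t - ?e n) \<omega> - \<eta> (- t) \<omega>) \<partial>M) \<longlonglongrightarrow> (\<integral>\<omega>. ?g (X \<omega> t - \<eta> (- t) \<omega>) \<partial>M)"
  proof (rule integral_dominated_convergence[where w = "\<lambda>_. 1"])
    show "AE \<omega> in M. (\<lambda>n. ?g (\<eta> (- t - ?e n) \<omega> - \<eta> (- t) \<omega>)) \<longlonglongrightarrow> ?g (X \<omega> t - \<eta> (- t) \<omega>)"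
      using AE_space
    proof eventually_elim
      case (elim \<omega>)
      have "(\<lambda>n. - t - ?e n) \<longlonglongrightarrow> - t - 0" by (intro tendsto_intros e0)
      then have "filterlim (\<lambda>n. - t - ?e n) (at_left (- t)) sequentially"
        using e(1) by (auto simp: filterlim_at simp del: of_nat_Suc intro!: always_eventually)
      from filterlim_compose[OF Lim_at_left_tendsto[OF eta_cadlag[OF elim]] this]
      have "(\<lambda>n. \<eta> (- t - ?e n) \<omega>) \<longlonglongrightarrow> X \<omega> t" using t by (simp add: X_def xi_tilde_def)
      then show ?case by (intro tendsto_intros)
    qed
    show "(\<lambda>\<omega>. ?g (\<eta> (- t - ?e n) \<omega> - \<eta> (- t) \<omega>)) \<in> borel_measurable M" for n by measurable
  qed auto
  from LIMSEQ_unique[OF this[unfolded eqn] lim0]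
  have "(\<integral>\<omega>. ?g (X \<omega> t - \<eta> (- t) \<omega>) \<partial>M) = 0" .
  moreover have "integrable M (\<lambda>\<omega>. ?g (X \<omega> t - \<eta> (- t) \<omega>))"
    by (rule integrable_const_bound[where B = 1]) auto
  ultimately have "AE \<omega> in M. ?g (X \<omega> t - \<eta> (- t) \<omega>) = 0"
    by (subst (asm) integral_nonneg_eq_0_iff_AE) auto
  then show ?thesis by eventually_elim (auto simp: min_def split: if_splits)
qed

lemma X_nonpos: "t \<le> 0 \<Longrightarrow> AE \<omega> in M. X \<omega> t = \<eta> (- t) \<omega>"
proof (cases "t = 0")
  case True
  show ?thesis using xi_0 eta_0 by eventually_elim (simp add: X_nonneg True)
qed (use X_neg in auto)

lemma X_0: "AE \<omega> in M. X \<omega> 0 = 0"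
  using xi_0 by eventually_elim (simp add: X_nonneg)

text \<open>Since the grid contains \<open>0\<close>, no increment involves both halves of the process.\<close>

lemma prob_X_increments:
  assumes j: "j \<le> n" "t j = 0" and t: "\<And>i. i < n \<Longrightarrow> t i \<le> t (Suc i)" and A: "\<And>i. A i \<in> sets borel"
  shows "prob {\<omega> \<in> space M. \<forall>i<n. X \<omega> (t (Suc i)) - X \<omega> (t i) \<in> A i}
    = (\<Prod>i<n. prob {\<omega> \<in> space M. \<xi> (t (Suc i) - t i) \<omega> \<in> A i})"
proof -
  obtain m where n: "n = j + m" using j le_Suc_ex by blast
  have mono: "t i \<le> t k" if "i \<le> k" "k \<le> n" for i k
    using that
  proof (induction rule: dec_induct)
    case (step k)
    then show ?case using t[of k] by simp
  qed simp
  have neg: "t i \<le> 0" if "i \<le> j" for i using mono[of i j] that j by simp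
  have pos: "0 \<le> t (j + i)" if "i \<le> m" for i using mono[of j "j + i"] that j n by simp
  let ?E1 = "{\<omega> \<in> space M. \<forall>i<j. \<eta> (- t (Suc i)) \<omega> - \<eta> (- t i) \<omega> \<in> A i}"
  let ?E2 = "{\<omega> \<in> space M. \<forall>i<m. \<xi> (t (j + Suc i)) \<omega> - \<xi> (t (j + i)) \<omega> \<in> A (j + i)}"
  have E1: "?E1 \<in> sets Feta"
  proof -
    have "{\<omega> \<in> space Feta. \<forall>i<j. \<eta> (- t (Suc i)) \<omega> - \<eta> (- t i) \<omega> \<in> A i} \<in> sets Feta"
    proof (rule finite_box_sets[OF _ A])
      fix i assume "i < j"
      then have "0 \<le> - t (Suc i)" "0 \<le> - t i" using neg[of i] neg[of "Suc i"] by simp_all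
      then show "(\<lambda>\<omega>. \<eta> (- t (Suc i)) \<omega> - \<eta> (- t i) \<omega>) \<in> borel_measurable Feta"
        by (intro borel_measurable_diff eta_measurable_Feta)
    qed
    then show ?thesis by (simp only: space_F)
  qed
  have E2: "?E2 \<in> sets Fxi"
  proof -
    have "{\<omega> \<in> space Fxi. \<forall>i<m. \<xi> (t (j + Suc i)) \<omega> - \<xi> (t (j + i)) \<omega> \<in> A (j + i)} \<in> sets Fxi"
    proof (rule finite_box_sets[OF _ A])
      fix i assume "i < m"
      then have "0 \<le> t (j + Suc i)" "0 \<le> t (j + i)" using pos[of i] pos[of "Suc i"] by simp_all
      then show "(\<lambda>\<omega>. \<xi> (t (j + Suc i)) \<omega> - \<xi> (t (j + i)) \<omega>) \<in> borel_measurable Fxi"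
        by (intro borel_measurable_diff xi_measurable_Fxi)
    qed
    then show ?thesis by (simp only: space_F)
  qed
  have split_all: "(\<forall>i<j + m. P i) \<longleftrightarrow> (\<forall>i<j. P i) \<and> (\<forall>i<m. P (j + i))" for P :: "nat \<Rightarrow> bool"
    by (induction m) (auto simp: less_Suc_eq)
  have split_prod: "(\<Prod>i<j + m. g i) = (\<Prod>i<j. g i) * (\<Prod>i<m. g (j + i))" for g :: "nat \<Rightarrow> real"
    by (induction m) (simp_all add: mult.assoc)
  have "AE \<omega> in M. \<forall>i\<in>{..j}. X \<omega> (t i) = \<eta> (- t i) \<omega>"
    by (rule AE_finite_allI) (use neg X_nonpos in auto)
  then have ae: "AE \<omega> in M. \<omega> \<in> {\<omega> \<in> space M. \<forall>i<n. X \<omega> (t (Suc i)) - X \<omega> (t i) \<in> A i} \<longleftrightarrow> \<omega> \<in> ?E1 \<inter> ?E2"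
  proof eventually_elim
    case (elim \<omega>)
    have "X \<omega> (t (Suc i)) - X \<omega> (t i) = \<eta> (- t (Suc i)) \<omega> - \<eta> (- t i) \<omega>" if "i < j" for i
      using elim that by simp
    moreover have "X \<omega> (t (Suc (j + i))) - X \<omega> (t (j + i)) = \<xi> (t (j + Suc i)) \<omega> - \<xi> (t (j + i)) \<omega>" if "i < m" for i
      using pos[of "Suc i"] pos[of i] that by (simp add: X_nonneg)
    ultimately have "(\<forall>i<j + m. X \<omega> (t (Suc i)) - X \<omega> (t i) \<in> A i) \<longleftrightarrow>
        (\<forall>i<j. \<eta> (- t (Suc i)) \<omega> - \<eta> (- t i) \<omega> \<in> A i) \<and>
        (\<forall>i<m. \<xi> (t (j + Suc i)) \<omega> - \<xi> (t (j + i)) \<omega> \<in> A (j + i))"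
      unfolding split_all by simp
    then show ?case unfolding n by blast
  qed
  have tj: "t j \<le> 0" using j by simp
  have t1: "t i \<le> t (Suc i)" if "i < j" for i using t[of i] that n by simp
  have t2: "t (j + i) \<le> t (j + Suc i)" if "i < m" for i using t[of "j + i"] that n by simp
  have "prob {\<omega> \<in> space M. \<forall>i<n. X \<omega> (t (Suc i)) - X \<omega> (t i) \<in> A i} = prob (?E1 \<inter> ?E2)"
  proof (rule measure_eq_AE[OF ae])
    show "{\<omega> \<in> space M. \<forall>i<n. X \<omega> (t (Suc i)) - X \<omega> (t i) \<in> A i} \<in> sets M"
      by (rule finite_box_sets[OF _ A]) measurable
    show "?E1 \<inter> ?E2 \<in> sets M"
      by (rule sets.Int) (rule subsetD[OF sets_F_subset(2) E1], rule subsetD[OF sets_F_subset(1) E2])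
  qed
  also have "\<dots> = prob ?E1 * prob ?E2" by (rule prob_Int_F[OF E1 E2])
  also have "prob ?E1 = (\<Prod>i<j. prob {\<omega> \<in> space M. \<xi> (t (Suc i) - t i) \<omega> \<in> A i})"
    by (rule prob_eta_increments[OF tj t1 A])
  also have "prob ?E2 = (\<Prod>i<m. prob {\<omega> \<in> space M. \<xi> (t (j + Suc i) - t (j + i)) \<omega> \<in> A (j + i)})"
    by (rule prob_xi_increments[where t = "\<lambda>i. t (j + i)" and A = "\<lambda>i. A (j + i)", OF pos[OF le0] t2 A])
  finally show ?thesis unfolding n split_prod by simp
qed

text \<open>The law of the values at finitely many times is determined by the law of the increments
  along any grid that contains these times and \<open>0\<close>. If the grid contains \<open>- h\<close> as well, then
  its translate by \<open>h\<close> contains \<open>0\<close>, and both grids have the same spacings.\<close>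

lemma prob_box_rebase:
  assumes J: "finite J" and A: "\<And>t. A t \<in> sets borel"
  shows "prob {\<omega> \<in> space M. \<forall>s\<in>J. rebase h (X \<omega>) s \<in> A s} = prob {\<omega> \<in> space M. \<forall>s\<in>J. X \<omega> s \<in> A s}"
proof -
  let ?S = "J \<union> {0, - h}"
  define L where "L = sorted_list_of_set ?S"
  define n where "n = length L - 1"
  define t where "t = (\<lambda>i. L ! i)"
  have fin: "finite ?S" using J by simp
  have L: "sorted L" "set L = ?S"
    unfolding L_def by (rule sorted_sorted_list_of_set, rule set_sorted_list_of_set[OF fin])
  then have len: "length L = Suc n" unfolding n_def by (cases L) auto
  have t: "t i \<le> t (Suc i)" if "i < n" for i
    using sorted_nth_mono[OF L(1), of i "Suc i"] that len by (simp add: t_def)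
  have index: "\<exists>k\<le>n. t k = s" if "s \<in> ?S" for s
    using that L(2) len unfolding t_def by (metis in_set_conv_nth less_Suc_eq_le)
  obtain j where j: "j \<le> n" "t j = 0" using index[of 0] by auto
  obtain k where k: "k \<le> n" "t k = - h" using index[of "- h"] by auto
  let ?N = "PiM {..<n} (\<lambda>_. borel) :: (nat \<Rightarrow> real) measure"
  let ?D = "\<lambda>Y \<omega>. \<lambda>i\<in>{..<n}. Y \<omega> (t (Suc i)) - Y \<omega> (t i) :: real"
  define Y where "Y = (\<lambda>\<omega>. rebase h (X \<omega>))"
  have Y_meas[measurable]: "(\<lambda>\<omega>. Y \<omega> s) \<in> borel_measurable M" for s unfolding Y_def rebase_def by measurable
  have D_meas: "?D Z \<in> M \<rightarrow>\<^sub>M ?N" if "\<And>s. (\<lambda>\<omega>. Z \<omega> s) \<in> borel_measurable M" for Z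
    by (rule measurable_restrict) (rule borel_measurable_diff[OF that that])
  have law_box: "emeasure (distr M ?N (?D Z)) (Pi\<^sub>E {..<n} B)
    = ennreal (prob {\<omega> \<in> space M. \<forall>i<n. Z \<omega> (t (Suc i)) - Z \<omega> (t i) \<in> B i})"
    if Z: "\<And>s. (\<lambda>\<omega>. Z \<omega> s) \<in> borel_measurable M" and B: "\<And>i. i \<in> {..<n} \<Longrightarrow> B i \<in> sets borel" for Z B
  proof -
    have "?D Z -` (Pi\<^sub>E {..<n} B) \<inter> space M = {\<omega> \<in> space M. \<forall>i<n. Z \<omega> (t (Suc i)) - Z \<omega> (t i) \<in> B i}"
    proof -
      have "?D Z \<omega> \<in> Pi\<^sub>E {..<n} B \<longleftrightarrow> (\<forall>i<n. Z \<omega> (t (Suc i)) - Z \<omega> (t i) \<in> B i)" for \<omega>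
        unfolding PiE_iff by (simp add: Ball_def)
      then show ?thesis by (simp only: vimage_def Int_def mem_Collect_eq conj_commute)
    qed
    moreover have "Pi\<^sub>E {..<n} B \<in> sets ?N" using B by (intro sets_PiM_I_finite) auto
    ultimately show ?thesis
      using emeasure_distr[OF D_meas[of Z, OF Z], of "Pi\<^sub>E {..<n} B"] by (simp only: emeasure_eq_measure)
  qed
  have law: "distr M ?N (?D X) = distr M ?N (?D Y)"
  proof (rule measure_eqI_PiM_finite)
    fix B :: "nat \<Rightarrow> real set" assume B: "\<And>i. i \<in> {..<n} \<Longrightarrow> B i \<in> sets borel"
    define B' where "B' = (\<lambda>i. if i < n then B i else UNIV)"
    have B': "B' i \<in> sets borel" for i using B by (simp add: B'_def)
    have PiB: "Pi\<^sub>E {..<n} B = Pi\<^sub>E {..<n} B'" by (rule PiE_cong) (simp add: B'_def)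
    have "prob {\<omega> \<in> space M. \<forall>i<n. X \<omega> (t (Suc i)) - X \<omega> (t i) \<in> B' i}
      = (\<Prod>i<n. prob {\<omega> \<in> space M. \<xi> (t (Suc i) - t i) \<omega> \<in> B' i})"
      by (rule prob_X_increments[OF j t B'])
    moreover have "prob {\<omega> \<in> space M. \<forall>i<n. X \<omega> (h + t (Suc i)) - X \<omega> (h + t i) \<in> B' i}
      = (\<Prod>i<n. prob {\<omega> \<in> space M. \<xi> (h + t (Suc i) - (h + t i)) \<omega> \<in> B' i})"
      by (rule prob_X_increments[where t = "\<lambda>i. h + t i" and j = k]) (use k t B' in auto)
    ultimately have "prob {\<omega> \<in> space M. \<forall>i<n. X \<omega> (t (Suc i)) - X \<omega> (t i) \<in> B' i}
      = prob {\<omega> \<in> space M. \<forall>i<n. Y \<omega> (t (Suc i)) - Y \<omega> (t i) \<in> B' i}"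
      by (simp add: Y_def rebase_def)
    then show "emeasure (distr M ?N (?D X)) (Pi\<^sub>E {..<n} B) = emeasure (distr M ?N (?D Y)) (Pi\<^sub>E {..<n} B)"
      unfolding PiB using law_box[of X B'] law_box[of Y B'] B' by simp
  next
    interpret D: prob_space "distr M ?N (?D X)" by (rule prob_space_distr[OF D_meas]) simp
    show "range (\<lambda>_::nat. space ?N) \<subseteq> prod_algebra {..<n} (\<lambda>_. borel)"
      by (auto simp: space_PiM intro!: space_in_prod_algebra[of "{..<n}" "\<lambda>_. borel", simplified])
    show "emeasure (distr M ?N (?D X)) (space ?N) \<noteq> \<infinity>" using D.emeasure_finite by simp
  qed auto
  define B where "B = (\<lambda>i. if t i \<in> J then A (t i) else UNIV)"
  have B: "B i \<in> sets borel" for i using A by (simp add: B_def)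
  have box: "(\<forall>i\<le>n. y (t i) \<in> B i) \<longleftrightarrow> (\<forall>s\<in>J. y s \<in> A s)" for y
  proof
    assume *: "\<forall>i\<le>n. y (t i) \<in> B i"
    show "\<forall>s\<in>J. y s \<in> A s"
    proof
      fix s assume s: "s \<in> J"
      then obtain i where "i \<le> n" "t i = s" using index by blast
      then show "y s \<in> A s" using * s by (auto simp: B_def)
    qed
  qed (simp add: B_def)
  let ?G = "{d \<in> space ?N. \<forall>i<Suc n. partial_sums_from j d i \<in> B i}"
  have G: "?G \<in> sets ?N"
  proof (rule finite_box_sets)
    fix i assume "i < Suc n"
    show "(\<lambda>d. partial_sums_from j d i) \<in> borel_measurable ?N"
      unfolding partial_sums_from_def using \<open>i < Suc n\<close> j(1)
      by (cases "j \<le> i") (auto intro!: borel_measurable_sum borel_measurable_uminus measurable_component_singleton)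
  qed (rule B)
  have prob_G: "prob {\<omega> \<in> space M. \<forall>s\<in>J. Z \<omega> s \<in> A s} = measure (distr M ?N (?D Z)) ?G"
    if Z: "\<And>s. (\<lambda>\<omega>. Z \<omega> s) \<in> borel_measurable M" and Z0: "AE \<omega> in M. Z \<omega> 0 = 0" for Z
  proof -
    have ps: "partial_sums_from j (?D Z \<omega>) i = Z \<omega> (t i)" if "Z \<omega> 0 = 0" "i \<le> n" for \<omega> i
      using partial_sums_from_restrict[OF j(1) that(2), of "\<lambda>i. Z \<omega> (t (Suc i)) - Z \<omega> (t i)"]
        partial_sums_from_differences[of j "\<lambda>i. Z \<omega> (t i)" i] j that(1) by simp
    have "measure (distr M ?N (?D Z)) ?G = prob (?D Z -` ?G \<inter> space M)"
      by (rule measure_distr[OF D_meas[of Z, OF Z] G])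
    also have "\<dots> = prob {\<omega> \<in> space M. \<forall>s\<in>J. Z \<omega> s \<in> A s}"
    proof (rule measure_eq_AE)
      show "AE \<omega> in M. \<omega> \<in> ?D Z -` ?G \<inter> space M \<longleftrightarrow> \<omega> \<in> {\<omega> \<in> space M. \<forall>s\<in>J. Z \<omega> s \<in> A s}"
        using Z0
      proof eventually_elim
        case (elim \<omega>)
        have "?D Z \<omega> \<in> space ?N" by (simp add: space_PiM)
        then show ?case using ps[OF elim] box[of "Z \<omega>"] by (auto simp: less_Suc_eq_le)
      qed
      show "?D Z -` ?G \<inter> space M \<in> sets M" by (rule measurable_sets[OF D_meas[of Z, OF Z] G])
      have "{\<omega> \<in> space M. \<forall>i<Suc n. Z \<omega> (t i) \<in> B i} \<in> sets M" by (rule finite_box_sets[where f = "\<lambda>i \<omega>. Z \<omega> (t i)", OF Z B])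
      then show "{\<omega> \<in> space M. \<forall>s\<in>J. Z \<omega> s \<in> A s} \<in> sets M"
        using box by (simp add: less_Suc_eq_le)
    qed
    finally show ?thesis by simp
  qed
  have "AE \<omega> in M. Y \<omega> 0 = 0" by (simp add: Y_def rebase_def)
  then show ?thesis
    using prob_G[of X, OF X_component X_0] prob_G[of Y, OF Y_meas] law by (simp add: Y_def)
qed

section \<open>Ergodicity of the flow of increments\<close>

definition W :: "(real \<Rightarrow> real) measure" where "W = distr M path_space X"

lemma sets_W[measurable_cong]: "sets W = sets path_space" by (simp add: W_def)
lemma space_W: "space W = space path_space" by (simp add: W_def)

lemma prob_space_W: "prob_space W"
  unfolding W_def by (rule prob_space_distr[OF X_measurable])

lemma measure_W: "B \<in> sets path_space \<Longrightarrow> measure W B = prob {\<omega> \<in> space M. X \<omega> \<in> B}"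
  unfolding W_def by (subst measure_distr[OF X_measurable]) (simp_all add: vimage_def Int_def conj_commute)

lemma AE_W: "Measurable.pred path_space P \<Longrightarrow> (AE w in W. P w) \<longleftrightarrow> (AE \<omega> in M. P (X \<omega>))"
  unfolding W_def by (rule AE_distr_iff[OF X_measurable]) (simp add: pred_def)

lemma distr_rebase: "distr W W (rebase h) = W"
proof -
  have cong: "distr W W (rebase h) = distr W path_space (rebase h)" by (rule distr_cong) (simp_all add: sets_W)
  have meas: "rebase h \<in> W \<rightarrow>\<^sub>M path_space" by measurable
  interpret W: prob_space W by (rule prob_space_W)
  interpret D: prob_space "distr W path_space (rebase h)" by (rule W.prob_space_distr[OF meas])
  have "distr W path_space (rebase h) = W"
  proof (rule path_measure_eqI)
    fix J :: "real set" and A :: "real \<Rightarrow> real set" assume J: "finite J" and A: "\<And>t. A t \<in> sets borel"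
    have B: "path_box J A \<in> sets path_space" by (rule path_box_sets[OF J A])
    have X_space: "X \<omega> \<in> space path_space" if "\<omega> \<in> space M" for \<omega> using measurable_space[OF X_measurable that] .
    have r_space: "rebase h (X \<omega>) \<in> space path_space" if "\<omega> \<in> space M" for \<omega>
      using measurable_space[OF rebase_measurable X_space[OF that]] .
    have B': "rebase h -` path_box J A \<inter> space path_space \<in> sets path_space"
      by (rule measurable_sets[OF rebase_measurable B])
    have "measure (distr W path_space (rebase h)) (path_box J A) = measure W (rebase h -` path_box J A \<inter> space W)"
      by (rule measure_distr[OF meas B])
    also have "\<dots> = prob {\<omega> \<in> space M. X \<omega> \<in> rebase h -` path_box J A \<inter> space path_space}"
      unfolding space_W by (rule measure_W[OF B'])
    also have "{\<omega> \<in> space M. X \<omega> \<in> rebase h -` path_box J A \<inter> space path_space}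
        = {\<omega> \<in> space M. \<forall>s\<in>J. rebase h (X \<omega>) s \<in> A s}"
      using X_space r_space by (auto simp: path_box_def)
    also have "prob \<dots> = prob {\<omega> \<in> space M. \<forall>s\<in>J. X \<omega> s \<in> A s}" by (rule prob_box_rebase[OF J A])
    also have "{\<omega> \<in> space M. \<forall>s\<in>J. X \<omega> s \<in> A s} = {\<omega> \<in> space M. X \<omega> \<in> path_box J A}"
      using X_space by (auto simp: path_box_def)
    also have "prob \<dots> = measure W (path_box J A)" by (rule measure_W[OF B, symmetric])
    finally show "emeasure (distr W path_space (rebase h)) (path_box J A) = emeasure W (path_box J A)"
      by (simp add: W.emeasure_eq_measure D.emeasure_eq_measure)
  qed (simp_all add: sets_W D.finite_measure_axioms)
  then show ?thesis by (simp add: cong)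
qed

lemma measure_preserving_rebase: "measure_preserving_map W (rebase h)"
proof -
  interpret W: prob_space W by (rule prob_space_W)
  show ?thesis by unfold_locales (simp_all add: distr_rebase)
qed

lemma funpow_rebase: "(rebase 1 ^^ Suc n) w = rebase (real (Suc n)) w"
  by (induction n) (simp_all add: rebase_rebase add.commute)

text \<open>The flow is mixing: for two events that depend on finitely many times, one of them is eventually
  determined by the path before, the other by the increments after a fixed time, and these are independent.\<close>

lemma ergodic_rebase: "ergodic_map W (rebase 1)"
proof -
  interpret W: prob_space W by (rule prob_space_W)
  interpret mp: measure_preserving_map W "rebase 1" by (rule measure_preserving_rebase)
  show ?thesis
  proof (rule mp.ergodic_map_of_mixing[where G = path_boxes])
    show "Int_stable path_boxes" by (rule Int_stable_path_boxes)
    show "path_boxes \<subseteq> Pow (space W)" unfolding space_W by (rule path_boxes_Pow)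
    show "sets W = sigma_sets (space W) path_boxes" unfolding space_W sets_W by (rule sets_path_space_boxes)
    fix C D assume "C \<in> path_boxes" "D \<in> path_boxes"
    then obtain J A K B where C: "C = path_box J A" "finite J" "\<And>t. A t \<in> sets borel"
      and D: "D = path_box K B" "finite K" "\<And>t. B t \<in> sets borel"
      unfolding path_boxes_def by blast
    have Cs: "C \<in> sets path_space" and Ds: "D \<in> sets path_space" using C D path_box_sets by auto
    have "\<exists>m::nat. \<forall>s\<in>J \<union> K. \<bar>s\<bar> \<le> real m"
    proof -
      have fin: "finite (abs ` (J \<union> K))" using C(2) D(2) by simp
      obtain m :: nat where "Max (insert 0 (abs ` (J \<union> K))) \<le> real m" using real_arch_simple by blast
      then show ?thesis using fin by (intro exI[of _ m]) auto
    qed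
    then obtain m :: nat where m: "\<And>s. s \<in> J \<union> K \<Longrightarrow> \<bar>s\<bar> \<le> real m" by blast
    \<comment> \<open>The two events, seen from the time \<open>m\<close> that separates them.\<close>
    let ?C' = "{w \<in> space path_space. \<forall>s\<in>J. w (s - m) - w (- m) \<in> A s}"
    have "W.prob (C \<inter> ((rebase 1 ^^ n) -` D \<inter> space W)) = W.prob C * W.prob D" if n: "2 * m + 1 \<le> n" for n
    proof -
      obtain n' where n': "n = Suc n'" using n by (cases n) auto
      have iter: "(rebase 1 ^^ n) w = rebase (real n) w" for w unfolding n' by (rule funpow_rebase)
      let ?D' = "{w \<in> space path_space. \<forall>s\<in>K. w (n - m + s) - w (n - m) \<in> B s}"
      have set_meas: "{\<omega> \<in> space N. \<forall>s\<in>J. f s \<omega> \<in> A s} \<in> sets N"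
        if "finite J" "\<And>s. A s \<in> sets borel" "\<And>s. s \<in> J \<Longrightarrow> f s \<in> borel_measurable N"
        for J A and f :: "real \<Rightarrow> 'c \<Rightarrow> real" and N :: "'c measure"
      proof (rule sets.sets_Collect_finite_All)
        show "{\<omega> \<in> space N. f s \<omega> \<in> A s} \<in> sets N" if "s \<in> J" for s
          using measurable_sets[OF \<open>s \<in> J \<Longrightarrow> f s \<in> borel_measurable N\<close>[OF that] \<open>\<And>s. A s \<in> sets borel\<close>[of s]]
          by (simp add: vimage_def Int_def conj_commute)
      qed fact
      have C's: "?C' \<in> sets path_space"
        by (rule set_meas) (use C in \<open>auto intro!: borel_measurable_diff eval_measurable\<close>)
      have D's: "?D' \<in> sets path_space"
        by (rule set_meas) (use D in \<open>auto intro!: borel_measurable_diff eval_measurable\<close>)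
      let ?EC = "{\<omega> \<in> space M. \<forall>s\<in>J. Xpast \<omega> (s - m) - Xpast \<omega> (- m) \<in> A s}"
      let ?ED = "{\<omega> \<in> space M. \<forall>s\<in>K. \<xi> (n - m + s) \<omega> - \<xi> (n - m) \<omega> \<in> B s}"
      have Xp: "(\<lambda>\<omega>. Xpast \<omega> s) \<in> borel_measurable Feta" for s
        using Xpast_measurable by (simp add: measurable_path_space_iff)
      have "{\<omega> \<in> space Feta. \<forall>s\<in>J. Xpast \<omega> (s - m) - Xpast \<omega> (- m) \<in> A s} \<in> sets Feta"
        by (rule set_meas) (use C in \<open>auto intro!: borel_measurable_diff Xp\<close>)
      then have EC: "?EC \<in> sets Feta" by simp
      have nm: "0 \<le> real n - real m" "\<And>s. s \<in> K \<Longrightarrow> 0 \<le> real n - real m + s"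
        using n m by (force simp: abs_le_iff)+
      have "{\<omega> \<in> space Fxi. \<forall>s\<in>K. \<xi> (n - m + s) \<omega> - \<xi> (n - m) \<omega> \<in> B s} \<in> sets Fxi"
        by (rule set_meas) (use D nm in \<open>auto intro!: borel_measurable_diff xi_measurable_Fxi\<close>)
      then have ED: "?ED \<in> sets Fxi" by simp
      have X_space: "X \<omega> \<in> space path_space" if "\<omega> \<in> space M" for \<omega> using measurable_space[OF X_measurable that] .
      have aeC: "AE \<omega> in M. X \<omega> \<in> ?C' \<longleftrightarrow> \<omega> \<in> ?EC"
        using xi_0 AE_space
      proof eventually_elim
        case (elim \<omega>)
        have "X \<omega> (s - m) = Xpast \<omega> (s - m)" if "s \<in> J" for s
          using X_eq_Xpast[OF elim(1)] m[of s] that by (simp add: abs_le_iff)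
        moreover have "X \<omega> (- m) = Xpast \<omega> (- m)" by (rule X_eq_Xpast[OF elim(1)]) simp
        ultimately show ?case using X_space[OF elim(2)] elim(2) by simp
      qed
      have eqD: "X \<omega> \<in> ?D' \<longleftrightarrow> \<omega> \<in> ?ED" if "\<omega> \<in> space M" for \<omega>
        using X_space[OF that] nm that by (simp add: X_nonneg)
      have P1: "W.prob (?C' \<inter> ?D') = W.prob ?C' * W.prob ?D'"
      proof -
        have ECM: "?EC \<in> sets M" by (rule subsetD[OF sets_F_subset(2) EC])
        have EDM: "?ED \<in> sets M" by (rule subsetD[OF sets_F_subset(1) ED])
        have 1: "W.prob (?C' \<inter> ?D') = prob (?EC \<inter> ?ED)"
          unfolding measure_W[OF sets.Int[OF C's D's]]
        proof (rule measure_eq_AE)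
          show "AE \<omega> in M. \<omega> \<in> {\<omega> \<in> space M. X \<omega> \<in> ?C' \<inter> ?D'} \<longleftrightarrow> \<omega> \<in> ?EC \<inter> ?ED"
            using aeC AE_space by eventually_elim (use eqD in blast)
          show "{\<omega> \<in> space M. X \<omega> \<in> ?C' \<inter> ?D'} \<in> sets M"
            using measurable_sets[OF X_measurable sets.Int[OF C's D's]] by (simp add: vimage_def Int_def conj_commute)
          show "?EC \<inter> ?ED \<in> sets M" by (rule sets.Int[OF ECM EDM])
        qed
        have 2: "W.prob ?C' = prob ?EC"
          unfolding measure_W[OF C's]
        proof (rule measure_eq_AE)
          show "AE \<omega> in M. \<omega> \<in> {\<omega> \<in> space M. X \<omega> \<in> ?C'} \<longleftrightarrow> \<omega> \<in> ?EC"
            using aeC AE_space by eventually_elim blast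
          show "{\<omega> \<in> space M. X \<omega> \<in> ?C'} \<in> sets M"
            using measurable_sets[OF X_measurable C's] by (simp add: vimage_def Int_def conj_commute)
        qed (rule ECM)
        have "{\<omega> \<in> space M. X \<omega> \<in> ?D'} = ?ED" using eqD by blast
        then have 3: "W.prob ?D' = prob ?ED" unfolding measure_W[OF D's] by simp
        show ?thesis unfolding 1 2 3 by (rule prob_Int_F[OF EC ED])
      qed
      have shiftm: "W.prob (rebase (real m) -` E \<inter> space W) = W.prob E" if "E \<in> sets path_space" for E
      proof -
        interpret mpm: measure_preserving_map W "rebase (real m)" by (rule measure_preserving_rebase)
        show ?thesis using mpm.prob_funpow_vimage[of E 1] that by (simp add: sets_W)
      qed
      have r_space: "rebase h w \<in> space path_space" if "w \<in> space path_space" for h w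
        using measurable_space[OF rebase_measurable that] .
      have inC: "rebase (real m) w \<in> ?C' \<longleftrightarrow> w \<in> C" if "w \<in> space path_space" "w 0 = 0" for w
        using that r_space[OF that(1)] unfolding C(1) path_box_def by (simp add: rebase_def)
      have "real m + real (n - m) = real n" using n by simp
      then have nm_add: "real m + (real (n - m) + s) = real n + s" "real m + real (n - m) = real n" for s by simp_all
      have inD: "rebase (real m) w \<in> ?D' \<longleftrightarrow> (rebase 1 ^^ n) w \<in> D" if "w \<in> space path_space" for w
        using that r_space[OF that] unfolding iter D(1) path_box_def by (simp add: rebase_def nm_add del: of_nat_diff)
      have "Measurable.pred path_space (\<lambda>w. w 0 = 0)" using eval_measurable[of 0] by measurable
      then have W0: "AE w in W. w 0 = 0" using X_0 by (simp add: AE_W)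
      have PC: "W.prob C = W.prob ?C'"
      proof -
        have "W.prob C = W.prob (rebase (real m) -` ?C' \<inter> space W)"
        proof (rule measure_eq_AE)
          show "AE w in W. w \<in> C \<longleftrightarrow> w \<in> rebase (real m) -` ?C' \<inter> space W"
            using W0 AE_space by eventually_elim (use inC in \<open>auto simp: space_W\<close>)
          show "C \<in> sets W" using Cs by (simp add: sets_W)
          show "rebase (real m) -` ?C' \<inter> space W \<in> sets W"
            using measurable_sets[OF rebase_measurable C's] by (simp only: sets_W space_W)
        qed
        then show ?thesis using shiftm[OF C's] by simp
      qed
      have PD: "W.prob D = W.prob ?D'"
      proof -
        have "W.prob D = W.prob ((rebase 1 ^^ n) -` D \<inter> space W)" using mp.prob_funpow_vimage Ds by (simp add: sets_W)
        also have "(rebase 1 ^^ n) -` D \<inter> space W = rebase (real m) -` ?D' \<inter> space W"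
          using inD by (auto simp: space_W)
        finally show ?thesis using shiftm[OF D's] by simp
      qed
      have PCD: "W.prob (C \<inter> ((rebase 1 ^^ n) -` D \<inter> space W)) = W.prob (?C' \<inter> ?D')"
      proof -
        have "W.prob (C \<inter> ((rebase 1 ^^ n) -` D \<inter> space W)) = W.prob (rebase (real m) -` (?C' \<inter> ?D') \<inter> space W)"
        proof (rule measure_eq_AE)
          show "AE w in W. w \<in> C \<inter> ((rebase 1 ^^ n) -` D \<inter> space W) \<longleftrightarrow> w \<in> rebase (real m) -` (?C' \<inter> ?D') \<inter> space W"
            using W0 AE_space
          proof eventually_elim
            case (elim w)
            then have "w \<in> space path_space" by (simp add: space_W)
            then show ?case using inC[of w] inD[of w] elim by blast
          qed
          show "C \<inter> ((rebase 1 ^^ n) -` D \<inter> space W) \<in> sets W"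
            using Cs Ds measurable_sets[OF mp.funpow_measurable, of D n] by (simp add: sets_W)
          show "rebase (real m) -` (?C' \<inter> ?D') \<inter> space W \<in> sets W"
            using measurable_sets[OF rebase_measurable sets.Int[OF C's D's]] by (simp only: sets_W space_W)
        qed
        then show ?thesis using shiftm[OF sets.Int[OF C's D's]] by simp
      qed
      show ?thesis unfolding PCD PC PD by (rule P1)
    qed
    then have "eventually (\<lambda>n. W.prob (C \<inter> ((rebase 1 ^^ n) -` D \<inter> space W)) = W.prob C * W.prob D) sequentially"
      by (auto simp: eventually_sequentially)
    then show "(\<lambda>n. W.prob (C \<inter> ((rebase 1 ^^ n) -` D \<inter> space W))) \<longlonglongrightarrow> W.prob C * W.prob D"
      by (rule tendsto_eventually)
  qed
qed

section \<open>Summability of the past\<close>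

text \<open>The event that \<open>\<eta>\<close> is eventually nonpositive at rational times has the probability of the same
  event for \<open>- \<xi>\<close>, and right-continuity extends it to all times.\<close>

lemma eta_eventually_nonpos: "AE \<omega> in M. \<exists>m::nat. \<forall>s\<ge>real m. \<eta> s \<omega> \<le> 0"
proof -
  let ?r = "\<lambda>a b. real a / real (Suc b)"
  define P where "P p \<longleftrightarrow> (\<exists>m::nat. \<forall>a b. real m \<le> ?r a b \<longrightarrow> p (?r a b) \<le> 0)" for p :: "real \<Rightarrow> real"
  have [measurable]: "(\<lambda>p. p (?r a b)) \<in> borel_measurable half_line_space" for a b
    by (rule measurable_component_singleton) simp
  have set_meas: "{p \<in> space half_line_space. P p} \<in> sets half_line_space" unfolding P_def by measurable
  have "AE \<omega> in M. P (half_line_path (\<lambda>t \<omega>. - \<xi> t \<omega>) \<omega>)"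
    using drift unfolding drifts_to_infinity_def
  proof eventually_elim
    case (elim \<omega>)
    then obtain b where b: "\<And>s. b \<le> s \<Longrightarrow> 0 \<le> \<xi> s \<omega>"
      by (auto simp: filterlim_at_top eventually_at_top_linorder)
    obtain m :: nat where "b \<le> real m" using real_arch_simple by blast
    then show ?case unfolding P_def using b by (intro exI[of _ m]) (auto simp: half_line_path_def)
  qed
  moreover have "{\<omega> \<in> space M. P (half_line_path Z \<omega>)} \<in> sets M"
    if "\<And>t. 0 \<le> t \<Longrightarrow> Z t \<in> borel_measurable M" for Z
  proof -
    have "half_line_path Z -` {p \<in> space half_line_space. P p} \<inter> space M \<in> sets M"
      by (rule measurable_sets[OF half_line_path_measurable[OF that] set_meas])
    moreover have "half_line_path Z -` {p \<in> space half_line_space. P p} \<inter> space M = {\<omega> \<in> space M. P (half_line_path Z \<omega>)}"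
      using half_line_path_funcset[of Z UNIV] by auto
    ultimately show ?thesis by simp
  qed
  note ev = this
  ultimately have "prob {\<omega> \<in> space M. P (half_line_path (\<lambda>t \<omega>. - \<xi> t \<omega>) \<omega>)} = 1"
    by (subst prob_Collect_eq_1) (auto intro!: ev)
  then have "prob {\<omega> \<in> space M. P (half_line_path \<eta> \<omega>)} = 1"
    using prob_copy[OF set_meas] by simp
  then have "AE \<omega> in M. P (half_line_path \<eta> \<omega>)"
    by (subst (asm) prob_Collect_eq_1) (auto intro!: ev)
  then show ?thesis
    using AE_space
  proof eventually_elim
    case (elim \<omega>)
    then obtain m :: nat where m0: "\<forall>a b. real m \<le> ?r a b \<longrightarrow> half_line_path \<eta> \<omega> (?r a b) \<le> 0"
      unfolding P_def by blast
    have m: "\<eta> (?r a b) \<omega> \<le> 0" if "real m \<le> ?r a b" for a b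
      using m0[rule_format, OF that] by (simp add: half_line_path_def)
    show ?case
    proof (intro exI[of _ m] allI impI)
      fix s assume s: "real m \<le> s"
      then have "0 \<le> s" by (meson of_nat_0_le_iff order_trans)
      let ?d = "\<lambda>n. (real_of_int \<lfloor>s * real (Suc n)\<rfloor> + 1) / real (Suc n)"
      have "(\<lambda>n. \<eta> (?d n) \<omega>) \<longlonglongrightarrow> \<eta> s \<omega>"
        using eta_cadlag[OF elim(2)] \<open>0 \<le> s\<close>
        by (intro filterlim_compose[OF _ filterlim_dyadic_at_right]) (simp add: cadlag_on_half_line_iff)
      moreover have "\<eta> (?d n) \<omega> \<le> 0" for n
      proof -
        have "0 \<le> \<lfloor>s * real (Suc n)\<rfloor>" using \<open>0 \<le> s\<close> by simp
        then have d: "?d n = ?r (nat (\<lfloor>s * real (Suc n)\<rfloor> + 1)) n" by simp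
        have "s * real (Suc n) \<le> real_of_int \<lfloor>s * real (Suc n)\<rfloor> + 1" by linarith
        then have "s \<le> ?d n" by (simp add: pos_le_divide_eq del: of_nat_Suc)
        then show ?thesis using m[of "nat (\<lfloor>s * real (Suc n)\<rfloor> + 1)" n] s unfolding d by linarith
      qed
      ultimately show "\<eta> s \<omega> \<le> 0" by (intro LIMSEQ_le_const2) auto
    qed
  qed
qed

lemma X_eventually_nonpos: "AE \<omega> in M. \<exists>m::nat. \<forall>s\<le>- real m. X \<omega> s \<le> 0"
  using eta_eventually_nonpos AE_space
proof eventually_elim
  case (elim \<omega>)
  then obtain m :: nat where m: "\<And>s. real m \<le> s \<Longrightarrow> \<eta> s \<omega> \<le> 0" by blast
  show ?case
  proof (intro exI[of _ "Suc m"] allI impI)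
    fix s assume s: "s \<le> - real (Suc m)"
    have "Lim (at_left (- s)) (\<lambda>r. \<eta> r \<omega>) \<le> 0"
    proof (rule tendsto_upperbound)
      show "((\<lambda>r. \<eta> r \<omega>) \<longlongrightarrow> Lim (at_left (- s)) (\<lambda>r. \<eta> r \<omega>)) (at_left (- s))"
        by (rule Lim_at_left_tendsto[OF eta_cadlag[OF elim(2)]]) (use s in simp)
      show "eventually (\<lambda>r. \<eta> r \<omega> \<le> 0) (at_left (- s))"
        by (rule eventually_at_left_mem_Ioo[of "real m" "- s" "- s"]) (use s m in auto)
    qed simp
    then show "X \<omega> s \<le> 0" using s by (simp add: X_def xi_tilde_def)
  qed
qed

text \<open>The successors keep the mesh and the time index positive.\<close>

definition climb :: "nat \<Rightarrow> 'a set" where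
  "climb N = {\<omega> \<in> space M. \<forall>j. 1 < \<xi> (real (Suc j) * real (Suc N)) \<omega>}"

lemma climb_sets: "climb N \<in> sets Fxi"
proof -
  have [measurable]: "\<xi> (real (Suc j) * real (Suc N)) \<in> borel_measurable Fxi" for j
    by (rule xi_measurable_Fxi) simp
  have "{\<omega> \<in> space Fxi. \<forall>j. 1 < \<xi> (real (Suc j) * real (Suc N)) \<omega>} \<in> sets Fxi" by measurable
  then show ?thesis by (simp add: climb_def)
qed

lemma prob_climb_pos: "\<exists>N. 0 < prob (climb N)"
proof (rule ccontr)
  assume "\<not> (\<exists>N. 0 < prob (climb N))"
  then have "\<not> 0 < prob (climb N)" for N by blast
  then have "prob (climb N) = 0" for N using measure_nonneg[of M "climb N"] by (metis order_le_less)
  then have "AE \<omega> in M. \<omega> \<notin> climb N" for N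
    using subsetD[OF sets_F_subset(1) climb_sets] by (simp add: prob_eq_0)
  then have "AE \<omega> in M. \<forall>N. \<omega> \<notin> climb N" by (simp add: AE_all_countable)
  with drift[unfolded drifts_to_infinity_def] AE_space have "AE \<omega> in M. False"
  proof eventually_elim
    case (elim \<omega>)
    from elim(1) obtain b where b: "\<And>s. b \<le> s \<Longrightarrow> 1 < \<xi> s \<omega>"
      by (auto simp: filterlim_at_top_dense eventually_at_top_linorder)
    obtain N :: nat where N: "b \<le> real N" using real_arch_simple by blast
    have "b \<le> real (Suc j) * real (Suc N)" for j
    proof -
      have "real (Suc N) \<le> real (Suc j) * real (Suc N)" by simp
      then show ?thesis using N by linarith
    qed
    then have "\<omega> \<in> climb N" using b elim(2) by (simp add: climb_def)
    with elim(3) show ?case by blast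
  qed
  then show False by simp
qed

text \<open>Consider the grid times at which the path lies in a given unit interval and after which it exceeds its
  current value by more than one unit at all later grid times. Every path has at most one of them. A given grid
  time is one of them with probability \<open>prob (climb N)\<close> times the probability summed here, by stationarity and
  the independence of past and future.\<close>

lemma sum_prob_unit_interval:
  assumes u: "0 \<le> u" and c: "0 < prob (climb N)"
  shows "(\<Sum>k. ennreal (prob {\<omega> \<in> space M. X \<omega> (- (u + real k * real (Suc N))) \<in> {b - 1..b}}))
    \<le> ennreal (1 / prob (climb N))"
proof -
  let ?s = "\<lambda>k. u + real k * real (Suc N)"
  let ?P = "\<lambda>k. prob {\<omega> \<in> space M. X \<omega> (- ?s k) \<in> {b - 1..b}}"
  have s: "0 \<le> ?s k" for k using u by simp
  let ?B = "\<lambda>k. {w \<in> space path_space. w (- ?s k) \<in> {b - 1..b} \<and> (\<forall>j. 1 < w (real (Suc j) * real (Suc N)))}"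
  note [measurable] = eval_measurable
  have B: "?B k \<in> sets path_space" for k by measurable
  note [measurable del] = eval_measurable
  let ?L = "\<lambda>k. rebase (?s k) -` ?B k \<inter> space W"
  have L: "?L k \<in> sets W" for k
    using measurable_sets[OF rebase_measurable B, of "?s k" k] by (simp add: sets_W space_W)
  interpret W: prob_space W by (rule prob_space_W)
  have PL: "W.prob (?L k) = ?P k * prob (climb N)" for k
  proof -
    interpret mp: measure_preserving_map W "rebase (?s k)" by (rule measure_preserving_rebase)
    have past_set: "{\<omega> \<in> space M. Xpast \<omega> (- ?s k) \<in> {b - 1..b}} \<in> sets Feta"
    proof -
      have "(\<lambda>\<omega>. Xpast \<omega> (- ?s k)) \<in> borel_measurable Feta"
        using Xpast_measurable unfolding measurable_path_space_iff by blast
      from measurable_sets[OF this, of "{b - 1..b}"] show ?thesis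
        by (simp add: vimage_def Int_def conj_commute)
    qed
    have "W.prob (?L k) = W.prob (?B k)" using mp.prob_funpow_vimage[of "?B k" 1] B by (simp add: sets_W)
    also have "\<dots> = prob {\<omega> \<in> space M. X \<omega> \<in> ?B k}" by (rule measure_W[OF B])
    also have "\<dots> = prob ({\<omega> \<in> space M. Xpast \<omega> (- ?s k) \<in> {b - 1..b}} \<inter> climb N)"
    proof (rule measure_eq_AE)
      show "AE \<omega> in M. \<omega> \<in> {\<omega> \<in> space M. X \<omega> \<in> ?B k} \<longleftrightarrow> \<omega> \<in> {\<omega> \<in> space M. Xpast \<omega> (- ?s k) \<in> {b - 1..b}} \<inter> climb N"
        using xi_0 AE_space
      proof eventually_elim
        case (elim \<omega>)
        have "X \<omega> \<in> space path_space" by (rule measurable_space[OF X_measurable elim(2)])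
        moreover have "X \<omega> (- ?s k) = Xpast \<omega> (- ?s k)" by (rule X_eq_Xpast[OF elim(1)]) (use s[of k] in simp)
        moreover have "X \<omega> (real (Suc j) * real (Suc N)) = \<xi> (real (Suc j) * real (Suc N)) \<omega>" for j
          by (rule X_nonneg) simp
        ultimately show ?case using elim(2) by (simp add: climb_def del: of_nat_Suc)
      qed
      have "X -` ?B k \<inter> space M \<in> sets M" by (rule measurable_sets[OF X_measurable B])
      moreover have "X -` ?B k \<inter> space M = {\<omega> \<in> space M. X \<omega> \<in> ?B k}" by blast
      ultimately show "{\<omega> \<in> space M. X \<omega> \<in> ?B k} \<in> sets M" by (simp only:)
      show "{\<omega> \<in> space M. Xpast \<omega> (- ?s k) \<in> {b - 1..b}} \<inter> climb N \<in> sets M"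
        by (rule sets.Int[OF subsetD[OF sets_F_subset(2) past_set] subsetD[OF sets_F_subset(1) climb_sets]])
    qed
    also have "\<dots> = prob {\<omega> \<in> space M. Xpast \<omega> (- ?s k) \<in> {b - 1..b}} * prob (climb N)"
      by (rule prob_Int_F[OF past_set climb_sets])
    also have "prob {\<omega> \<in> space M. Xpast \<omega> (- ?s k) \<in> {b - 1..b}} = ?P k"
    proof (rule measure_eq_AE)
      show "AE \<omega> in M. \<omega> \<in> {\<omega> \<in> space M. Xpast \<omega> (- ?s k) \<in> {b - 1..b}} \<longleftrightarrow> \<omega> \<in> {\<omega> \<in> space M. X \<omega> (- ?s k) \<in> {b - 1..b}}"
        using xi_0
      proof eventually_elim
        case (elim \<omega>)
        have "X \<omega> (- ?s k) = Xpast \<omega> (- ?s k)" by (rule X_eq_Xpast[OF elim(1)]) (use s[of k] in simp)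
        then show ?case by simp
      qed
      show "{\<omega> \<in> space M. Xpast \<omega> (- ?s k) \<in> {b - 1..b}} \<in> sets M"
        by (rule subsetD[OF sets_F_subset(2) past_set])
      show "{\<omega> \<in> space M. X \<omega> (- ?s k) \<in> {b - 1..b}} \<in> sets M" by measurable
    qed
    finally show ?thesis .
  qed
  have disj: "disjoint_family ?L"
  proof -
    have "?L i \<inter> ?L k = {}" if "i < k" for i k
    proof -
      have False if w: "w \<in> ?L i" "w \<in> ?L k" for w
      proof -
        obtain j where j: "k = i + Suc j" using \<open>i < k\<close> less_imp_Suc_add by auto
        have "w 0 - w (?s i) \<in> {b - 1..b}" "w 0 - w (?s k) \<in> {b - 1..b}"
          using w by (simp_all add: rebase_def)
        moreover have "1 < w (?s k) - w (?s i)"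
        proof -
          have "1 < w (?s i + real (Suc j) * real (Suc N)) - w (?s i)"
            using w(1) by (simp add: rebase_def del: of_nat_Suc)
          moreover have "?s i + real (Suc j) * real (Suc N) = ?s k" unfolding j by (simp add: algebra_simps)
          ultimately show ?thesis by (simp only:)
        qed
        ultimately show False unfolding atLeastAtMost_iff by linarith
      qed
      then show ?thesis by blast
    qed
    note lt = this
    show ?thesis
      unfolding disjoint_family_on_def
    proof (intro ballI impI)
      fix i k :: nat assume "i \<noteq> k"
      then consider "i < k" | "k < i" by linarith
      then show "?L i \<inter> ?L k = {}"
      proof cases
        case 1 then show ?thesis by (rule lt)
      next
        case 2 from lt[OF this] show ?thesis by (simp only: Int_commute)
      qed
    qed
  qed
  have "(\<lambda>k. W.prob (?L k)) sums W.prob (\<Union>k. ?L k)"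
    by (rule W.finite_measure_UNION[OF image_subsetI[OF L] disj])
  then have "(\<lambda>k. ?P k * prob (climb N)) sums W.prob (\<Union>k. ?L k)" by (simp only: PL)
  from sums_divide[OF this, of "prob (climb N)"]
  have sums: "?P sums (W.prob (\<Union>k. ?L k) / prob (climb N))" using c by simp
  then have "(\<Sum>k. ennreal (?P k)) = ennreal (W.prob (\<Union>k. ?L k) / prob (climb N))"
    by (intro suminf_ennreal_eq) auto
  also have "\<dots> \<le> ennreal (1 / prob (climb N))"
    by (intro ennreal_leI divide_right_mono) auto
  finally show ?thesis .
qed

text \<open>The negative half-line is cut into unit intervals. Up to a common constant the expected time spent in the
  interval below \<open>- a\<close> contributes at most \<open>exp (- a)\<close>.\<close>

lemma occupation_below_0: "AE \<omega> in M. (\<integral>\<^sup>+s. ennreal (exp (X \<omega> (- s))) * indicator {..0} (X \<omega> (- s)) * indicator {0..} s \<partial>lborel) < \<infinity>"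
proof -
  obtain N where c: "0 < prob (climb N)" using prob_climb_pos by blast
  have Xm: "(\<lambda>p. X (snd p) (- fst p)) \<in> borel_measurable (lborel \<Otimes>\<^sub>M M)"
    by (rule eval_jointly_measurable[where Z = "\<lambda>p. X (snd p)"]) (use X_measurable in measurable)
  have Xm'[measurable]: "(\<lambda>p. X (fst p) (- snd p)) \<in> borel_measurable (M \<Otimes>\<^sub>M lborel)"
    by (rule eval_jointly_measurable[where Z = "\<lambda>p. X (fst p)"]) (use X_measurable in measurable)
  have occ_meas: "(\<lambda>s. ennreal (prob {\<omega> \<in> space M. X \<omega> (- s) \<in> A})) \<in> borel_measurable lborel"
    if [measurable]: "A \<in> sets borel" for A
  proof -
    have "(\<lambda>s. \<integral>\<^sup>+\<omega>. indicator A (X \<omega> (- s)) \<partial>M) \<in> borel_measurable lborel"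
    proof (rule borel_measurable_nn_integral)
      have "(\<lambda>p. indicator A (X (snd p) (- fst p)) :: ennreal) \<in> borel_measurable (lborel \<Otimes>\<^sub>M M)"
        by (rule measurable_compose[OF Xm]) measurable
      then show "(\<lambda>(s, \<omega>). indicator A (X \<omega> (- s)) :: ennreal) \<in> borel_measurable (lborel \<Otimes>\<^sub>M M)"
        by (simp add: split_beta')
    qed
    moreover have "(\<integral>\<^sup>+\<omega>. indicator A (X \<omega> (- s)) \<partial>M) = ennreal (prob {\<omega> \<in> space M. X \<omega> (- s) \<in> A})" for s
    proof -
      have "(\<integral>\<^sup>+\<omega>. indicator A (X \<omega> (- s)) \<partial>M) = (\<integral>\<^sup>+\<omega>. indicator {\<omega> \<in> space M. X \<omega> (- s) \<in> A} \<omega> \<partial>M)"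
        by (intro nn_integral_cong) (auto simp: indicator_def)
      then show ?thesis by (simp add: emeasure_eq_measure)
    qed
    ultimately show ?thesis by simp
  qed
  \<comment> \<open>The exponential on the negative half-line is dominated by its value at the upper end of each unit interval.\<close>
  have dom: "ennreal (exp x) * indicator {..0} x \<le> (\<Sum>a. ennreal (exp (- real a)) * indicator {- real a - 1..- real a} x)" for x
  proof (cases "x \<le> 0")
    case True
    define a where "a = nat \<lfloor>- x\<rfloor>"
    have a: "real a \<le> - x" "- x < real a + 1" using True unfolding a_def by linarith+
    have "ennreal (exp x) * indicator {..0} x \<le> ennreal (exp (- real a)) * indicator {- real a - 1..- real a} x"
      using a True by (auto intro!: ennreal_leI simp: indicator_def)
    also have "\<dots> \<le> (\<Sum>a. ennreal (exp (- real a)) * indicator {- real a - 1..- real a} x)"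
    proof -
      have "f a \<le> (\<Sum>a. f a)" for f :: "nat \<Rightarrow> ennreal"
        using sum_le_suminf[of f "{a}"] by simp
      then show ?thesis .
    qed
    finally show ?thesis .
  qed simp
  have "(\<integral>\<^sup>+\<omega>. \<integral>\<^sup>+s. ennreal (exp (X \<omega> (- s))) * indicator {..0} (X \<omega> (- s)) * indicator {0..} s \<partial>lborel \<partial>M)
     \<le> (\<integral>\<^sup>+\<omega>. \<integral>\<^sup>+s. (\<Sum>a. ennreal (exp (- real a)) * indicator {- real a - 1..- real a} (X \<omega> (- s)) * indicator {0..} s) \<partial>lborel \<partial>M)"
    using dom by (intro nn_integral_mono) (auto simp: indicator_def simp del: exp_minus)
  also have "\<dots> = (\<integral>\<^sup>+s. \<integral>\<^sup>+\<omega>. (\<Sum>a. ennreal (exp (- real a)) * indicator {- real a - 1..- real a} (X \<omega> (- s)) * indicator {0..} s) \<partial>M \<partial>lborel)"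
  proof -
    interpret pair_sigma_finite M lborel ..
    show ?thesis
      by (rule Fubini'[symmetric]) measurable
  qed
  also have "\<dots> = (\<integral>\<^sup>+s. (\<Sum>a. ennreal (exp (- real a)) * (ennreal (prob {\<omega> \<in> space M. X \<omega> (- s) \<in> {- real a - 1..- real a}}) * indicator {0..} s)) \<partial>lborel)"
  proof (intro nn_integral_cong)
    fix s :: real
    have "(\<integral>\<^sup>+\<omega>. (\<Sum>a. ennreal (exp (- real a)) * indicator {- real a - 1..- real a} (X \<omega> (- s)) * indicator {0..} s) \<partial>M)
      = (\<Sum>a. \<integral>\<^sup>+\<omega>. ennreal (exp (- real a)) * indicator {- real a - 1..- real a} (X \<omega> (- s)) * indicator {0..} s \<partial>M)"
      by (rule nn_integral_suminf) measurable
    also have "\<dots> = (\<Sum>a. ennreal (exp (- real a)) * (ennreal (prob {\<omega> \<in> space M. X \<omega> (- s) \<in> {- real a - 1..- real a}}) * indicator {0..} s))"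
    proof (rule suminf_cong)
      fix a
      have set: "{\<omega> \<in> space M. X \<omega> (- s) \<in> {- real a - 1..- real a}} \<in> sets M" by measurable
      have "(\<integral>\<^sup>+\<omega>. ennreal (exp (- real a)) * indicator {- real a - 1..- real a} (X \<omega> (- s)) * indicator {0..} s \<partial>M)
        = (\<integral>\<^sup>+\<omega>. (ennreal (exp (- real a)) * indicator {0..} s) * indicator {\<omega> \<in> space M. X \<omega> (- s) \<in> {- real a - 1..- real a}} \<omega> \<partial>M)"
        by (intro nn_integral_cong) (auto simp: indicator_def)
      also have "\<dots> = (ennreal (exp (- real a)) * indicator {0..} s) * emeasure M {\<omega> \<in> space M. X \<omega> (- s) \<in> {- real a - 1..- real a}}"
        by (rule nn_integral_cmult_indicator[OF set])
      finally show "(\<integral>\<^sup>+\<omega>. ennreal (exp (- real a)) * indicator {- real a - 1..- real a} (X \<omega> (- s)) * indicator {0..} s \<partial>M)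
        = ennreal (exp (- real a)) * (ennreal (prob {\<omega> \<in> space M. X \<omega> (- s) \<in> {- real a - 1..- real a}}) * indicator {0..} s)"
        by (simp add: emeasure_eq_measure ac_simps)
    qed
    finally show "(\<integral>\<^sup>+\<omega>. (\<Sum>a. ennreal (exp (- real a)) * indicator {- real a - 1..- real a} (X \<omega> (- s)) * indicator {0..} s) \<partial>M)
      = (\<Sum>a. ennreal (exp (- real a)) * (ennreal (prob {\<omega> \<in> space M. X \<omega> (- s) \<in> {- real a - 1..- real a}}) * indicator {0..} s))" .
  qed
  also have "\<dots> = (\<Sum>a. \<integral>\<^sup>+s. ennreal (exp (- real a)) * (ennreal (prob {\<omega> \<in> space M. X \<omega> (- s) \<in> {- real a - 1..- real a}}) * indicator {0..} s) \<partial>lborel)"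
  proof (rule nn_integral_suminf)
    fix a
    show "(\<lambda>s. ennreal (exp (- real a)) * (ennreal (prob {\<omega> \<in> space M. X \<omega> (- s) \<in> {- real a - 1..- real a}}) * indicator {0..} s)) \<in> borel_measurable lborel"
      using occ_meas[of "{- real a - 1..- real a}"] by measurable
  qed
  also have "\<dots> \<le> (\<Sum>a. ennreal (exp (- real a)) * (ennreal (1 / prob (climb N)) * ennreal (real (Suc N))))"
  proof (intro suminf_le summableI)
    fix a
    let ?F = "\<lambda>s. ennreal (prob {\<omega> \<in> space M. X \<omega> (- s) \<in> {- real a - 1..- real a}})"
    have F[measurable]: "?F \<in> borel_measurable borel" using occ_meas[of "{- real a - 1..- real a}"] by simp
    have "(\<integral>\<^sup>+s. ?F s * indicator {0..} s \<partial>lborel) = (\<integral>\<^sup>+u. (\<Sum>k. ?F (u + real k * real (Suc N))) * indicator {0..<real (Suc N)} u \<partial>lborel)"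
      by (rule nn_integral_periodize[OF F]) simp
    also have "\<dots> \<le> (\<integral>\<^sup>+u. ennreal (1 / prob (climb N)) * indicator {0..<real (Suc N)} u \<partial>lborel)"
    proof (intro nn_integral_mono)
      fix u :: real
      show "(\<Sum>k. ?F (u + real k * real (Suc N))) * indicator {0..<real (Suc N)} u \<le> ennreal (1 / prob (climb N)) * indicator {0..<real (Suc N)} u"
      proof (cases "u \<in> {0..<real (Suc N)}")
        case True
        then have "0 \<le> u" by simp
        show ?thesis unfolding indicator_simps(1)[OF True] mult_1_right
          by (rule sum_prob_unit_interval[OF \<open>0 \<le> u\<close> c])
      next
        case False
        show ?thesis unfolding indicator_simps(2)[OF False] mult_zero_right by (rule order_refl)
      qed
    qed
    also have "\<dots> = ennreal (1 / prob (climb N)) * ennreal (real (Suc N))"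
      by (subst nn_integral_cmult_indicator) auto
    finally have le: "(\<integral>\<^sup>+s. ?F s * indicator {0..} s \<partial>lborel) \<le> ennreal (1 / prob (climb N)) * ennreal (real (Suc N))" .
    have "(\<integral>\<^sup>+s. ennreal (exp (- real a)) * (?F s * indicator {0..} s) \<partial>lborel) = ennreal (exp (- real a)) * (\<integral>\<^sup>+s. ?F s * indicator {0..} s \<partial>lborel)"
      by (rule nn_integral_cmult) measurable
    then show "(\<integral>\<^sup>+s. ennreal (exp (- real a)) * (?F s * indicator {0..} s) \<partial>lborel) \<le> ennreal (exp (- real a)) * (ennreal (1 / prob (climb N)) * ennreal (real (Suc N)))"
      using le by (simp add: mult_left_mono)
  qed
  also have "\<dots> = (\<Sum>a. ennreal (exp (- real a))) * (ennreal (1 / prob (climb N)) * ennreal (real (Suc N)))"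
    by (rule ennreal_suminf_multc)
  also have "\<dots> < \<infinity>"
  proof -
    have "summable (\<lambda>a. exp (- 1 :: real) ^ a)" by (rule summable_geometric) simp
    then have "summable (\<lambda>a. exp (- real a))" by (simp add: exp_of_nat_mult[symmetric])
    then have "(\<Sum>a. ennreal (exp (- real a))) = ennreal (\<Sum>a. exp (- real a))"
      by (intro suminf_ennreal2) auto
    then show ?thesis by (simp add: ennreal_mult_less_top)
  qed
  finally have "(\<integral>\<^sup>+\<omega>. \<integral>\<^sup>+s. ennreal (exp (X \<omega> (- s))) * indicator {..0} (X \<omega> (- s)) * indicator {0..} s \<partial>lborel \<partial>M) \<noteq> \<infinity>" by simp
  then show ?thesis
    by (rule nn_integral_noteq_infinite[rotated, THEN AE_mp]) (auto simp: less_top intro!: AE_I2)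
qed

sublocale E: ergodic_map W "rebase 1" by (rule ergodic_rebase)

lemma X_space: "\<omega> \<in> space M \<Longrightarrow> X \<omega> \<in> space path_space"
  by (rule measurable_space[OF X_measurable])

lemma X_summable_past: "AE \<omega> in M. summable_past (X \<omega>)"
  using occupation_below_0 X_eventually_nonpos AE_space
proof eventually_elim
  case (elim \<omega>)
  define w where "w = X \<omega>"
  have cad: "cadlag_on UNIV w" using X_space[OF elim(3)] by (simp add: w_def space_path_space)
  have [measurable]: "w \<in> borel_measurable borel" by (rule cadlag_borel_measurable[OF cad])
  obtain m :: nat where m: "\<And>s. s \<le> - real m \<Longrightarrow> w s \<le> 0" using elim(2) unfolding w_def by blast
  let ?F = "\<lambda>s. ennreal (exp (w s)) * indicator {..0} (w s) * indicator {..0} s"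
  have "(\<integral>\<^sup>+s. ?F s \<partial>lborel) = (\<integral>\<^sup>+s. ?F (0 + (- 1) * s) \<partial>lborel)"
    by (subst nn_integral_real_affine[where c = "- 1" and t = 0]) auto
  also have "\<dots> = (\<integral>\<^sup>+s. ennreal (exp (w (- s))) * indicator {..0} (w (- s)) * indicator {0..} s \<partial>lborel)"
    by (intro nn_integral_cong) (simp add: indicator_def)
  also have "\<dots> < \<infinity>" using elim(1) by (simp add: w_def)
  finally have fin: "(\<integral>\<^sup>+s. ?F s \<partial>lborel) < \<infinity>" .
  have "set_integrable lborel {..- real m} (\<lambda>s. exp (w s))"
    unfolding set_integrable_def
  proof (rule integrableI_bounded)
    have "(\<integral>\<^sup>+s. ennreal (norm (indicator {..- real m} s *\<^sub>R exp (w s))) \<partial>lborel) \<le> (\<integral>\<^sup>+s. ?F s \<partial>lborel)"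
    proof (rule nn_integral_mono)
      fix s
      show "ennreal (norm (indicator {..- real m} s *\<^sub>R exp (w s))) \<le> ?F s"
      proof (cases "s \<le> - real m")
        case True
        then have "w s \<le> 0" "s \<le> 0" using m[of s] by auto
        then show ?thesis using True by simp
      qed simp
    qed
    then show "(\<integral>\<^sup>+s. ennreal (norm (indicator {..- real m} s *\<^sub>R exp (w s))) \<partial>lborel) < \<infinity>"
      using fin by (rule le_less_trans)
  qed measurable
  from set_integrable_Un[OF this cadlag_exp_integrable_Ioc[OF cad, of "- real m" 0]]
  have "set_integrable lborel ({..- real m} \<union> {- real m<..0}) (\<lambda>s. exp (w s))" by simp
  moreover have "{..- real m} \<union> {- real m<..0} = {..0}" by auto
  ultimately show ?case using cad by (simp add: summable_past_def w_def)
qed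

lemma X_clock_path: "AE \<omega> in M. clock_path (X \<omega>)"
  using X_summable_past drift[unfolded drifts_to_infinity_def]
proof eventually_elim
  case (elim \<omega>)
  obtain b where b: "\<And>s. b \<le> s \<Longrightarrow> 0 \<le> \<xi> s \<omega>"
    using elim(2) by (auto simp: filterlim_at_top eventually_at_top_linorder)
  show ?case
    by (rule clock_path_of_eventually_nonneg[OF elim(1), of "max b 0"]) (simp add: X_nonneg b)
qed

lemma W_clock_path: "AE w in W. clock_path w"
proof -
  have "Measurable.pred path_space clock_path" using sets_clock_path by (simp add: pred_def)
  then show ?thesis using X_clock_path by (simp add: AE_W)
qed

lemma measurable_W: "measurable W N = measurable path_space N"
  by (rule measurable_cong_sets) (simp_all add: sets_W)

lemma nn_integral_rebase:
  assumes "F \<in> borel_measurable path_space"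
  shows "(\<integral>\<^sup>+w. F (rebase s w) \<partial>W) = (\<integral>\<^sup>+w. F w \<partial>W)"
proof -
  have F: "F \<in> borel_measurable W" using assms by (simp add: measurable_W)
  have rb: "rebase s \<in> W \<rightarrow>\<^sub>M W" by measurable
  have "F \<in> borel_measurable (distr W W (rebase s))" using F by (simp add: distr_rebase)
  from nn_integral_distr[OF rb this] show ?thesis by (simp add: distr_rebase)
qed

lemma nn_integral_W:
  "F \<in> borel_measurable path_space \<Longrightarrow> (\<integral>\<^sup>+w. F w \<partial>W) = (\<integral>\<^sup>+\<omega>. F (X \<omega>) \<partial>M)"
  unfolding W_def by (subst nn_integral_distr[OF X_measurable]) simp_all

section \<open>The total mass\<close>

text \<open>The common total mass of \<open>Q\<close> and \<open>\<nu>\<close>.\<close>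

definition mass :: ennreal where "mass = (\<integral>\<^sup>+w. ennreal (1 / V_path w 0) \<partial>W)"

text \<open>The clock value at time \<open>1\<close>, in a form that is measurable on the whole path space.\<close>

definition clock_gain :: "(real \<Rightarrow> real) \<Rightarrow> real" where
  "clock_gain w = ln (past_exp w 1) - ln (past_exp w 0)"

definition unit_increment :: "(real \<Rightarrow> real) \<Rightarrow> real" where "unit_increment w = w 1 - w 0"

definition log_V :: "(real \<Rightarrow> real) \<Rightarrow> real" where "log_V w = ln (V_path w 0)"

lemma clock_gain_measurable[measurable]: "clock_gain \<in> borel_measurable path_space"
  using past_exp_measurable_path[of 1] past_exp_measurable_path[of 0] unfolding clock_gain_def[abs_def] by measurable

lemma log_V_measurable[measurable]: "log_V \<in> borel_measurable path_space"
  using V_path_measurable_path[of 0] unfolding log_V_def[abs_def] by measurable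

lemma unit_increment_measurable[measurable]: "unit_increment \<in> borel_measurable path_space"
  using eval_measurable[of 1] eval_measurable[of 0] unfolding unit_increment_def[abs_def] by measurable

lemma clock_gain_nonneg: "clock_path w \<Longrightarrow> 0 \<le> clock_gain w"
proof -
  assume "clock_path w"
  then interpret clock_path w .
  show ?thesis using past_exp_mono[of 0 1] past_exp_pos[of 0] by (simp add: clock_gain_def)
qed

lemma clock_gain_coboundary:
  assumes "clock_path w" shows "clock_gain w - unit_increment w = log_V (rebase 1 w) - log_V w"
proof -
  interpret clock_path w by fact
  show ?thesis
    using past_exp_pos[of 0] past_exp_pos[of 1]
    by (simp add: clock_gain_def unit_increment_def log_V_def V_path_rebase) (simp add: V_path_def ln_mult)
qed

text \<open>The clock runs at speed \<open>1 / V\<close>, whose mean is the same at all times.\<close>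

lemma nn_integral_clock_gain: "(\<integral>\<^sup>+w. ennreal (clock_gain w) \<partial>W) = mass"
proof -
  interpret P: pair_sigma_finite W lborel ..
  have V: "(\<lambda>p. V_path (fst p) (snd p)) \<in> borel_measurable (W \<Otimes>\<^sub>M lborel)"
    by (rule V_path_measurable) measurable
  have "(\<integral>\<^sup>+w. ennreal (clock_gain w) \<partial>W) = (\<integral>\<^sup>+w. \<integral>\<^sup>+s. ennreal (1 / V_path w s) * indicator {0<..1} s \<partial>lborel \<partial>W)"
  proof (rule nn_integral_cong_AE)
    show "AE w in W. ennreal (clock_gain w) = (\<integral>\<^sup>+s. ennreal (1 / V_path w s) * indicator {0<..1} s \<partial>lborel)"
      using W_clock_path
    proof eventually_elim
      case (elim w)
      then interpret clock_path w .
      show ?case using nn_integral_inverse_V_path[of 0 1] by (simp add: clock_gain_def)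
    qed
  qed
  also have "\<dots> = (\<integral>\<^sup>+s. \<integral>\<^sup>+w. ennreal (1 / V_path w s) * indicator {0<..1} s \<partial>W \<partial>lborel)"
    by (rule P.Fubini'[symmetric]) (use V in \<open>simp add: split_beta'\<close>)
  also have "\<dots> = (\<integral>\<^sup>+s. mass * indicator {0<..1 :: real} s \<partial>lborel)"
  proof (rule nn_integral_cong)
    fix s :: real
    have m0: "(\<lambda>w. ennreal (1 / V_path w 0)) \<in> borel_measurable path_space"
      using V_path_measurable_path[of 0] by measurable
    have ms: "(\<lambda>w. ennreal (1 / V_path w s)) \<in> borel_measurable W"
      using V_path_measurable_path[of s] unfolding measurable_W by measurable
    have "(\<integral>\<^sup>+w. ennreal (1 / V_path w s) * indicator {0<..1} s \<partial>W) = (\<integral>\<^sup>+w. ennreal (1 / V_path w s) \<partial>W) * indicator {0<..1} s"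
      by (rule nn_integral_multc[OF ms])
    also have "(\<integral>\<^sup>+w. ennreal (1 / V_path w s) \<partial>W) = mass"
      using nn_integral_rebase[OF m0, of s] by (simp add: V_path_rebase mass_def)
    finally show "(\<integral>\<^sup>+w. ennreal (1 / V_path w s) * indicator {0<..1} s \<partial>W) = mass * indicator {0<..1} s" .
  qed
  also have "\<dots> = mass" by (simp add: nn_integral_cmult_indicator)
  finally show ?thesis .
qed

lemma unit_increment_X: "AE \<omega> in M. unit_increment (X \<omega>) = \<xi> 1 \<omega>"
  using xi_0 by eventually_elim (simp add: unit_increment_def X_nonneg)

lemma integrable_unit_increment_iff: "integrable W unit_increment \<longleftrightarrow> integrable M (\<xi> 1)"
proof -
  have m: "(\<lambda>\<omega>. unit_increment (X \<omega>)) \<in> borel_measurable M"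
    by (rule measurable_compose[OF X_measurable unit_increment_measurable])
  have "integrable W unit_increment \<longleftrightarrow> integrable M (\<lambda>\<omega>. unit_increment (X \<omega>))"
    unfolding W_def by (rule integrable_distr_eq[OF X_measurable unit_increment_measurable])
  also have "\<dots> \<longleftrightarrow> integrable M (\<xi> 1)"
    by (rule integrable_cong_AE[OF m xi_measurable unit_increment_X]) simp
  finally show ?thesis .
qed

lemma integral_unit_increment: "(\<integral>w. unit_increment w \<partial>W) = (\<integral>\<omega>. \<xi> 1 \<omega> \<partial>M)"
proof -
  have m: "(\<lambda>\<omega>. unit_increment (X \<omega>)) \<in> borel_measurable M"
    by (rule measurable_compose[OF X_measurable unit_increment_measurable])
  have "(\<integral>w. unit_increment w \<partial>W) = (\<integral>\<omega>. unit_increment (X \<omega>) \<partial>M)"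
    unfolding W_def by (rule integral_distr[OF X_measurable unit_increment_measurable])
  also have "\<dots> = (\<integral>\<omega>. \<xi> 1 \<omega> \<partial>M)"
    by (rule integral_cong_AE[OF m xi_measurable unit_increment_X]) simp
  finally show ?thesis .
qed

lemma integrable_clock_gain: "mass < \<infinity> \<Longrightarrow> integrable W clock_gain"
proof (rule integrableI_nonneg)
  show "clock_gain \<in> borel_measurable W" by (simp add: measurable_W)
  show "AE w in W. 0 \<le> clock_gain w" using W_clock_path by eventually_elim (rule clock_gain_nonneg)
qed (simp add: nn_integral_clock_gain)

lemma integrable_min_clock_gain: "integrable W (\<lambda>w. min (clock_gain w) (real K))"
proof (rule E.integrable_const_bound[where B = "real K"])
  show "AE w in W. norm (min (clock_gain w) (real K)) \<le> real K"
    using W_clock_path by eventually_elim (use clock_gain_nonneg in force)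
  show "(\<lambda>w. min (clock_gain w) (real K)) \<in> borel_measurable W"
    unfolding measurable_W by measurable
qed

text \<open>Truncation makes the clock gain integrable and keeps it below the increment plus a coboundary.\<close>

lemma integral_min_clock_gain_le:
  assumes int: "integrable M (\<xi> 1)"
  shows "(\<integral>w. min (clock_gain w) (real K) \<partial>W) \<le> (\<integral>w. unit_increment w \<partial>W)"
proof -
  have int': "integrable W unit_increment" using int by (simp add: integrable_unit_increment_iff)
  have "(\<integral>w. min (clock_gain w) (real K) - unit_increment w \<partial>W) \<le> 0"
  proof (rule E.integral_nonpos_of_le_coboundary)
    show "integrable W (\<lambda>w. min (clock_gain w) (real K) - unit_increment w)"
      by (intro Bochner_Integration.integrable_diff integrable_min_clock_gain int')
    show "log_V \<in> borel_measurable W" by (simp add: measurable_W)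
    show "AE w in W. min (clock_gain w) (real K) - unit_increment w \<le> log_V (rebase 1 w) - log_V w"
      using W_clock_path
    proof eventually_elim
      case (elim w)
      then show ?case using clock_gain_coboundary[of w] by linarith
    qed
  qed
  then show ?thesis
    by (subst (asm) Bochner_Integration.integral_diff[OF integrable_min_clock_gain int']) simp
qed

lemma mean_nonneg:
  assumes "integrable M (\<xi> 1)" shows "0 \<le> (\<integral>\<omega>. \<xi> 1 \<omega> \<partial>M)"
proof -
  have "0 \<le> (\<integral>w. min (clock_gain w) (real 0) \<partial>W)"
  proof (rule integral_nonneg_AE)
    show "AE w in W. 0 \<le> min (clock_gain w) (real 0)"
      using W_clock_path by eventually_elim (simp add: clock_gain_nonneg)
  qed
  then show ?thesis using integral_min_clock_gain_le[OF assms, of 0] by (simp add: integral_unit_increment)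
qed

lemma mass_eq_mean:
  assumes int: "integrable M (\<xi> 1)" shows "mass = ennreal (\<integral>\<omega>. \<xi> 1 \<omega> \<partial>M)"
proof -
  have int': "integrable W unit_increment" using int by (simp add: integrable_unit_increment_iff)
  let ?m = "\<integral>w. unit_increment w \<partial>W"
  have "mass \<le> ennreal ?m"
    unfolding nn_integral_clock_gain[symmetric]
  proof (rule nn_integral_le_of_truncations)
    show "clock_gain \<in> borel_measurable W" by (simp add: measurable_W)
    fix K :: nat
    have "(\<integral>\<^sup>+w. ennreal (min (clock_gain w) (real K)) \<partial>W) = ennreal (\<integral>w. min (clock_gain w) (real K) \<partial>W)"
    proof (rule nn_integral_eq_integral[OF integrable_min_clock_gain])
      show "AE w in W. 0 \<le> min (clock_gain w) (real K)"
        using W_clock_path by eventually_elim (use clock_gain_nonneg in force)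
    qed
    also have "\<dots> \<le> ennreal ?m" by (rule ennreal_leI[OF integral_min_clock_gain_le[OF int]])
    finally show "(\<integral>\<^sup>+w. ennreal (min (clock_gain w) (real K)) \<partial>W) \<le> ennreal ?m" .
  qed
  then have "mass < \<infinity>" using ennreal_less_top le_less_trans by (metis infinity_ennreal_def)
  from integrable_clock_gain[OF this] have a: "integrable W clock_gain" .
  have "(\<integral>w. unit_increment w - clock_gain w \<partial>W) \<le> 0"
  proof (rule E.integral_nonpos_of_le_coboundary)
    show "integrable W (\<lambda>w. unit_increment w - clock_gain w)"
      by (intro Bochner_Integration.integrable_diff a int')
    show "(\<lambda>w. - log_V w) \<in> borel_measurable W" unfolding measurable_W by measurable
    show "AE w in W. unit_increment w - clock_gain w \<le> - log_V (rebase 1 w) - - log_V w"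
      using W_clock_path
    proof eventually_elim
      case (elim w)
      then show ?case using clock_gain_coboundary[of w] by linarith
    qed
  qed
  then have "?m \<le> (\<integral>w. clock_gain w \<partial>W)"
    by (subst (asm) Bochner_Integration.integral_diff[OF int' a]) simp
  then have "ennreal ?m \<le> ennreal (\<integral>w. clock_gain w \<partial>W)" by (rule ennreal_leI)
  also have "\<dots> = (\<integral>\<^sup>+w. ennreal (clock_gain w) \<partial>W)"
  proof (rule nn_integral_eq_integral[OF a, symmetric])
    show "AE w in W. 0 \<le> clock_gain w" using W_clock_path by eventually_elim (rule clock_gain_nonneg)
  qed
  also have "\<dots> = mass" by (rule nn_integral_clock_gain)
  finally show ?thesis using \<open>mass \<le> ennreal ?m\<close> by (simp add: integral_unit_increment)
qed

text \<open>The difference \<open>\<xi> 1 - log V 0\<close> is the clock gain minus \<open>log V 1\<close>, and \<open>- log V 1 \<le> 1 / V 1\<close> has mean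
  at most \<open>mass\<close>. Since \<open>\<xi> 1\<close> and \<open>V 0\<close> are independent, \<open>V 0\<close> may be fixed in this bound.\<close>

lemma integrable_pos_part:
  assumes fin: "mass < \<infinity>" shows "integrable M (\<lambda>\<omega>. max 0 (\<xi> 1 \<omega>))"
proof -
  let ?g = "\<lambda>\<omega>. log_V (Xpast \<omega>)"
  have g: "?g \<in> borel_measurable Feta" by (rule measurable_compose[OF Xpast_measurable log_V_measurable])
  have \<phi>: "(\<lambda>p. ennreal (max 0 (\<xi> 1 (fst p) - ?g (snd p)))) \<in> borel_measurable (Fxi \<Otimes>\<^sub>M Feta)"
    using g xi_measurable_Fxi[of 1] by measurable
  let ?V1 = "\<lambda>w. ennreal (1 / V_path w 1)"
  have V1[measurable]: "?V1 \<in> borel_measurable path_space" using V_path_measurable_path[of 1] by measurable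
  have V1_mass: "(\<integral>\<^sup>+w. ?V1 w \<partial>W) = mass"
  proof -
    have m0: "(\<lambda>w. ennreal (1 / V_path w 0)) \<in> borel_measurable path_space"
      using V_path_measurable_path[of 0] by measurable
    show ?thesis using nn_integral_rebase[OF m0, of 1] by (simp add: V_path_rebase mass_def)
  qed
  have "(\<integral>\<^sup>+\<omega>. ennreal (max 0 (\<xi> 1 \<omega> - ?g \<omega>)) \<partial>M) \<le> (\<integral>\<^sup>+\<omega>. ennreal (clock_gain (X \<omega>)) + ?V1 (X \<omega>) \<partial>M)"
  proof (rule nn_integral_mono_AE)
    show "AE \<omega> in M. ennreal (max 0 (\<xi> 1 \<omega> - ?g \<omega>)) \<le> ennreal (clock_gain (X \<omega>)) + ?V1 (X \<omega>)"
      using xi_0 unit_increment_X X_clock_path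
    proof eventually_elim
      case (elim \<omega>)
      then interpret clock_path "X \<omega>" by simp
      have "V_path (X \<omega>) 0 = V_path (Xpast \<omega>) 0" by (rule V_path_cong) (rule X_eq_Xpast[OF elim(1)])
      then have "?g \<omega> = log_V (X \<omega>)" by (simp add: log_V_def)
      moreover have "- log_V (rebase 1 (X \<omega>)) \<le> 1 / V_path (X \<omega>) 1"
      proof -
        have "ln (1 / V_path (X \<omega>) 1) \<le> 1 / V_path (X \<omega>) 1 - 1"
          using V_path_pos[of 1] by (intro ln_le_minus_one) simp
        then show ?thesis using V_path_pos[of 1] by (simp add: log_V_def V_path_rebase ln_div)
      qed
      ultimately have "\<xi> 1 \<omega> - ?g \<omega> \<le> clock_gain (X \<omega>) + 1 / V_path (X \<omega>) 1"
        using clock_gain_coboundary[OF elim(3)] elim(2) by linarith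
      moreover have "0 \<le> clock_gain (X \<omega>)" "0 \<le> 1 / V_path (X \<omega>) 1"
        using clock_gain_nonneg[OF elim(3)] V_path_pos[of 1] by simp_all
      ultimately have "ennreal (max 0 (\<xi> 1 \<omega> - ?g \<omega>)) \<le> ennreal (clock_gain (X \<omega>) + 1 / V_path (X \<omega>) 1)"
        by (intro ennreal_leI) simp
      also have "\<dots> = ennreal (clock_gain (X \<omega>)) + ?V1 (X \<omega>)"
        by (rule ennreal_plus) (fact clock_gain_nonneg[OF elim(3)], use V_path_pos[of 1] in simp)
      finally show ?case .
    qed
  qed
  also have "\<dots> = (\<integral>\<^sup>+w. ennreal (clock_gain w) + ?V1 w \<partial>W)"
    by (rule nn_integral_W[symmetric]) measurable
  also have "\<dots> = mass + mass"
    by (subst nn_integral_add) (simp_all add: measurable_W nn_integral_clock_gain V1_mass)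
  also have "\<dots> < \<infinity>" using fin by simp
  finally have "(\<integral>\<^sup>+\<omega>1. (\<integral>\<^sup>+\<omega>2. ennreal (max 0 (\<xi> 1 \<omega>2 - ?g \<omega>1)) \<partial>M) \<partial>M) < \<infinity>"
    using nn_integral_decouple[OF \<phi>] by simp
  then have fin2: "(\<integral>\<^sup>+\<omega>1. (\<integral>\<^sup>+\<omega>2. ennreal (max 0 (\<xi> 1 \<omega>2 - ?g \<omega>1)) \<partial>M) \<partial>M) \<noteq> \<infinity>" by simp
  have "\<exists>r. (\<integral>\<^sup>+\<omega>2. ennreal (max 0 (\<xi> 1 \<omega>2 - r)) \<partial>M) < \<infinity>"
  proof (rule ccontr)
    assume "\<not> ?thesis"
    then have "(\<integral>\<^sup>+\<omega>2. ennreal (max 0 (\<xi> 1 \<omega>2 - ?g \<omega>1)) \<partial>M) = \<infinity>" for \<omega>1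
      by (metis infinity_ennreal_def less_top)
    then show False using fin2 by (simp add: emeasure_space_1)
  qed
  then obtain r where r: "(\<integral>\<^sup>+\<omega>2. ennreal (max 0 (\<xi> 1 \<omega>2 - r)) \<partial>M) < \<infinity>" by blast
  have [measurable]: "\<xi> 1 \<in> borel_measurable M" by (rule xi_measurable) simp
  have "integrable M (\<lambda>\<omega>. max 0 (\<xi> 1 \<omega> - r))"
    by (rule integrableI_nonneg) (use r in auto)
  then have "integrable M (\<lambda>\<omega>. max 0 (\<xi> 1 \<omega> - r) + \<bar>r\<bar>)" by simp
  then show ?thesis
    by (rule Bochner_Integration.integrable_bound) auto
qed

text \<open>Truncated from below at \<open>- K\<close>, the increment is integrable and at least the clock gain minus a
  coboundary. So the mean of the truncated negative part is at most that of the positive part, for all \<open>K\<close>.\<close>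

lemma integrable_of_finite_mass:
  assumes fin: "mass < \<infinity>" shows "integrable M (\<xi> 1)"
proof -
  have [measurable]: "\<xi> 1 \<in> borel_measurable M" by (rule xi_measurable) simp
  have [measurable]: "unit_increment \<in> borel_measurable W" by (simp add: measurable_W)
  have a: "integrable W clock_gain" by (rule integrable_clock_gain[OF fin])
  have pos_M: "integrable M (\<lambda>\<omega>. max 0 (unit_increment (X \<omega>)))"
  proof (rule integrable_cong_AE_imp[OF integrable_pos_part[OF fin]])
    show "(\<lambda>\<omega>. max 0 (unit_increment (X \<omega>))) \<in> borel_measurable M"
      using measurable_compose[OF X_measurable unit_increment_measurable] by measurable
    show "AE \<omega> in M. max 0 (\<xi> 1 \<omega>) = max 0 (unit_increment (X \<omega>))" using unit_increment_X by eventually_elim simp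
  qed
  have pm: "(\<lambda>w. max 0 (unit_increment w)) \<in> borel_measurable path_space" by measurable
  have pos: "integrable W (\<lambda>w. max 0 (unit_increment w))"
    unfolding W_def integrable_distr_eq[OF X_measurable pm] by (rule pos_M)
  let ?P = "\<integral>w. max 0 (unit_increment w) \<partial>W"
  have neg_le: "(\<integral>\<^sup>+w. ennreal (min (max 0 (- unit_increment w)) (real K)) \<partial>W) \<le> ennreal ?P" for K :: nat
  proof -
    let ?n = "\<lambda>w. min (max 0 (- unit_increment w)) (real K)"
    have n: "integrable W ?n"
      by (rule E.integrable_const_bound[where B = "real K"]) (auto intro!: AE_I2)
    have trunc: "unit_increment w \<le> max 0 (unit_increment w) - ?n w" for w by (simp add: min_def max_def)
    have "(\<integral>w. clock_gain w - (max 0 (unit_increment w) - ?n w) \<partial>W) \<le> 0"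
    proof (rule E.integral_nonpos_of_le_coboundary)
      show "integrable W (\<lambda>w. clock_gain w - (max 0 (unit_increment w) - ?n w))"
        by (intro Bochner_Integration.integrable_diff a pos n)
      show "log_V \<in> borel_measurable W" by (simp add: measurable_W)
      show "AE w in W. clock_gain w - (max 0 (unit_increment w) - ?n w) \<le> log_V (rebase 1 w) - log_V w"
        using W_clock_path
      proof eventually_elim
        case (elim w)
        then show ?case using clock_gain_coboundary[of w] trunc[of w] by linarith
      qed
    qed
    then have "(\<integral>w. clock_gain w \<partial>W) - (?P - (\<integral>w. ?n w \<partial>W)) \<le> 0"
      by (subst (asm) Bochner_Integration.integral_diff[OF a Bochner_Integration.integrable_diff[OF pos n]],
          subst (asm) Bochner_Integration.integral_diff[OF pos n])
    moreover have "0 \<le> (\<integral>w. clock_gain w \<partial>W)"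
    proof (rule integral_nonneg_AE)
      show "AE w in W. 0 \<le> clock_gain w" using W_clock_path by eventually_elim (rule clock_gain_nonneg)
    qed
    ultimately have le: "(\<integral>w. ?n w \<partial>W) \<le> ?P" by linarith
    have "(\<integral>\<^sup>+w. ennreal (?n w) \<partial>W) = ennreal (\<integral>w. ?n w \<partial>W)"
      by (rule nn_integral_eq_integral[OF n]) (auto intro!: AE_I2)
    also have "\<dots> \<le> ennreal ?P" by (rule ennreal_leI[OF le])
    finally show ?thesis .
  qed
  have "(\<integral>\<^sup>+w. ennreal (max 0 (- unit_increment w)) \<partial>W) \<le> ennreal ?P"
    by (rule nn_integral_le_of_truncations[OF _ neg_le]) measurable
  then have neg_fin: "(\<integral>\<^sup>+w. ennreal (max 0 (- unit_increment w)) \<partial>W) < \<infinity>"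
    using ennreal_less_top le_less_trans by (metis infinity_ennreal_def)
  have neg: "integrable W (\<lambda>w. max 0 (- unit_increment w))"
    by (rule integrableI_nonneg) (use neg_fin in \<open>auto intro!: AE_I2\<close>)
  have "integrable W (\<lambda>w. max 0 (unit_increment w) - max 0 (- unit_increment w))"
    by (rule Bochner_Integration.integrable_diff[OF pos neg])
  moreover have "max 0 (unit_increment w) - max 0 (- unit_increment w) = unit_increment w" for w
    by (simp add: max_def)
  ultimately show ?thesis unfolding integrable_unit_increment_iff[symmetric] by simp
qed

section \<open>Invariance and ergodicity of the time-changed path\<close>

text \<open>The law of the time-changed path under \<open>Q\<close>, written in terms of \<open>W\<close>.\<close>

definition mu_U :: "(real \<Rightarrow> real) measure" where
  "mu_U = distr (density W (\<lambda>w. ennreal (1 / V_path w 0))) path_space U_map"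

lemma sets_mu_U: "sets mu_U = sets path_space" and space_mu_U: "space mu_U = space path_space"
  by (simp_all add: mu_U_def)

lemma speed_measurable: "(\<lambda>w. ennreal (1 / V_path w 0)) \<in> borel_measurable W"
  using V_path_measurable_path[of 0] unfolding measurable_W by measurable

lemma nn_integral_mu_U:
  assumes F: "F \<in> borel_measurable path_space"
  shows "(\<integral>\<^sup>+u. F u \<partial>mu_U) = (\<integral>\<^sup>+w. ennreal (1 / V_path w 0) * F (U_map w) \<partial>W)"
proof -
  have U: "U_map \<in> density W (\<lambda>w. ennreal (1 / V_path w 0)) \<rightarrow>\<^sub>M path_space"
    using U_map_measurable by (simp add: measurable_W)
  have FU: "(\<lambda>w. F (U_map w)) \<in> borel_measurable W"
    unfolding measurable_W by (rule measurable_compose[OF U_map_measurable F])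
  have "(\<integral>\<^sup>+u. F u \<partial>mu_U) = (\<integral>\<^sup>+w. F (U_map w) \<partial>density W (\<lambda>w. ennreal (1 / V_path w 0)))"
    unfolding mu_U_def by (subst nn_integral_distr[OF U]) (simp_all add: F)
  also have "\<dots> = (\<integral>\<^sup>+w. ennreal (1 / V_path w 0) * F (U_map w) \<partial>W)"
    by (rule nn_integral_density[OF speed_measurable FU])
  finally show ?thesis .
qed

lemma emeasure_mu_U:
  assumes B: "B \<in> sets path_space"
  shows "emeasure mu_U B = (\<integral>\<^sup>+w. ennreal (1 / V_path w 0) * indicator B (U_map w) \<partial>W)"
  using nn_integral_mu_U[of "indicator B"] B by (simp add: sets_mu_U)

text \<open>Averaging over the first \<open>n\<close> units of time of the original flow turns the shift of the
  time-changed path by \<open>h\<close> into a translation by \<open>h\<close> of an interval of integration. This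
  changes the integral by at most \<open>\<bar>h\<bar>\<close>, whatever \<open>n\<close> is.\<close>

lemma mu_U_shift_le:
  assumes B: "B \<in> sets path_space"
  shows "emeasure mu_U (shift h -` B \<inter> space path_space) \<le> emeasure mu_U B"
proof -
  define J where "J h = (\<integral>\<^sup>+w. ennreal (1 / V_path w 0) * indicator B (shift h (U_map w)) \<partial>W)" for h
  \<comment> \<open>The measure of those clock times in an interval of length \<open>a\<close> at which the shifted path is in \<open>B\<close>.\<close>
  define K where "K h a w = (\<integral>\<^sup>+r. indicator {h<..h + a} r * indicator B (shift r (U_map w)) \<partial>lborel)" for h a w
  interpret P: pair_sigma_finite W lborel ..
  have orbit_meas: "(\<lambda>r. indicator B (shift r (U_map w)) :: ennreal) \<in> borel_measurable borel" if "w \<in> space path_space" for w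
  proof -
    have "(\<lambda>_. U_map w) \<in> (borel :: real measure) \<rightarrow>\<^sub>M path_space"
      using measurable_space[OF U_map_measurable that] by (rule measurable_const)
    from shift_jointly_measurable[OF this measurable_ident]
    have "(\<lambda>r. shift r (U_map w)) \<in> borel \<rightarrow>\<^sub>M path_space" by (simp add: id_def)
    from measurable_compose[OF this borel_measurable_indicator[OF B]] show ?thesis .
  qed
  have NJ: "ennreal (real n) * J h = (\<integral>\<^sup>+w. K h (A_path w (real n)) w \<partial>W)" for n :: nat and h
  proof -
    have m0: "(\<lambda>w. ennreal (1 / V_path w 0) * indicator B (shift h (U_map w))) \<in> borel_measurable path_space"
      using speed_measurable measurable_compose[OF measurable_compose[OF U_map_measurable shift_measurable] borel_measurable_indicator[OF B]]
      unfolding measurable_W by (rule borel_measurable_times_ennreal)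
    have meas: "(\<lambda>p. ennreal (1 / V_path (fst p) (snd p)) * indicator B (shift h (U_map (rebase (snd p) (fst p)))) * indicator {0<..real n} (snd p))
       \<in> borel_measurable (W \<Otimes>\<^sub>M lborel)"
    proof -
      have fst: "fst \<in> W \<Otimes>\<^sub>M lborel \<rightarrow>\<^sub>M path_space" by measurable
      have [measurable]: "(\<lambda>p. V_path (fst p) (snd p)) \<in> borel_measurable (W \<Otimes>\<^sub>M lborel)"
        by (rule V_path_measurable[OF fst]) measurable
      have "(\<lambda>p. rebase (snd p) (fst p)) \<in> W \<Otimes>\<^sub>M lborel \<rightarrow>\<^sub>M path_space"
        by (rule rebase_jointly_measurable[OF fst]) measurable
      from measurable_compose[OF measurable_compose[OF measurable_compose[OF this U_map_measurable] shift_measurable[of h]] borel_measurable_indicator[OF B]]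
      have [measurable]: "(\<lambda>p. indicator B (shift h (U_map (rebase (snd p) (fst p)))) :: ennreal) \<in> borel_measurable (W \<Otimes>\<^sub>M lborel)" .
      show ?thesis by measurable
    qed
    have "ennreal (real n) * J h = (\<integral>\<^sup>+s. J h * indicator {0<..real n} s \<partial>lborel)"
      by (simp add: nn_integral_cmult_indicator mult.commute)
    also have "\<dots> = (\<integral>\<^sup>+s. \<integral>\<^sup>+w. ennreal (1 / V_path w s) * indicator B (shift h (U_map (rebase s w))) * indicator {0<..real n} s \<partial>W \<partial>lborel)"
    proof (rule nn_integral_cong)
      fix s :: real
      have "J h = (\<integral>\<^sup>+w. ennreal (1 / V_path (rebase s w) 0) * indicator B (shift h (U_map (rebase s w))) \<partial>W)"
        unfolding J_def by (rule nn_integral_rebase[OF m0, symmetric])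
      then have Js: "J h = (\<integral>\<^sup>+w. ennreal (1 / V_path w s) * indicator B (shift h (U_map (rebase s w))) \<partial>W)"
        by (simp add: V_path_rebase)
      have ms: "(\<lambda>w. ennreal (1 / V_path w s) * indicator B (shift h (U_map (rebase s w)))) \<in> borel_measurable W"
        using measurable_compose[OF rebase_measurable[of s] m0] by (simp add: V_path_rebase measurable_W)
      show "J h * indicator {0<..real n} s = (\<integral>\<^sup>+w. ennreal (1 / V_path w s) * indicator B (shift h (U_map (rebase s w))) * indicator {0<..real n} s \<partial>W)"
        unfolding Js by (rule nn_integral_multc[OF ms, symmetric])
    qed
    also have "\<dots> = (\<integral>\<^sup>+w. \<integral>\<^sup>+s. ennreal (1 / V_path w s) * indicator B (shift h (U_map (rebase s w))) * indicator {0<..real n} s \<partial>lborel \<partial>W)"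
      by (rule P.Fubini') (use meas in \<open>simp add: split_beta'\<close>)
    also have "\<dots> = (\<integral>\<^sup>+w. K h (A_path w (real n)) w \<partial>W)"
    proof (rule nn_integral_cong_AE)
      show "AE w in W. (\<integral>\<^sup>+s. ennreal (1 / V_path w s) * indicator B (shift h (U_map (rebase s w))) * indicator {0<..real n} s \<partial>lborel)
          = K h (A_path w (real n)) w"
        using W_clock_path AE_space
      proof eventually_elim
        case (elim w)
        then interpret clock_path w by simp
        have w: "w \<in> space path_space" using elim(2) by (simp add: space_W)
        let ?G = "\<lambda>r. indicator B (shift (r + h) (U_map w)) * indicator {0<..A_path w (real n)} r :: ennreal"
        have "(\<lambda>r. indicator B (shift (r + h) (U_map w)) :: ennreal) \<in> borel_measurable borel"
          by (rule measurable_compose[OF _ orbit_meas[OF w]]) simp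
        then have G: "?G \<in> borel_measurable borel" by measurable
        have ind: "indicator {0<..A_path w (real n)} (A_path w s) = (indicator {0<..real n} s :: ennreal)" for s
          using strict_mono_less[OF A_path_strict_mono, of 0 s] strict_mono_less_eq[OF A_path_strict_mono, of s "real n"]
          by (simp add: indicator_def)
        have "(\<integral>\<^sup>+s. ennreal (1 / V_path w s) * indicator B (shift h (U_map (rebase s w))) * indicator {0<..real n} s \<partial>lborel)
          = (\<integral>\<^sup>+s. ennreal (1 / V_path w s) * ?G (A_path w s) \<partial>lborel)"
          by (intro nn_integral_cong) (simp add: U_map_rebase[OF elim(1)] shift_shift ind mult.assoc)
        also have "\<dots> = (\<integral>\<^sup>+r. ?G r \<partial>lborel)" by (rule nn_integral_A_path[OF G])
        also have "\<dots> = (\<integral>\<^sup>+r. ?G (- h + 1 * r) \<partial>lborel)"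
          using nn_integral_real_affine[of ?G 1 "- h"] G by simp
        also have "\<dots> = K h (A_path w (real n)) w"
          unfolding K_def by (intro nn_integral_cong) (auto simp: indicator_def)
        finally show ?case .
      qed
    qed
    finally show ?thesis .
  qed
  have K_le: "K h a w \<le> K 0 a w + ennreal \<bar>h\<bar>" if w: "w \<in> space path_space" and "0 \<le> a" for h a w
  proof -
    note [measurable] = orbit_meas[OF w]
    have "K h a w \<le> (\<integral>\<^sup>+r. indicator {0<..0 + a} r * indicator B (shift r (U_map w)) + (indicator {h<..0} r + indicator {a<..a + h} r) \<partial>lborel)"
      unfolding K_def by (intro nn_integral_mono) (auto simp: indicator_def)
    also have "\<dots> = K 0 a w + (\<integral>\<^sup>+r. indicator {h<..0} r + indicator {a<..a + h} r \<partial>lborel)"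
      unfolding K_def by (rule nn_integral_add) measurable
    also have "(\<integral>\<^sup>+r. indicator {h<..0} r + indicator {a<..a + h} r \<partial>lborel) = ennreal \<bar>h\<bar>"
      by (subst nn_integral_add) (cases "0 \<le> h"; simp)+
    finally show ?thesis .
  qed
  have NJ_le: "ennreal (real n) * J h \<le> ennreal (real n) * J 0 + ennreal \<bar>h\<bar>" for n :: nat and h
  proof -
    define a where "a w = ln (past_exp w (real n)) - ln (past_exp w 0)" for w
    have aeq: "AE w in W. A_path w (real n) = a w"
      using W_clock_path
    proof eventually_elim
      case (elim w)
      then interpret clock_path w .
      show ?case by (simp add: a_def A_path_eq)
    qed
    have K_meas: "(\<lambda>w. K 0 (a w) w) \<in> borel_measurable W"
      unfolding K_def
    proof (rule lborel.borel_measurable_nn_integral)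
      have fst: "fst \<in> W \<Otimes>\<^sub>M lborel \<rightarrow>\<^sub>M path_space" by measurable
      have [measurable]: "a \<in> borel_measurable path_space"
        unfolding a_def using past_exp_measurable_path by measurable
      have [measurable]: "(\<lambda>p. a (fst p)) \<in> borel_measurable (W \<Otimes>\<^sub>M lborel)"
        by (rule measurable_compose[OF fst]) measurable
      have "(\<lambda>p. shift (snd p) (U_map (fst p))) \<in> W \<Otimes>\<^sub>M lborel \<rightarrow>\<^sub>M path_space"
        by (rule shift_jointly_measurable[OF measurable_compose[OF fst U_map_measurable]]) measurable
      from measurable_compose[OF this borel_measurable_indicator[OF B]]
      have [measurable]: "(\<lambda>p. indicator B (shift (snd p) (U_map (fst p))) :: ennreal) \<in> borel_measurable (W \<Otimes>\<^sub>M lborel)" .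
      have "(\<lambda>p. (if 0 < snd p \<and> snd p \<le> 0 + a (fst p) then 1 else 0) * indicator B (shift (snd p) (U_map (fst p))) :: ennreal) \<in> borel_measurable (W \<Otimes>\<^sub>M lborel)"
        by measurable
      then show "(\<lambda>(w, r). indicator {0<..0 + a w} r * indicator B (shift r (U_map w)) :: ennreal) \<in> borel_measurable (W \<Otimes>\<^sub>M lborel)"
        by (simp add: split_beta' indicator_def of_bool_def)
    qed
    have "(\<integral>\<^sup>+w. K h (A_path w (real n)) w \<partial>W) \<le> (\<integral>\<^sup>+w. K 0 (A_path w (real n)) w + ennreal \<bar>h\<bar> \<partial>W)"
    proof (rule nn_integral_mono_AE)
      show "AE w in W. K h (A_path w (real n)) w \<le> K 0 (A_path w (real n)) w + ennreal \<bar>h\<bar>"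
        using W_clock_path AE_space
      proof eventually_elim
        case (elim w)
        then interpret clock_path w by simp
        have "0 \<le> A_path w (real n)" using strict_mono_less_eq[OF A_path_strict_mono, of 0 "real n"] by simp
        then show ?case using K_le elim(2) by (simp add: space_W)
      qed
    qed
    also have "\<dots> = (\<integral>\<^sup>+w. K 0 (a w) w + ennreal \<bar>h\<bar> \<partial>W)"
      using aeq by (intro nn_integral_cong_AE) (auto elim!: eventually_mono)
    also have "\<dots> = (\<integral>\<^sup>+w. K 0 (a w) w \<partial>W) + (\<integral>\<^sup>+w. ennreal \<bar>h\<bar> \<partial>W)"
      by (rule nn_integral_add[OF K_meas]) simp
    also have "(\<integral>\<^sup>+w. K 0 (a w) w \<partial>W) = (\<integral>\<^sup>+w. K 0 (A_path w (real n)) w \<partial>W)"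
      using aeq by (intro nn_integral_cong_AE) (auto elim!: eventually_mono)
    also have "(\<integral>\<^sup>+w. ennreal \<bar>h\<bar> \<partial>W) = ennreal \<bar>h\<bar>" by (simp add: E.emeasure_space_1)
    finally show ?thesis by (simp only: NJ)
  qed
  have "J h \<le> J 0"
  proof (rule ennreal_le_epsilon)
    fix e :: real assume e: "0 < e"
    obtain n :: nat where n: "\<bar>h\<bar> / e < real n" using reals_Archimedean2 by blast
    have "0 \<le> \<bar>h\<bar> / e" using e by simp
    then have n0: "0 < real n" using n by linarith
    have "\<bar>h\<bar> \<le> real n * e" using n e by (simp add: divide_less_eq)
    then have "ennreal \<bar>h\<bar> \<le> ennreal (real n) * ennreal e" using e by (simp add: ennreal_leI flip: ennreal_mult)
    then have "ennreal (real n) * J h \<le> ennreal (real n) * (J 0 + ennreal e)"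
      using NJ_le[of n h] by (simp add: distrib_left) (meson add_left_mono order_trans)
    then show "J h \<le> J 0 + ennreal e"
      using n0 by (subst (asm) ennreal_mult_le_mult_iff) simp_all
  qed
  moreover have "J 0 = emeasure mu_U B"
    unfolding J_def emeasure_mu_U[OF B] by (simp add: shift_def)
  moreover have "J h = emeasure mu_U (shift h -` B \<inter> space path_space)"
  proof -
    have sB: "shift h -` B \<inter> space path_space \<in> sets path_space" by (rule measurable_sets[OF shift_measurable B])
    show ?thesis
      unfolding J_def emeasure_mu_U[OF sB]
    proof (rule nn_integral_cong)
      fix w assume "w \<in> space W"
      then have "U_map w \<in> space path_space" using measurable_space[OF U_map_measurable] by (simp add: space_W)
      then show "ennreal (1 / V_path w 0) * indicator B (shift h (U_map w)) = ennreal (1 / V_path w 0) * indicator (shift h -` B \<inter> space path_space) (U_map w)"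
        by (simp add: indicator_def)
    qed
  qed
  ultimately show ?thesis by simp
qed

lemma shift_vimage_shift_vimage:
  "shift k -` (shift h -` B \<inter> space path_space) \<inter> space path_space = shift (k + h) -` B \<inter> space path_space"
proof -
  have "shift k u \<in> space path_space" if "u \<in> space path_space" for u
    by (rule measurable_space[OF shift_measurable that])
  then show ?thesis by (auto simp: shift_shift)
qed

lemma mu_U_shift:
  assumes B: "B \<in> sets path_space"
  shows "emeasure mu_U (shift h -` B \<inter> space path_space) = emeasure mu_U B"
proof (rule antisym[OF mu_U_shift_le[OF B]])
  let ?B = "shift h -` B \<inter> space path_space"
  have "?B \<in> sets path_space" by (rule measurable_sets[OF shift_measurable B])
  from mu_U_shift_le[OF this, of "- h"]
  have "emeasure mu_U (shift 0 -` B \<inter> space path_space) \<le> emeasure mu_U ?B"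
    by (simp only: shift_vimage_shift_vimage add.left_inverse)
  moreover have "shift 0 -` B \<inter> space path_space = B"
    using sets.sets_into_space[OF B] by (auto simp: shift_def)
  ultimately show "emeasure mu_U B \<le> emeasure mu_U ?B" by (simp only:)
qed

lemma distr_mu_U_shift: "distr mu_U path_space (shift h) = mu_U"
proof (rule measure_eqI)
  have sh: "shift h \<in> mu_U \<rightarrow>\<^sub>M path_space"
    using shift_measurable[of h] measurable_cong_sets[OF sets_mu_U refl] by blast
  fix B assume "B \<in> sets (distr mu_U path_space (shift h))"
  then have B: "B \<in> sets path_space" by simp
  show "emeasure (distr mu_U path_space (shift h)) B = emeasure mu_U B"
    using emeasure_distr[OF sh B] mu_U_shift[OF B, of h] by (simp add: space_mu_U)
qed (simp add: sets_mu_U)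

text \<open>The paths whose time change lies in a shift-invariant set form an event that is invariant
  under the original flow.\<close>

lemma mu_U_ergodic:
  assumes B: "B \<in> sets path_space" and inv: "\<And>h. shift h -` B \<inter> space path_space = B"
  shows "B \<in> null_sets mu_U \<or> space path_space - B \<in> null_sets mu_U"
proof -
  define C where "C = {w \<in> space path_space. clock_path w \<and> U_map w \<in> B}"
  have "C = {w \<in> space path_space. clock_path w} \<inter> (U_map -` B \<inter> space path_space)"
    by (auto simp: C_def)
  then have C: "C \<in> sets path_space"
    using sets.Int[OF sets_clock_path measurable_sets[OF U_map_measurable B]] by (simp only:)
  have invB: "shift h u \<in> B \<longleftrightarrow> u \<in> B" if "u \<in> space path_space" for h u
    using inv[of h] that by blast
  have "rebase 1 w \<in> C \<longleftrightarrow> w \<in> C" if w: "w \<in> space path_space" for w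
  proof -
    have r: "rebase 1 w \<in> space path_space" by (rule measurable_space[OF rebase_measurable w])
    have "clock_path (rebase 1 w) \<longleftrightarrow> clock_path w"
      using w by (intro clock_path_rebase_iff) (simp add: space_path_space)
    moreover have "U_map (rebase 1 w) \<in> B \<longleftrightarrow> U_map w \<in> B" if "clock_path w"
      using invB[OF measurable_space[OF U_map_measurable w]] U_map_rebase[OF that, of 1] by simp
    ultimately show ?thesis using w r unfolding C_def by blast
  qed
  then have "rebase 1 -` C \<inter> space W = C"
    using sets.sets_into_space[OF C] unfolding space_W by blast
  then have "E.prob C = 0 \<or> E.prob C = 1" using C by (intro E.ergodic) (simp add: sets_W)
  then show ?thesis
  proof
    assume "E.prob C = 0"
    then have ae: "AE w in W. w \<notin> C" using C by (subst (asm) E.prob_eq_0) (simp_all add: sets_W)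
    have "(\<integral>\<^sup>+w. ennreal (1 / V_path w 0) * indicator B (U_map w) \<partial>W) = (\<integral>\<^sup>+w. 0 \<partial>W)"
    proof (rule nn_integral_cong_AE)
      show "AE w in W. ennreal (1 / V_path w 0) * indicator B (U_map w) = 0"
        using ae W_clock_path AE_space
        by eventually_elim (simp add: C_def space_W)
    qed
    then have "emeasure mu_U B = 0" by (simp add: emeasure_mu_U[OF B])
    then show ?thesis using B by (simp add: null_sets_def sets_mu_U)
  next
    assume "E.prob C = 1"
    then have ae: "AE w in W. w \<in> C" using C by (subst (asm) E.prob_eq_1) (simp_all add: sets_W)
    have B': "space path_space - B \<in> sets path_space" using B by auto
    have "(\<integral>\<^sup>+w. ennreal (1 / V_path w 0) * indicator (space path_space - B) (U_map w) \<partial>W) = (\<integral>\<^sup>+w. 0 \<partial>W)"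
    proof (rule nn_integral_cong_AE)
      show "AE w in W. ennreal (1 / V_path w 0) * indicator (space path_space - B) (U_map w) = 0"
        using ae by eventually_elim (simp add: C_def)
    qed
    then have "emeasure mu_U (space path_space - B) = 0" by (simp add: emeasure_mu_U[OF B'])
    then show ?thesis using B' by (simp add: null_sets_def sets_mu_U)
  qed
qed

section \<open>The measure Q and the marginal\<close>

lemma V_tilde_eq: "V_tilde \<xi> \<eta> t \<omega> = V_path (X \<omega>) t"
  by (simp add: V_tilde_def V_path_def I_tilde_def past_exp_def X_def)

lemma A_clock_eq: "A_clock \<xi> \<eta> t \<omega> = A_path (X \<omega>) t"
  by (simp add: A_clock_def A_path_def V_tilde_eq)

lemma U_tilde_eq: "U_tilde \<xi> \<eta> t \<omega> = U_path (X \<omega>) t"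
  by (simp add: U_tilde_def U_path_def T_clock_def T_path_def V_tilde_eq A_clock_eq)

definition Q :: "'a measure" where "Q = Q_measure M \<xi> \<eta>"

lemma Q_eq: "Q = density M (\<lambda>\<omega>. ennreal (1 / V_path (X \<omega>) 0))"
  by (simp add: Q_def Q_measure_def V_tilde_eq)

lemma sets_Q: "sets Q = sets M" and space_Q: "space Q = space M"
  by (simp_all add: Q_eq)

lemma measurable_Q: "measurable Q N = measurable M N"
  by (rule measurable_cong_sets) (simp_all add: sets_Q)

lemma density_measurable: "(\<lambda>\<omega>. ennreal (1 / V_path (X \<omega>) 0)) \<in> borel_measurable M"
  using measurable_compose[OF X_measurable V_path_measurable_path[of 0]] by measurable

lemma AE_Q_iff: "(AE \<omega> in Q. P \<omega>) \<longleftrightarrow> (AE \<omega> in M. P \<omega>)"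
proof -
  have pos: "AE \<omega> in M. 0 < ennreal (1 / V_path (X \<omega>) 0)"
    using X_clock_path
  proof eventually_elim
    case (elim \<omega>)
    then interpret clock_path "X \<omega>" .
    show ?case using V_path_pos[of 0] by simp
  qed
  have "(AE \<omega> in Q. P \<omega>) \<longleftrightarrow> (AE \<omega> in M. 0 < ennreal (1 / V_path (X \<omega>) 0) \<longrightarrow> P \<omega>)"
    unfolding Q_eq by (rule AE_density[OF density_measurable])
  also have "\<dots> \<longleftrightarrow> (AE \<omega> in M. P \<omega>)"
  proof
    assume "AE \<omega> in M. 0 < ennreal (1 / V_path (X \<omega>) 0) \<longrightarrow> P \<omega>"
    with pos show "AE \<omega> in M. P \<omega>" by eventually_elim blast
  next
    assume "AE \<omega> in M. P \<omega>"
    then show "AE \<omega> in M. 0 < ennreal (1 / V_path (X \<omega>) 0) \<longrightarrow> P \<omega>" by eventually_elim blast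
  qed
  finally show ?thesis .
qed

lemma nn_integral_Q:
  "F \<in> borel_measurable M \<Longrightarrow> (\<integral>\<^sup>+\<omega>. F \<omega> \<partial>Q) = (\<integral>\<^sup>+\<omega>. ennreal (1 / V_path (X \<omega>) 0) * F \<omega> \<partial>M)"
  unfolding Q_eq by (rule nn_integral_density[OF density_measurable])

lemma nn_integral_Q_path:
  assumes F: "F \<in> borel_measurable path_space"
  shows "(\<integral>\<^sup>+\<omega>. F (U_map (X \<omega>)) \<partial>Q) = (\<integral>\<^sup>+u. F u \<partial>mu_U)"
proof -
  have FU: "(\<lambda>w. F (U_map w)) \<in> borel_measurable path_space" by (rule measurable_compose[OF U_map_measurable F])
  have "(\<integral>\<^sup>+\<omega>. F (U_map (X \<omega>)) \<partial>Q) = (\<integral>\<^sup>+\<omega>. ennreal (1 / V_path (X \<omega>) 0) * F (U_map (X \<omega>)) \<partial>M)"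
    by (rule nn_integral_Q[OF measurable_compose[OF X_measurable FU]])
  also have "\<dots> = (\<integral>\<^sup>+w. ennreal (1 / V_path w 0) * F (U_map w) \<partial>W)"
    by (rule nn_integral_W[symmetric], rule borel_measurable_times_ennreal[OF _ FU])
       (use speed_measurable in \<open>simp add: measurable_W\<close>)
  also have "\<dots> = (\<integral>\<^sup>+u. F u \<partial>mu_U)" by (rule nn_integral_mu_U[OF F, symmetric])
  finally show ?thesis .
qed

lemma UX_measurable: "(\<lambda>\<omega>. U_map (X \<omega>)) \<in> Q \<rightarrow>\<^sub>M path_space"
  unfolding measurable_Q by (rule measurable_compose[OF X_measurable U_map_measurable])

lemma distr_Q_U_map: "distr Q path_space (\<lambda>\<omega>. U_map (X \<omega>)) = mu_U"
proof (rule measure_eqI)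
  fix B assume "B \<in> sets (distr Q path_space (\<lambda>\<omega>. U_map (X \<omega>)))"
  then have B: "B \<in> sets path_space" by simp
  have "emeasure (distr Q path_space (\<lambda>\<omega>. U_map (X \<omega>))) B = (\<integral>\<^sup>+u. indicator B u \<partial>distr Q path_space (\<lambda>\<omega>. U_map (X \<omega>)))"
    using B by simp
  also have "\<dots> = (\<integral>\<^sup>+\<omega>. indicator B (U_map (X \<omega>)) \<partial>Q)"
    by (subst nn_integral_distr[OF UX_measurable]) (use B in simp_all)
  also have "\<dots> = (\<integral>\<^sup>+u. indicator B u \<partial>mu_U)" by (rule nn_integral_Q_path) (use B in simp)
  also have "\<dots> = emeasure mu_U B" using B by (simp add: sets_mu_U)
  finally show "emeasure (distr Q path_space (\<lambda>\<omega>. U_map (X \<omega>))) B = emeasure mu_U B" .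
qed (simp add: sets_mu_U)

lemma U_tilde_AE: "AE \<omega> in Q. (\<lambda>t. U_tilde \<xi> \<eta> t \<omega>) = U_map (X \<omega>)"
  unfolding AE_Q_iff using X_clock_path by eventually_elim (simp add: U_tilde_eq U_map_def fun_eq_iff)

lemma path_law_U_tilde: "path_law Q (U_tilde \<xi> \<eta>) = mu_U"
  using path_law_eq_distr[OF UX_measurable U_tilde_AE] by (simp add: distr_Q_U_map)

lemma U_tilde_measurable: "U_tilde \<xi> \<eta> t \<in> borel_measurable Q"
proof -
  have "(\<lambda>\<omega>. U_path (X \<omega>) t) \<in> borel_measurable M" by (rule measurable_compose[OF X_measurable U_path_measurable_path])
  then show ?thesis by (simp add: measurable_Q U_tilde_eq[abs_def])
qed

lemma cadlag_process_U_tilde: "cadlag_process Q (U_tilde \<xi> \<eta>)"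
  unfolding cadlag_process_def
proof
  show "\<forall>t. U_tilde \<xi> \<eta> t \<in> borel_measurable Q" using U_tilde_measurable by blast
  show "AE \<omega> in Q. cadlag_on UNIV (\<lambda>t. U_tilde \<xi> \<eta> t \<omega>)"
    using U_tilde_AE AE_space
  proof eventually_elim
    case (elim \<omega>)
    have "U_map (X \<omega>) \<in> space path_space" by (rule measurable_space[OF UX_measurable elim(2)])
    then show ?case using elim(1) by (simp add: space_path_space)
  qed
qed

lemma stationary_U_tilde: "stationary_process Q (U_tilde \<xi> \<eta>)"
  by (simp add: stationary_process_def cadlag_process_U_tilde path_law_U_tilde distr_mu_U_shift)

lemma ergodic_U_tilde: "ergodic_process Q (U_tilde \<xi> \<eta>)"
  using mu_U_ergodic by (simp add: ergodic_process_def cadlag_process_U_tilde path_law_U_tilde)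

text \<open>For almost every sample point the left limits of \<open>\<eta>\<close> differ from \<open>\<eta>\<close> only on a Lebesgue
  null set, so that the exponential functional of \<open>\<eta>\<close> is the value of \<open>V\<close> at time \<open>0\<close>.\<close>

lemma eta_jointly_measurable: "(\<lambda>p. \<eta> (max (snd p) 0) (fst p)) \<in> borel_measurable (M \<Otimes>\<^sub>M borel)"
proof -
  have "(\<lambda>p. \<eta> (max (fst p) 0) (snd p)) \<in> borel_measurable (borel \<Otimes>\<^sub>M M)"
  proof (rule right_continuous_jointly_measurable[where Z = "\<lambda>t. \<eta> (max t 0)"])
    show "\<eta> (max t 0) \<in> borel_measurable M" for t by (rule eta_measurable) simp
    show "((\<lambda>s. \<eta> (max s 0) \<omega>) \<longlongrightarrow> \<eta> (max t 0) \<omega>) (at_right t)" if "\<omega> \<in> space M" for \<omega> t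
    proof (cases "0 \<le> t")
      case True
      have "eventually (\<lambda>s. \<eta> s \<omega> = \<eta> (max s 0) \<omega>) (at_right t)"
        unfolding eventually_at_filter using True by (intro always_eventually) (simp add: max_def)
      moreover have "((\<lambda>s. \<eta> s \<omega>) \<longlongrightarrow> \<eta> t \<omega>) (at_right t)"
        using eta_cadlag[OF that] True by (simp add: cadlag_on_half_line_iff)
      ultimately show ?thesis using True tendsto_cong by (metis max.absorb1)
    next
      case False
      have "eventually (\<lambda>s. \<eta> (max s 0) \<omega> = \<eta> (max t 0) \<omega>) (at_right t)"
        unfolding eventually_at_right[of t 0] using False by (subst eventually_at_right[of t 0]) (auto intro!: exI[of _ 0] simp: max_def)
      then show ?thesis by (rule tendsto_eventually)
    qed
  qed
  from measurable_compose[OF measurable_pair_swap' this] show ?thesis by (simp add: split_beta')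
qed

lemma I_hat_eq: "AE \<omega> in M. I_hat \<eta> \<omega> = V_path (X \<omega>) 0"
proof -
  interpret P: pair_sigma_finite M lborel ..
  have eta_neg: "(\<lambda>p. \<eta> (max (- snd p) 0) (fst p)) \<in> borel_measurable (M \<Otimes>\<^sub>M lborel)"
  proof -
    have "(\<lambda>p. (fst p, - snd p)) \<in> M \<Otimes>\<^sub>M lborel \<rightarrow>\<^sub>M M \<Otimes>\<^sub>M (borel :: real measure)" by measurable
    from measurable_compose[OF this eta_jointly_measurable] show ?thesis by simp
  qed
  have X_joint: "(\<lambda>p. X (fst p) (snd p)) \<in> borel_measurable (M \<Otimes>\<^sub>M lborel)"
    by (rule eval_jointly_measurable[where Z = "\<lambda>p. X (fst p)"]) (use X_measurable in measurable)
  have "AE \<omega> in M. AE s in lborel. s < 0 \<longrightarrow> X \<omega> s = \<eta> (max (- s) 0) \<omega>"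
  proof (subst P.AE_commute)
    have "{p \<in> space (M \<Otimes>\<^sub>M lborel). snd p < 0 \<longrightarrow> X (fst p) (snd p) = \<eta> (max (- snd p) 0) (fst p)} \<in> sets (M \<Otimes>\<^sub>M lborel)"
      using eta_neg X_joint by measurable
    then show "{p \<in> space (M \<Otimes>\<^sub>M lborel). snd p < 0 \<longrightarrow> X (fst p) (snd p) = \<eta> (max (- snd p) 0) (fst p)} \<in> sets (M \<Otimes>\<^sub>M lborel)" .
    show "AE s in lborel. AE \<omega> in M. s < 0 \<longrightarrow> X \<omega> s = \<eta> (max (- s) 0) \<omega>"
    proof (rule AE_I2)
      fix s :: real
      show "AE \<omega> in M. s < 0 \<longrightarrow> X \<omega> s = \<eta> (max (- s) 0) \<omega>"
      proof (cases "s < 0")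
        case True
        from X_neg[OF True] show ?thesis using True by (simp add: max_def)
      qed simp
    qed
  qed
  then show ?thesis
    using xi_0 AE_space
  proof eventually_elim
    case (elim \<omega>)
    have X0: "X \<omega> 0 = 0" using elim(2) by (simp add: X_nonneg)
    have [measurable]: "X \<omega> \<in> borel_measurable borel"
      by (rule cadlag_borel_measurable) (use X_space[OF elim(3)] in \<open>simp add: space_path_space\<close>)
    have [measurable]: "(\<lambda>s. \<eta> (max s 0) \<omega>) \<in> borel_measurable borel"
      using measurable_compose[OF measurable_Pair1'[OF elim(3)] eta_jointly_measurable] by simp
    have "I_hat \<eta> \<omega> = (LINT s|lborel. indicator {0<..} s * exp (\<eta> s \<omega>))"
      unfolding I_hat_def zero_ereal_def interval_integral_to_infinity_eq by (simp add: set_lebesgue_integral_def)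
    also have "\<dots> = (LINT s|lborel. indicator {0<..} s * exp (\<eta> (max s 0) \<omega>))"
      by (intro Bochner_Integration.integral_cong) (auto simp: indicator_def max_def)
    also have "\<dots> = (LINT s|lborel. indicator {0<..} (0 + - 1 * s) * exp (\<eta> (max (0 + - 1 * s) 0) \<omega>))"
      by (subst lborel_integral_real_affine[where c = "- 1" and t = 0]) auto
    also have "\<dots> = (LINT s|lborel. indicator {..<0} s * exp (X \<omega> s))"
    proof (rule integral_cong_AE)
      show "(\<lambda>s. indicator {0<..} (0 + - 1 * s) * exp (\<eta> (max (0 + - 1 * s) 0) \<omega>)) \<in> borel_measurable lborel"
        by measurable
      show "(\<lambda>s. indicator {..<0} s * exp (X \<omega> s)) \<in> borel_measurable lborel" by measurable
      show "AE s in lborel. indicator {0<..} (0 + - 1 * s) * exp (\<eta> (max (0 + - 1 * s) 0) \<omega>) = indicator {..<0} s * exp (X \<omega> s)"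
        using elim(1) by eventually_elim (simp add: indicator_def)
    qed
    also have "\<dots> = V_path (X \<omega>) 0" by (simp add: V_path_def past_exp_eq_integral X0)
    finally show ?case .
  qed
qed

lemma I_hat_measurable: "I_hat \<eta> \<in> borel_measurable M"
proof -
  have "(\<lambda>\<omega>. LINT s|lborel. indicator {0<..} s * exp (\<eta> (max s 0) \<omega>)) \<in> borel_measurable M"
  proof (rule lborel.borel_measurable_lebesgue_integral)
    have [measurable]: "(\<lambda>p. \<eta> (max (snd p) 0) (fst p)) \<in> borel_measurable (M \<Otimes>\<^sub>M lborel)"
      using eta_jointly_measurable by (simp cong: measurable_cong_sets)
    show "(\<lambda>(\<omega>, s). indicator {0<..} s * exp (\<eta> (max s 0) \<omega>)) \<in> borel_measurable (M \<Otimes>\<^sub>M lborel)"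
      unfolding split_beta' by measurable
  qed
  moreover have "I_hat \<eta> \<omega> = (LINT s|lborel. indicator {0<..} s * exp (\<eta> (max s 0) \<omega>))" for \<omega>
  proof -
    have "I_hat \<eta> \<omega> = (LINT s|lborel. indicator {0<..} s * exp (\<eta> s \<omega>))"
      unfolding I_hat_def zero_ereal_def interval_integral_to_infinity_eq by (simp add: set_lebesgue_integral_def)
    also have "\<dots> = (LINT s|lborel. indicator {0<..} s * exp (\<eta> (max s 0) \<omega>))"
      by (intro Bochner_Integration.integral_cong) (auto simp: indicator_def max_def)
    finally show ?thesis .
  qed
  then have "I_hat \<eta> = (\<lambda>\<omega>. LINT s|lborel. indicator {0<..} s * exp (\<eta> (max s 0) \<omega>))" by (rule ext)
  ultimately show ?thesis by (simp only:)
qed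

lemma nn_integral_nu:
  assumes F[measurable]: "F \<in> borel_measurable borel"
  shows "(\<integral>\<^sup>+x. F x \<partial>nu_measure M \<eta>) = (\<integral>\<^sup>+w. ennreal (1 / V_path w 0) * F (1 / V_path w 0) \<partial>W)"
proof -
  have I: "I_hat \<eta> \<in> M \<rightarrow>\<^sub>M borel" by (rule I_hat_measurable)
  have "(\<integral>\<^sup>+x. F x \<partial>nu_measure M \<eta>) = (\<integral>\<^sup>+x. F (1 / x) \<partial>density (mu_law M \<eta>) (\<lambda>x. ennreal (1 / x) * indicator {0<..} x))"
    unfolding nu_measure_def mu_law_def by (subst nn_integral_distr) simp_all
  also have "\<dots> = (\<integral>\<^sup>+x. (ennreal (1 / x) * indicator {0<..} x) * F (1 / x) \<partial>mu_law M \<eta>)"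
    unfolding mu_law_def by (rule nn_integral_density) simp_all
  also have "\<dots> = (\<integral>\<^sup>+\<omega>. (ennreal (1 / I_hat \<eta> \<omega>) * indicator {0<..} (I_hat \<eta> \<omega>)) * F (1 / I_hat \<eta> \<omega>) \<partial>M)"
    unfolding mu_law_def by (subst nn_integral_distr[OF I]) simp_all
  also have "\<dots> = (\<integral>\<^sup>+\<omega>. ennreal (1 / V_path (X \<omega>) 0) * F (1 / V_path (X \<omega>) 0) \<partial>M)"
  proof (rule nn_integral_cong_AE)
    show "AE \<omega> in M. (ennreal (1 / I_hat \<eta> \<omega>) * indicator {0<..} (I_hat \<eta> \<omega>)) * F (1 / I_hat \<eta> \<omega>)
      = ennreal (1 / V_path (X \<omega>) 0) * F (1 / V_path (X \<omega>) 0)"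
      using I_hat_eq X_clock_path
    proof eventually_elim
      case (elim \<omega>)
      then interpret clock_path "X \<omega>" by simp
      show ?case using V_path_pos[of 0] elim(1) by simp
    qed
  qed
  also have "\<dots> = (\<integral>\<^sup>+w. ennreal (1 / V_path w 0) * F (1 / V_path w 0) \<partial>W)"
  proof (rule nn_integral_W[symmetric])
    note [measurable] = V_path_measurable_path[of 0]
    show "(\<lambda>w. ennreal (1 / V_path w 0) * F (1 / V_path w 0)) \<in> borel_measurable path_space" by measurable
  qed
  finally show ?thesis .
qed

lemma distr_U_tilde: "distr Q borel (U_tilde \<xi> \<eta> t) = nu_measure M \<eta>"
proof (rule measure_eqI)
  fix B assume "B \<in> sets (distr Q borel (U_tilde \<xi> \<eta> t))"
  then have B: "B \<in> sets borel" by simp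
  have Bt: "(\<lambda>u. indicator B (u t) :: ennreal) \<in> borel_measurable path_space" for t
    by (rule measurable_compose[OF eval_measurable]) (use B in simp)
  have set: "{u \<in> space path_space. u t \<in> B} \<in> sets path_space" for t
    using measurable_sets[OF eval_measurable B] by (simp add: vimage_def Int_def conj_commute)
  have "emeasure (distr Q borel (U_tilde \<xi> \<eta> t)) B = (\<integral>\<^sup>+x. indicator B x \<partial>distr Q borel (U_tilde \<xi> \<eta> t))"
    using B by simp
  also have "\<dots> = (\<integral>\<^sup>+\<omega>. indicator B (U_tilde \<xi> \<eta> t \<omega>) \<partial>Q)"
    by (subst nn_integral_distr[OF U_tilde_measurable]) (use B in simp_all)
  also have "\<dots> = (\<integral>\<^sup>+\<omega>. indicator B (U_map (X \<omega>) t) \<partial>Q)"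
    using U_tilde_AE by (intro nn_integral_cong_AE) (auto elim!: eventually_mono simp: fun_eq_iff)
  also have "\<dots> = (\<integral>\<^sup>+u. indicator B (u t) \<partial>mu_U)" by (rule nn_integral_Q_path[OF Bt])
  also have "\<dots> = (\<integral>\<^sup>+u. indicator {u \<in> space path_space. u t \<in> B} u \<partial>mu_U)"
    by (intro nn_integral_cong) (simp add: space_mu_U indicator_def)
  also have "\<dots> = emeasure mu_U {u \<in> space path_space. u t \<in> B}" using set by (simp add: sets_mu_U)
  also have "{u \<in> space path_space. u t \<in> B} = shift t -` {u \<in> space path_space. u 0 \<in> B} \<inter> space path_space"
    using measurable_space[OF shift_measurable] by (auto simp: shift_def)
  also have "emeasure mu_U \<dots> = emeasure mu_U {u \<in> space path_space. u 0 \<in> B}" by (rule mu_U_shift[OF set])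
  also have "\<dots> = (\<integral>\<^sup>+w. ennreal (1 / V_path w 0) * indicator {u \<in> space path_space. u 0 \<in> B} (U_map w) \<partial>W)"
    by (rule emeasure_mu_U[OF set])
  also have "\<dots> = (\<integral>\<^sup>+w. ennreal (1 / V_path w 0) * indicator B (1 / V_path w 0) \<partial>W)"
  proof (rule nn_integral_cong_AE)
    show "AE w in W. ennreal (1 / V_path w 0) * indicator {u \<in> space path_space. u 0 \<in> B} (U_map w)
      = ennreal (1 / V_path w 0) * indicator B (1 / V_path w 0)"
      using W_clock_path AE_space
    proof eventually_elim
      case (elim w)
      then interpret clock_path w by simp
      have "U_map w \<in> space path_space" using measurable_space[OF U_map_measurable] elim(2) by (simp add: space_W)
      moreover have "U_map w 0 = 1 / V_path w 0" using elim(1) by (simp add: U_map_def U_path_zero)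
      ultimately show ?case by (simp add: indicator_def)
    qed
  qed
  also have "\<dots> = (\<integral>\<^sup>+x. indicator B x \<partial>nu_measure M \<eta>)" by (rule nn_integral_nu[symmetric]) (use B in simp)
  also have "\<dots> = emeasure (nu_measure M \<eta>) B" using B by (simp add: nu_measure_def)
  finally show "emeasure (distr Q borel (U_tilde \<xi> \<eta> t)) B = emeasure (nu_measure M \<eta>) B" .
qed (simp add: nu_measure_def)

lemma emeasure_Q_space: "emeasure Q (space M) = mass"
proof -
  have "emeasure Q (space M) = (\<integral>\<^sup>+\<omega>. 1 \<partial>Q)" by (simp add: space_Q[symmetric])
  also have "\<dots> = (\<integral>\<^sup>+\<omega>. ennreal (1 / V_path (X \<omega>) 0) * 1 \<partial>M)" by (rule nn_integral_Q) simp
  also have "\<dots> = mass"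
    unfolding mass_def using nn_integral_W[of "\<lambda>w. ennreal (1 / V_path w 0)"] speed_measurable
    by (simp add: measurable_W)
  finally show ?thesis .
qed

lemma emeasure_nu: "emeasure (nu_measure M \<eta>) UNIV = mass" "emeasure (nu_measure M \<eta>) {0<..} = mass"
proof -
  have sets: "sets (nu_measure M \<eta>) = sets borel" by (simp add: nu_measure_def)
  have *: "emeasure (nu_measure M \<eta>) B = mass" if "B \<in> sets borel" "{0<..} \<subseteq> B" for B
  proof -
    have "emeasure (nu_measure M \<eta>) B = (\<integral>\<^sup>+x. indicator B x \<partial>nu_measure M \<eta>)" using that sets by simp
    also have "\<dots> = (\<integral>\<^sup>+w. ennreal (1 / V_path w 0) * indicator B (1 / V_path w 0) \<partial>W)"
      by (rule nn_integral_nu) (use that in simp)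
    also have "\<dots> = mass"
      unfolding mass_def
    proof (rule nn_integral_cong_AE)
      show "AE w in W. ennreal (1 / V_path w 0) * indicator B (1 / V_path w 0) = ennreal (1 / V_path w 0)"
        using W_clock_path
      proof eventually_elim
        case (elim w)
        then interpret clock_path w by simp
        have "1 / V_path w 0 \<in> B" using V_path_pos[of 0] that(2) by auto
        then show ?case by simp
      qed
    qed
    finally show ?thesis .
  qed
  show "emeasure (nu_measure M \<eta>) UNIV = mass" by (rule *) auto
  show "emeasure (nu_measure M \<eta>) {0<..} = mass" by (rule *) auto
qed

lemma mass_finite_iff: "mass < \<infinity> \<longleftrightarrow> integrable M (\<xi> 1)"
proof
  assume "integrable M (\<xi> 1)"
  from mass_eq_mean[OF this] show "mass < \<infinity>"
    unfolding infinity_ennreal_def by (simp only: ennreal_less_top)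
qed (rule integrable_of_finite_mass)

lemma finite_measure_Q_iff: "finite_measure Q \<longleftrightarrow> integrable M (\<xi> 1)"
proof -
  have "finite_measure Q \<longleftrightarrow> emeasure Q (space Q) < \<infinity>"
    using finite_measure.emeasure_finite[of Q "space Q"] by (auto intro!: finite_measureI simp: less_top)
  then show ?thesis by (simp add: space_Q emeasure_Q_space mass_finite_iff[symmetric])
qed

lemma finite_measure_nu_iff: "finite_measure (nu_measure M \<eta>) \<longleftrightarrow> integrable M (\<xi> 1)"
proof -
  have space: "space (nu_measure M \<eta>) = UNIV" by (simp add: nu_measure_def)
  have "finite_measure (nu_measure M \<eta>) \<longleftrightarrow> emeasure (nu_measure M \<eta>) (space (nu_measure M \<eta>)) < \<infinity>"
    using finite_measure.emeasure_finite[of "nu_measure M \<eta>" "space (nu_measure M \<eta>)"] by (auto intro!: finite_measureI simp: less_top)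
  then show ?thesis by (simp add: space emeasure_nu mass_finite_iff[symmetric])
qed

section \<open>The ratio limit theorem\<close>

text \<open>The integral of \<open>f\<close> along the time-changed path, expressed in original time.\<close>

definition occupation :: "(real \<Rightarrow> real) \<Rightarrow> (real \<Rightarrow> real) \<Rightarrow> real \<Rightarrow> ennreal" where
  "occupation f w t = (\<integral>\<^sup>+s. ennreal (1 / V_path w s) * ennreal (f (1 / V_path w s)) * indicator {0<..t} s \<partial>lborel)"

text \<open>Up to an integer time the occupation is an orbit sum of the flow over unit time, to which the theorem of
  Birkhoff applies; it is monotone in between.\<close>

lemma occupation_limit:
  assumes f[measurable]: "f \<in> borel_measurable borel"
    and fin: "(\<integral>\<^sup>+x. ennreal (f x) \<partial>nu_measure M \<eta>) < \<infinity>"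
  shows "AE w in W. (\<forall>t. occupation f w t < \<infinity>) \<and>
    ((\<lambda>t. enn2real (occupation f w t) / t) \<longlongrightarrow> enn2real (\<integral>\<^sup>+x. ennreal (f x) \<partial>nu_measure M \<eta>)) at_top"
proof -
  interpret P: pair_sigma_finite W lborel ..
  let ?C = "\<integral>\<^sup>+x. ennreal (f x) \<partial>nu_measure M \<eta>"
  define \<phi> where "\<phi> w s = ennreal (1 / V_path w s) * ennreal (f (1 / V_path w s))" for w s
  have joint: "(\<lambda>p. \<phi> (fst p) (snd p)) \<in> borel_measurable (path_space \<Otimes>\<^sub>M lborel)"
  proof -
    have [measurable]: "(\<lambda>p. V_path (fst p) (snd p)) \<in> borel_measurable (path_space \<Otimes>\<^sub>M lborel)"
      by (rule V_path_measurable) measurable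
    show ?thesis unfolding \<phi>_def by measurable
  qed
  have m1: "(\<lambda>w. \<phi> w s) \<in> borel_measurable path_space" for s
    using V_path_measurable_path[of s] unfolding \<phi>_def by measurable
  have m2: "\<phi> w \<in> borel_measurable lborel" if "w \<in> space path_space" for w
    using measurable_compose[OF measurable_Pair1'[OF that] joint] by simp
  define F where "F w = occupation f w 1" for w
  have F_alt: "F w = (\<integral>\<^sup>+s. \<phi> w s * indicator {0<..1} s \<partial>lborel)" for w
    by (simp add: F_def occupation_def \<phi>_def)
  have Fm: "F \<in> borel_measurable path_space"
    unfolding F_alt[abs_def]
    by (rule lborel.borel_measurable_nn_integral) (use joint in \<open>simp add: split_beta'\<close>)
  have "(\<integral>\<^sup>+w. F w \<partial>W) = (\<integral>\<^sup>+s. \<integral>\<^sup>+w. \<phi> w s * indicator {0<..1} s \<partial>W \<partial>lborel)"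
    unfolding F_alt
  proof (rule P.Fubini'[symmetric])
    have "sets (W \<Otimes>\<^sub>M lborel) = sets (path_space \<Otimes>\<^sub>M lborel)" by (intro sets_pair_measure_cong sets_W refl)
    then have "(\<lambda>p. \<phi> (fst p) (snd p)) \<in> borel_measurable (W \<Otimes>\<^sub>M lborel)"
      using joint measurable_cong_sets by blast
    then show "(\<lambda>(w, s). \<phi> w s * indicator {0<..1} s) \<in> borel_measurable (W \<Otimes>\<^sub>M lborel)"
      by (simp add: split_beta')
  qed
  also have "\<dots> = (\<integral>\<^sup>+s. ?C * indicator {0<..1 :: real} s \<partial>lborel)"
  proof (rule nn_integral_cong)
    fix s :: real
    have "(\<integral>\<^sup>+w. \<phi> w s * indicator {0<..1} s \<partial>W) = (\<integral>\<^sup>+w. \<phi> w s \<partial>W) * indicator {0<..1} s"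
      by (rule nn_integral_multc) (use m1 in \<open>simp add: measurable_W\<close>)
    also have "(\<integral>\<^sup>+w. \<phi> w s \<partial>W) = (\<integral>\<^sup>+w. \<phi> (rebase s w) 0 \<partial>W)" by (simp add: \<phi>_def V_path_rebase)
    also have "\<dots> = (\<integral>\<^sup>+w. \<phi> w 0 \<partial>W)" by (rule nn_integral_rebase[OF m1])
    also have "\<dots> = ?C" unfolding \<phi>_def by (rule nn_integral_nu[symmetric]) measurable
    finally show "(\<integral>\<^sup>+w. \<phi> w s * indicator {0<..1} s \<partial>W) = ?C * indicator {0<..1} s" .
  qed
  also have "\<dots> = ?C" by (simp add: nn_integral_cmult_indicator)
  finally have F_int: "(\<integral>\<^sup>+w. F w \<partial>W) = ?C" .
  have F_fin: "AE w in W. F w \<noteq> \<infinity>"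
    by (rule nn_integral_noteq_infinite) (use F_int fin Fm in \<open>auto simp: measurable_W less_top\<close>)
  define Fr where "Fr w = enn2real (F w)" for w
  have Frm: "Fr \<in> borel_measurable W" unfolding Fr_def measurable_W using Fm by measurable
  have Fr_nn: "(\<integral>\<^sup>+w. ennreal (Fr w) \<partial>W) = ?C"
    unfolding F_int[symmetric]
    by (rule nn_integral_cong_AE) (use F_fin in \<open>auto elim!: eventually_mono simp: Fr_def less_top ennreal_enn2real_if\<close>)
  have Fr: "integrable W Fr"
    by (rule integrableI_nonneg[OF Frm]) (use Fr_nn fin in \<open>auto intro!: AE_I2 simp: Fr_def\<close>)
  have Fr_int: "(\<integral>w. Fr w \<partial>W) = enn2real ?C"
  proof -
    have "AE w in W. 0 \<le> Fr w" by (simp add: Fr_def)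
    from integral_eq_nn_integral[OF Frm this] show ?thesis unfolding Fr_nn .
  qed
  have bir: "AE w in W. (\<lambda>n. orbit_sum (rebase 1) Fr n w / real n) \<longlonglongrightarrow> enn2real ?C"
    using E.birkhoff[OF Fr] unfolding Fr_int .
  have all_fin: "AE w in W. \<forall>k. F ((rebase 1 ^^ k) w) \<noteq> \<infinity>"
    unfolding AE_all_countable by (intro allI E.AE_funpow F_fin)
  from bir all_fin AE_space show ?thesis
  proof eventually_elim
    case (elim w)
    have w: "w \<in> space path_space" using elim(3) by (simp add: space_W)
    note [measurable] = m2[OF w]
    have occ: "occupation f w t = (\<integral>\<^sup>+s. \<phi> w s * indicator {0<..t} s \<partial>lborel)" for t
      by (simp add: occupation_def \<phi>_def)
    have F_k: "F ((rebase 1 ^^ k) w) = (\<integral>\<^sup>+s. \<phi> w s * indicator {real k<..real (Suc k)} s \<partial>lborel)" for k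
    proof -
      have "F ((rebase 1 ^^ k) w) = (\<integral>\<^sup>+s. \<phi> w (real k + 1 * s) * indicator {real k<..real (Suc k)} (real k + 1 * s) \<partial>lborel)"
        unfolding F_alt by (intro nn_integral_cong) (auto simp: \<phi>_def V_path_funpow_rebase indicator_def)
      also have "\<dots> = (\<integral>\<^sup>+s. \<phi> w s * indicator {real k<..real (Suc k)} s \<partial>lborel)"
        using nn_integral_real_affine[of "\<lambda>s. \<phi> w s * indicator {real k<..real (Suc k)} s" 1 "real k"] m2[OF w] by simp
      finally show ?thesis .
    qed
    have step: "occupation f w (real (Suc n)) = occupation f w (real n) + F ((rebase 1 ^^ n) w)" for n
    proof -
      have "occupation f w (real (Suc n)) = (\<integral>\<^sup>+s. \<phi> w s * indicator {0<..real n} s + \<phi> w s * indicator {real n<..real (Suc n)} s \<partial>lborel)"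
        unfolding occ by (intro nn_integral_cong) (auto simp: indicator_def)
      also have "\<dots> = occupation f w (real n) + F ((rebase 1 ^^ n) w)"
        unfolding occ F_k by (rule nn_integral_add) measurable
      finally show ?thesis .
    qed
    have nat_fin: "occupation f w (real n) < \<infinity> \<and> enn2real (occupation f w (real n)) = orbit_sum (rebase 1) Fr n w" for n
    proof (induction n)
      case 0
      then show ?case by (simp add: occ)
    next
      case (Suc n)
      have Fn: "F ((rebase 1 ^^ n) w) < \<infinity>" using elim(2) by (simp add: less_top)
      have "enn2real (occupation f w (real (Suc n))) = enn2real (occupation f w (real n)) + Fr ((rebase 1 ^^ n) w)"
        unfolding step Fr_def using Suc Fn by (intro enn2real_plus) auto
      then show ?case
        using Suc Fn by (simp only: step) (simp add: orbit_sum_eq_sum)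
    qed
    have mono: "occupation f w s \<le> occupation f w t" if "s \<le> t" for s t
      unfolding occ using that by (intro nn_integral_mono mult_left_mono) (auto simp: indicator_def)
    have all: "occupation f w t < \<infinity>" for t
    proof -
      obtain n :: nat where "t \<le> real n" using real_arch_simple by blast
      from mono[OF this] nat_fin[of n] show ?thesis by (meson le_less_trans)
    qed
    have "((\<lambda>t. enn2real (occupation f w t) / t) \<longlongrightarrow> enn2real ?C) at_top"
    proof (rule tendsto_over_real_of_nat[OF elim(1)])
      show "enn2real (occupation f w s) \<le> enn2real (occupation f w t)" if "s \<le> t" for s t
        using mono[OF that] all[of t] by (intro enn2real_mono) auto
    qed (use nat_fin in auto)
    then show ?case using all by blast
  qed
qed

lemma nn_integral_U_path:
  assumes w: "clock_path w" and [measurable]: "f \<in> borel_measurable borel" and t: "0 \<le> t"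
  shows "(\<integral>\<^sup>+s. ennreal (f (U_path w s)) * indicator {0<..t} s \<partial>lborel) = occupation f w (T_path w t)"
proof -
  interpret clock_path w by fact
  have [measurable]: "U_path w \<in> borel_measurable borel" by (rule cadlag_borel_measurable[OF cadlag_U_path])
  have ind: "indicator {0<..t} (A_path w s) = (indicator {0<..T_path w t} s :: ennreal)" for s
  proof -
    have "0 < A_path w s \<longleftrightarrow> 0 < s" using strict_mono_less[OF A_path_strict_mono, of 0 s] by simp
    moreover have "A_path w s \<le> t \<longleftrightarrow> s \<le> T_path w t"
      using strict_mono_less_eq[OF A_path_strict_mono, of s "T_path w t"] by simp
    ultimately show ?thesis by (simp add: indicator_def)
  qed
  have "(\<integral>\<^sup>+s. ennreal (f (U_path w s)) * indicator {0<..t} s \<partial>lborel)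
    = (\<integral>\<^sup>+s. ennreal (1 / V_path w s) * (ennreal (f (U_path w (A_path w s))) * indicator {0<..t} (A_path w s)) \<partial>lborel)"
    by (rule nn_integral_A_path[symmetric]) measurable
  also have "\<dots> = occupation f w (T_path w t)"
    unfolding occupation_def ind U_path_A_path by (simp add: mult.assoc)
  finally show ?thesis .
qed

lemma time_average:
  fixes f :: "real \<Rightarrow> real"
  assumes f: "integrable (nu_measure M \<eta>) f"
  shows "AE w in W. ((\<lambda>t. (LBINT s=0..ereal t. f (U_path w s)) / T_path w t) \<longlongrightarrow> (\<integral>x. f x \<partial>nu_measure M \<eta>)) at_top"
proof -
  have fm[measurable]: "f \<in> borel_measurable borel"
    using borel_measurable_integrable[OF f] by (simp add: nu_measure_def cong: measurable_cong_sets)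
  have finp: "(\<integral>\<^sup>+x. ennreal (f x) \<partial>nu_measure M \<eta>) < \<infinity>" and finm: "(\<integral>\<^sup>+x. ennreal (- f x) \<partial>nu_measure M \<eta>) < \<infinity>"
    using f by (simp_all add: real_integrable_def less_top)
  have int: "(\<integral>x. f x \<partial>nu_measure M \<eta>) = enn2real (\<integral>\<^sup>+x. ennreal (f x) \<partial>nu_measure M \<eta>) - enn2real (\<integral>\<^sup>+x. ennreal (- f x) \<partial>nu_measure M \<eta>)"
    by (rule real_lebesgue_integral_def[OF f])
  have fm': "(\<lambda>x. - f x) \<in> borel_measurable borel" by measurable
  from occupation_limit[OF fm finp] occupation_limit[OF fm' finm] W_clock_path show ?thesis
  proof eventually_elim
    case (elim w)
    interpret clock_path w by (rule elim(3))
    have [measurable]: "U_path w \<in> borel_measurable borel" by (rule cadlag_borel_measurable[OF cadlag_U_path])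
    let ?op = "occupation f w" and ?om = "occupation (\<lambda>x. - f x) w"
    have lb: "(LBINT s=0..ereal t. f (U_path w s)) = enn2real (?op (T_path w t)) - enn2real (?om (T_path w t))" if t: "0 \<le> t" for t
    proof -
      let ?g = "\<lambda>s. indicator {0<..t} s *\<^sub>R f (U_path w s)"
      have p: "(\<integral>\<^sup>+s. ennreal (?g s) \<partial>lborel) = ?op (T_path w t)"
        unfolding nn_integral_U_path[OF elim(3) fm t, symmetric] by (intro nn_integral_cong) (simp add: indicator_def)
      have m: "(\<integral>\<^sup>+s. ennreal (- ?g s) \<partial>lborel) = ?om (T_path w t)"
        unfolding nn_integral_U_path[OF elim(3) fm' t, symmetric] by (intro nn_integral_cong) (simp add: indicator_def)
      have gm: "?g \<in> borel_measurable lborel" by measurable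
      have "integrable lborel ?g"
        unfolding real_integrable_def p m using gm elim(1,2) by (simp add: less_top)
      from real_lebesgue_integral_def[OF this]
      have "(LINT s|lborel. ?g s) = enn2real (?op (T_path w t)) - enn2real (?om (T_path w t))" unfolding p m .
      moreover have "(LBINT s=0..ereal t. f (U_path w s)) = (LINT s:{0<..t}|lborel. f (U_path w s))"
        unfolding zero_ereal_def by (rule interval_integral_Ioc[OF t])
      ultimately show ?thesis by (simp add: set_lebesgue_integral_def)
    qed
    have "((\<lambda>t. enn2real (?op (T_path w t)) / T_path w t - enn2real (?om (T_path w t)) / T_path w t) \<longlongrightarrow> (\<integral>x. f x \<partial>nu_measure M \<eta>)) at_top"
      unfolding int
      by (intro tendsto_diff filterlim_compose[OF conjunct2[OF elim(1)] T_path_at_top] filterlim_compose[OF conjunct2[OF elim(2)] T_path_at_top])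
    moreover have "eventually (\<lambda>t. enn2real (?op (T_path w t)) / T_path w t - enn2real (?om (T_path w t)) / T_path w t
        = (LBINT s=0..ereal t. f (U_path w s)) / T_path w t) at_top"
      using eventually_ge_at_top[of 0] by eventually_elim (simp add: lb diff_divide_distrib)
    ultimately show ?case by (rule Lim_transform_eventually)
  qed
qed

theorem ratio_limit:
  fixes f g :: "real \<Rightarrow> real"
  assumes f: "integrable (nu_measure M \<eta>) f" and g: "integrable (nu_measure M \<eta>) g" and nz: "(\<integral>x. g x \<partial>nu_measure M \<eta>) \<noteq> 0"
  shows "AE \<omega> in M. ((\<lambda>t. (LBINT s=0..ereal t. f (U_tilde \<xi> \<eta> s \<omega>)) / (LBINT s=0..ereal t. g (U_tilde \<xi> \<eta> s \<omega>)))
    \<longlongrightarrow> (\<integral>x. f x \<partial>nu_measure M \<eta>) / (\<integral>x. g x \<partial>nu_measure M \<eta>)) at_top"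
proof -
  have "AE w in W. ((\<lambda>t. (LBINT s=0..ereal t. f (U_path w s)) / (LBINT s=0..ereal t. g (U_path w s)))
    \<longlongrightarrow> (\<integral>x. f x \<partial>nu_measure M \<eta>) / (\<integral>x. g x \<partial>nu_measure M \<eta>)) at_top"
    using time_average[OF f] time_average[OF g] W_clock_path
  proof eventually_elim
    case (elim w)
    interpret clock_path w by (rule elim(3))
    have "eventually (\<lambda>t. ((LBINT s=0..ereal t. f (U_path w s)) / T_path w t) / ((LBINT s=0..ereal t. g (U_path w s)) / T_path w t)
      = (LBINT s=0..ereal t. f (U_path w s)) / (LBINT s=0..ereal t. g (U_path w s))) at_top"
      using eventually_gt_at_top[of 0]
    proof eventually_elim
      case (elim t)
      then have "0 < T_path w t" using T_path_less_iff[of 0 t] by simp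
      then show ?case by simp
    qed
    then show ?case by (rule Lim_transform_eventually[OF tendsto_divide[OF elim(1,2) nz]])
  qed
  from AE_distrD[OF X_measurable this[unfolded W_def]] show ?thesis by (simp add: U_tilde_eq)
qed

section \<open>The Markov property\<close>

text \<open>An auxiliary path with a deterministic past whose value of \<open>V\<close> at time \<open>0\<close> is \<open>1 / x\<close>. It represents the
  Ornstein-Uhlenbeck type process started from \<open>x\<close> as a functional that is jointly measurable
  in \<open>x\<close> and the sample point.\<close>

definition glue :: "real \<times> 'a \<Rightarrow> real \<Rightarrow> real" where
  "glue p t = xi_tilde (\<lambda>s p. \<xi> s (snd p)) (\<lambda>s p. - s - ln (fst p)) t p"

lemma glue_nonneg: "0 \<le> t \<Longrightarrow> glue p t = \<xi> t (snd p)"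
  by (simp add: glue_def xi_tilde_def)

lemma glue_neg: "t < 0 \<Longrightarrow> glue p t = t - ln (fst p)"
proof -
  assume t: "t < 0"
  have "((\<lambda>s. - s - ln (fst p)) \<longlongrightarrow> - (- t) - ln (fst p)) (at_left (- t))" by (intro tendsto_intros)
  then have "Lim (at_left (- t)) (\<lambda>s. - s - ln (fst p)) = - (- t) - ln (fst p)"
    by (intro tendsto_Lim) auto
  then show ?thesis using t by (simp add: glue_def xi_tilde_def)
qed

lemma glue_measurable: "glue \<in> borel \<Otimes>\<^sub>M Fxi \<rightarrow>\<^sub>M path_space"
proof -
  have "(\<lambda>p t. xi_tilde (\<lambda>s p. \<xi> s (snd p)) (\<lambda>s p. - s - ln (fst p)) t p) \<in> borel \<Otimes>\<^sub>M Fxi \<rightarrow>\<^sub>M path_space"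
  proof (rule xi_tilde_measurable)
    show "(\<lambda>p. \<xi> t (snd p)) \<in> borel_measurable (borel \<Otimes>\<^sub>M Fxi)" if "0 \<le> t" for t
      by (rule measurable_compose[OF measurable_snd xi_measurable_Fxi[OF that]])
    show "cadlag_on {0..} (\<lambda>t. \<xi> t (snd p))" if "p \<in> space (borel \<Otimes>\<^sub>M Fxi)" for p :: "real \<times> 'a"
      using that by (intro xi_cadlag) (auto simp: space_pair_measure)
    show "(\<lambda>p::real \<times> 'a. - t - ln (fst p)) \<in> borel_measurable (borel \<Otimes>\<^sub>M Fxi)" for t by measurable
    show "cadlag_on {0..} (\<lambda>t. - t - ln (fst p))" for p :: "real \<times> 'a"
      unfolding cadlag_on_half_line_iff by (auto intro!: tendsto_intros exI)
  qed
  then show ?thesis by (simp add: glue_def[abs_def])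
qed

lemma glue_clock_path:
  assumes x: "0 < x" and \<omega>: "\<omega> \<in> space M" and lim: "filterlim (\<lambda>t. \<xi> t \<omega>) at_top at_top"
  shows "clock_path (glue (x, \<omega>))" "past_exp (glue (x, \<omega>)) 0 = 1 / x"
proof -
  let ?w = "glue (x, \<omega>)"
  have "(x, \<omega>) \<in> space (borel \<Otimes>\<^sub>M Fxi)" using \<omega> by (simp add: space_pair_measure)
  then have cad: "cadlag_on UNIV ?w" using measurable_space[OF glue_measurable] by (simp add: space_path_space)
  have eq: "indicator {..<0} s * exp (?w s) = indicator {..<0} s * exp s / x" for s
    using x by (simp add: indicator_def glue_neg exp_diff)
  have "integrable lborel (\<lambda>s. indicator {..<0} s * exp s / x)"
    using exp_negative_half_line(1) by simp
  then have "set_integrable lborel {..<0} (\<lambda>s. exp (?w s))"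
    unfolding set_integrable_def by (simp add: eq)
  from set_integrable_Un[OF this cadlag_exp_integrable_Ioc[OF cad, of "-1" 0]]
  have "set_integrable lborel ({..<0} \<union> {-1<..0}) (\<lambda>s. exp (?w s))" by simp
  then have "set_integrable lborel {..0} (\<lambda>s. exp (?w s))" by (rule set_integrable_subset) auto
  then have "summable_past ?w" using cad by (simp add: summable_past_def)
  obtain b where b: "\<And>s. b \<le> s \<Longrightarrow> 0 \<le> \<xi> s \<omega>"
    using lim by (auto simp: filterlim_at_top eventually_at_top_linorder)
  show "clock_path ?w"
    by (rule clock_path_of_eventually_nonneg[of _ "max b 0"]) (fact, use b in \<open>simp add: glue_nonneg\<close>)
  have "past_exp ?w 0 = (LINT s|lborel. indicator {..<0} s * exp s / x)"
    unfolding past_exp_eq_integral by (simp add: eq)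
  also have "\<dots> = 1 / x" using exp_negative_half_line(2) by simp
  finally show "past_exp ?w 0 = 1 / x" .
qed

lemma ou_from_eq_glue:
  assumes x: "0 < x" and t: "0 \<le> t"
  shows "AE \<omega> in M. ou_from \<xi> x t \<omega> = U_path (glue (x, \<omega>)) t"
  using drift[unfolded drifts_to_infinity_def] AE_space
proof eventually_elim
  case (elim \<omega>)
  show ?case
    by (rule ou_from_eq_U_path[OF glue_clock_path(1)[OF x elim(2,1)] _ t])
       (simp_all add: glue_nonneg glue_clock_path(2)[OF x elim(2,1)])
qed

text \<open>The semigroup of the Ornstein-Uhlenbeck type process at positive starting points, written with a
  jointly measurable integrand.\<close>

definition transition :: "real \<Rightarrow> (real \<Rightarrow> ennreal) \<Rightarrow> real \<Rightarrow> ennreal" where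
  "transition t f x = (\<integral>\<^sup>+\<omega>. f (U_path (glue (x, \<omega>)) t) \<partial>M)"

lemma transition_eq: "0 < x \<Longrightarrow> 0 \<le> t \<Longrightarrow> transition t f x = ou_semigroup M \<xi> t f x"
  unfolding transition_def ou_semigroup_def
  using ou_from_eq_glue[of x t] by (intro nn_integral_cong_AE) (auto elim!: eventually_mono)

lemma transition_measurable:
  assumes [measurable]: "f \<in> borel_measurable borel" shows "transition t f \<in> borel_measurable borel"
proof -
  have g: "(\<lambda>p. f (U_path (glue p) t)) \<in> borel_measurable (borel \<Otimes>\<^sub>M Fxi)"
    by (rule measurable_compose[OF measurable_compose[OF glue_measurable U_path_measurable_path]]) measurable
  have id: "(\<lambda>p. (fst p, snd p)) \<in> (borel :: real measure) \<Otimes>\<^sub>M M \<rightarrow>\<^sub>M borel \<Otimes>\<^sub>M Fxi"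
    by (rule measurable_Pair[OF measurable_fst measurable_compose[OF measurable_snd id_measurable_F(1)]])
  have "(\<lambda>p. f (U_path (glue p) t)) \<in> borel_measurable (borel \<Otimes>\<^sub>M M)"
    using measurable_compose[OF id g] by simp
  then show ?thesis
    unfolding transition_def[abs_def] by (intro borel_measurable_nn_integral) (simp add: split_beta')
qed

lemma Xpast_clock_path: "AE \<omega> in M. clock_path (Xpast \<omega>)"
  using X_clock_path xi_0 AE_space
proof eventually_elim
  case (elim \<omega>)
  interpret clock_path "X \<omega>" by (rule elim(1))
  have eq: "Xpast \<omega> s = X \<omega> s" if "s \<le> 0" for s using X_eq_Xpast[OF elim(2) that] by simp
  have "Xpast \<omega> \<in> space path_space" using measurable_space[OF Xpast_measurable] elim(3) by simp
  moreover have "set_integrable lborel {..0} (\<lambda>s. exp (Xpast \<omega> s))"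
    using integrable_past_0 by (rule set_integrable_cong[THEN iffD1, rotated -1]) (auto simp: eq)
  ultimately have "summable_past (Xpast \<omega>)" by (simp add: summable_past_def space_path_space)
  then show ?case
    by (rule clock_path_of_eventually_nonneg[of _ 0]) (simp add: Xpast_def xi_tilde_def)
qed

definition U_past :: "'a \<Rightarrow> real \<Rightarrow> real" where "U_past \<omega> r = U_path (Xpast \<omega>) r"

lemma U_past_measurable: "(\<lambda>\<omega>. U_past \<omega> r) \<in> borel_measurable Feta"
  unfolding U_past_def by (rule measurable_compose[OF Xpast_measurable U_path_measurable_path])

lemma U_past_eq: "AE \<omega> in M. \<forall>r\<le>0. U_map (X \<omega>) r = U_past \<omega> r"
  using X_clock_path Xpast_clock_path xi_0
proof eventually_elim
  case (elim \<omega>)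
  then show ?case
    using U_path_cong_past[OF elim(1,2) X_eq_Xpast[OF elim(3)]] by (simp add: U_map_def U_past_def)
qed

text \<open>The Markov property at time \<open>0\<close>: the past of the time-changed path depends on \<open>\<eta>\<close> only, so that
  \<open>\<xi>\<close> may be integrated out first.\<close>

lemma markov_at_0:
  assumes f[measurable]: "f \<in> borel_measurable borel" and H[measurable]: "H \<in> borel_measurable Feta" and t: "0 \<le> t"
  shows "(\<integral>\<^sup>+\<omega>. H \<omega> * f (U_map (X \<omega>) t) \<partial>Q) = (\<integral>\<^sup>+\<omega>. H \<omega> * transition t f (U_map (X \<omega>) 0) \<partial>Q)"
proof -
  let ?x = "\<lambda>\<omega>. U_past \<omega> 0"
  note [measurable] = U_past_measurable
  have H_M: "H \<in> borel_measurable M" using measurable_compose[OF id_measurable_F(2) H] by simp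
  have x_eq: "AE \<omega> in M. 1 / V_path (X \<omega>) 0 = ?x \<omega> \<and> U_map (X \<omega>) 0 = ?x \<omega> \<and> 0 < ?x \<omega>"
    using X_clock_path U_past_eq
  proof eventually_elim
    case (elim \<omega>)
    interpret clock_path "X \<omega>" by (rule elim(1))
    have "U_map (X \<omega>) 0 = 1 / V_path (X \<omega>) 0" using elim(1) by (simp add: U_map_def U_path_zero)
    then show ?case using elim(2) V_path_pos[of 0] by simp
  qed
  have U_glue: "AE \<omega> in M. U_map (X \<omega>) t = U_path (glue (?x \<omega>, \<omega>)) t"
    using X_clock_path x_eq xi_0 drift[unfolded drifts_to_infinity_def] AE_space
  proof eventually_elim
    case (elim \<omega>)
    interpret clock_path "X \<omega>" by (rule elim(1))
    have x: "0 < ?x \<omega>" using elim(2) by simp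
    have "?x \<omega> = 1 / past_exp (X \<omega>) 0" using elim(2,3) by (simp add: V_path_def X_nonneg)
    then have "ou_from \<xi> (?x \<omega>) t \<omega> = U_path (X \<omega>) t"
      by (intro ou_from_eq_U_path[OF elim(1) _ t]) (simp_all add: X_nonneg)
    moreover have "ou_from \<xi> (?x \<omega>) t \<omega> = U_path (glue (?x \<omega>, \<omega>)) t"
      by (rule ou_from_eq_U_path[OF glue_clock_path(1)[OF x elim(5,4)] _ t])
         (simp_all add: glue_nonneg glue_clock_path(2)[OF x elim(5,4)])
    ultimately show ?case using elim(1) by (simp add: U_map_def)
  qed
  let ?\<phi> = "\<lambda>p. ennreal (?x (snd p)) * (H (snd p) * f (U_path (glue (?x (snd p), fst p)) t))"
  have \<phi>: "?\<phi> \<in> borel_measurable (Fxi \<Otimes>\<^sub>M Feta)"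
  proof -
    have "(\<lambda>p. (?x (snd p), fst p)) \<in> Fxi \<Otimes>\<^sub>M Feta \<rightarrow>\<^sub>M borel \<Otimes>\<^sub>M Fxi" by measurable
    from measurable_compose[OF measurable_compose[OF this glue_measurable] U_path_measurable_path[of t]]
    have [measurable]: "(\<lambda>p. U_path (glue (?x (snd p), fst p)) t) \<in> borel_measurable (Fxi \<Otimes>\<^sub>M Feta)" .
    show ?thesis by measurable
  qed
  have U_meas: "(\<lambda>\<omega>. U_map (X \<omega>) r) \<in> borel_measurable M" for r
    by (rule measurable_compose[OF measurable_compose[OF X_measurable U_map_measurable] eval_measurable])
  have "(\<integral>\<^sup>+\<omega>. H \<omega> * f (U_map (X \<omega>) t) \<partial>Q) = (\<integral>\<^sup>+\<omega>. ennreal (1 / V_path (X \<omega>) 0) * (H \<omega> * f (U_map (X \<omega>) t)) \<partial>M)"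
    by (rule nn_integral_Q) (use H_M U_meas[of t] in measurable)
  also have "\<dots> = (\<integral>\<^sup>+\<omega>. ?\<phi> (\<omega>, \<omega>) \<partial>M)"
  proof (rule nn_integral_cong_AE)
    show "AE \<omega> in M. ennreal (1 / V_path (X \<omega>) 0) * (H \<omega> * f (U_map (X \<omega>) t)) = ?\<phi> (\<omega>, \<omega>)"
      using x_eq U_glue by eventually_elim simp
  qed
  also have "\<dots> = (\<integral>\<^sup>+\<omega>1. (\<integral>\<^sup>+\<omega>2. ?\<phi> (\<omega>2, \<omega>1) \<partial>M) \<partial>M)" by (rule nn_integral_decouple[OF \<phi>])
  also have "\<dots> = (\<integral>\<^sup>+\<omega>1. ennreal (?x \<omega>1) * (H \<omega>1 * transition t f (?x \<omega>1)) \<partial>M)"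
  proof (rule nn_integral_cong)
    fix \<omega>1
    have g: "(\<lambda>\<omega>2. f (U_path (glue (?x \<omega>1, \<omega>2)) t)) \<in> borel_measurable M"
    proof -
      have "(\<lambda>\<omega>2. (?x \<omega>1, \<omega>2)) \<in> M \<rightarrow>\<^sub>M borel \<Otimes>\<^sub>M Fxi"
        by (rule measurable_Pair[OF measurable_const id_measurable_F(1)]) simp
      from measurable_compose[OF measurable_compose[OF measurable_compose[OF this glue_measurable] U_path_measurable_path[of t]] f]
      show ?thesis .
    qed
    show "(\<integral>\<^sup>+\<omega>2. ?\<phi> (\<omega>2, \<omega>1) \<partial>M) = ennreal (?x \<omega>1) * (H \<omega>1 * transition t f (?x \<omega>1))"
      unfolding transition_def using g by (simp add: nn_integral_cmult)
  qed
  also have "\<dots> = (\<integral>\<^sup>+\<omega>. ennreal (1 / V_path (X \<omega>) 0) * (H \<omega> * transition t f (U_map (X \<omega>) 0)) \<partial>M)"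
  proof (rule nn_integral_cong_AE)
    show "AE \<omega> in M. ennreal (?x \<omega>) * (H \<omega> * transition t f (?x \<omega>))
      = ennreal (1 / V_path (X \<omega>) 0) * (H \<omega> * transition t f (U_map (X \<omega>) 0))"
      using x_eq by eventually_elim simp
  qed
  also have "\<dots> = (\<integral>\<^sup>+\<omega>. H \<omega> * transition t f (U_map (X \<omega>) 0) \<partial>Q)"
    by (rule nn_integral_Q[symmetric])
       (use H_M measurable_compose[OF U_meas[of 0] transition_measurable[OF f, of t]] in measurable)
  finally show ?thesis .
qed

lemma sets_past:
  assumes "A \<in> sets (past Q (U_tilde \<xi> \<eta>) s)"
  obtains C where "C \<in> sets (PiM {..s} (\<lambda>_. borel))" "A = {\<omega> \<in> space M. (\<lambda>r\<in>{..s}. U_tilde \<xi> \<eta> r \<omega>) \<in> C}"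
proof -
  let ?h = "\<lambda>\<omega>. \<lambda>r\<in>{..s}. U_tilde \<xi> \<eta> r \<omega>"
  let ?N = "PiM {..s} (\<lambda>_. borel) :: (real \<Rightarrow> real) measure"
  have h: "?h \<in> space M \<rightarrow> space ?N" by (auto simp: space_PiM)
  have "sets (past Q (U_tilde \<xi> \<eta>) s) = sigma_sets (space M) {U_tilde \<xi> \<eta> r -` B \<inter> space M | r B. r \<le> s \<and> B \<in> sets borel}"
    unfolding past_def space_Q by (rule sets_measure_of) auto
  also have "\<dots> \<subseteq> sets (vimage_algebra (space M) ?h ?N)"
  proof -
    have "{U_tilde \<xi> \<eta> r -` B \<inter> space M | r B. r \<le> s \<and> B \<in> sets borel} \<subseteq> sets (vimage_algebra (space M) ?h ?N)"
    proof safe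
      fix r and B :: "real set" assume r: "r \<le> s" and B: "B \<in> sets borel"
      have "(\<lambda>p. p r) \<in> ?N \<rightarrow>\<^sub>M borel" by (rule measurable_component_singleton) (use r in simp)
      from measurable_sets[OF this B]
      have "(\<lambda>p. p r) -` B \<inter> space ?N \<in> sets ?N" .
      from in_vimage_algebra[OF this, of ?h "space M"]
      have "?h -` ((\<lambda>p. p r) -` B \<inter> space ?N) \<inter> space M \<in> sets (vimage_algebra (space M) ?h ?N)" .
      moreover have "?h -` ((\<lambda>p. p r) -` B \<inter> space ?N) \<inter> space M = U_tilde \<xi> \<eta> r -` B \<inter> space M"
        using h r by auto
      ultimately show "U_tilde \<xi> \<eta> r -` B \<inter> space M \<in> sets (vimage_algebra (space M) ?h ?N)" by (simp only:)
    qed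
    from sets.sigma_sets_subset[OF this] show ?thesis by simp
  qed
  also have "\<dots> = {?h -` C \<inter> space M | C. C \<in> sets ?N}" by (rule sets_vimage_algebra2[OF h])
  finally obtain C where "C \<in> sets ?N" "A = ?h -` C \<inter> space M" using assms by blast
  then show thesis by (intro that[of C]) auto
qed

lemma past_subalgebra: "subalgebra Q (past Q (U_tilde \<xi> \<eta>) s)"
proof -
  have gen: "{U_tilde \<xi> \<eta> r -` B \<inter> space M | r B. r \<le> s \<and> B \<in> sets borel} \<subseteq> sets Q"
  proof safe
    fix r and B :: "real set" assume "B \<in> sets borel"
    from measurable_sets[OF U_tilde_measurable this] show "U_tilde \<xi> \<eta> r -` B \<inter> space M \<in> sets Q" by (simp add: space_Q)
  qed
  have "sets (past Q (U_tilde \<xi> \<eta>) s) = sigma_sets (space M) {U_tilde \<xi> \<eta> r -` B \<inter> space M | r B. r \<le> s \<and> B \<in> sets borel}"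
    unfolding past_def space_Q by (rule sets_measure_of) auto
  moreover have "space (past Q (U_tilde \<xi> \<eta>) s) = space Q"
    unfolding past_def by (rule space_measure_of) auto
  ultimately show ?thesis
    using sets.sigma_sets_subset[OF gen] by (simp add: subalgebra_def space_Q)
qed

lemma U_tilde_measurable_past: "U_tilde \<xi> \<eta> s \<in> borel_measurable (past Q (U_tilde \<xi> \<eta>) s)"
proof (rule measurableI)
  have sp: "space (past Q (U_tilde \<xi> \<eta>) s) = space Q"
    unfolding past_def by (rule space_measure_of) auto
  fix B :: "real set" assume "B \<in> sets borel"
  then show "U_tilde \<xi> \<eta> s -` B \<inter> space (past Q (U_tilde \<xi> \<eta>) s) \<in> sets (past Q (U_tilde \<xi> \<eta>) s)"
    unfolding sp unfolding past_def by (subst sets_measure_of) auto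
qed simp

text \<open>On the set where \<open>U\<close> is at most \<open>n\<close>, the measure has total mass at most \<open>n\<close>.\<close>

lemma sigma_finite_past: "sigma_finite_subalgebra Q (past Q (U_tilde \<xi> \<eta>) s)"
proof (rule sigma_finite_subalgebra.intro[OF past_subalgebra])
  let ?F = "past Q (U_tilde \<xi> \<eta>) s"
  let ?R = "restr_to_subalg Q ?F"
  let ?A = "\<lambda>n::nat. U_tilde \<xi> \<eta> s -` {..real n} \<inter> space ?F"
  have A: "?A n \<in> sets ?F" for n by (rule measurable_sets[OF U_tilde_measurable_past]) simp
  have sp: "space ?F = space Q" using past_subalgebra by (simp add: subalgebra_def)
  have bound: "emeasure ?R (?A n) \<le> ennreal (real n)" for n
  proof -
    have "emeasure ?R (?A n) = emeasure Q (U_tilde \<xi> \<eta> s -` {..real n} \<inter> space Q)"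
      using emeasure_restr_to_subalg[OF past_subalgebra A] by (simp only: sp)
    also have "\<dots> = emeasure (nu_measure M \<eta>) {..real n}"
      unfolding distr_U_tilde[of s, symmetric] by (rule emeasure_distr[OF U_tilde_measurable, symmetric]) simp
    also have "\<dots> = (\<integral>\<^sup>+x. indicator {..real n} x \<partial>nu_measure M \<eta>)" by (simp add: nu_measure_def)
    also have "\<dots> = (\<integral>\<^sup>+w. ennreal (1 / V_path w 0) * indicator {..real n} (1 / V_path w 0) \<partial>W)"
      by (rule nn_integral_nu) simp
    also have "\<dots> \<le> (\<integral>\<^sup>+w. ennreal (real n) \<partial>W)"
      by (intro nn_integral_mono) (auto simp: indicator_def intro!: ennreal_leI)
    also have "\<dots> = ennreal (real n)" by (simp add: E.emeasure_space_1)
    finally show ?thesis .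
  qed
  show "sigma_finite_measure ?R"
  proof
    show "\<exists>A. countable A \<and> A \<subseteq> sets ?R \<and> \<Union> A = space ?R \<and> (\<forall>a\<in>A. emeasure ?R a \<noteq> \<infinity>)"
    proof (intro exI[of _ "range ?A"] conjI ballI)
      show "range ?A \<subseteq> sets ?R" using A by (auto simp: sets_restr_to_subalg[OF past_subalgebra])
      show "\<Union> (range ?A) = space ?R"
        using real_arch_simple by (auto simp: space_restr_to_subalg sp)
      fix a assume "a \<in> range ?A"
      then obtain n where "a = ?A n" by blast
      then show "emeasure ?R a \<noteq> \<infinity>" using bound[of n] by (auto simp: top_unique)
    qed simp
  qed
qed

text \<open>The invariance of the path law moves time \<open>s\<close> to \<open>0\<close>, where the Markov property is known, and
  back.\<close>

theorem markov_U_tilde: "markov_process_with_semigroup Q (U_tilde \<xi> \<eta>) (ou_semigroup M \<xi>)"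
  unfolding markov_process_with_semigroup_def
proof (intro conjI allI impI ballI)
  show "U_tilde \<xi> \<eta> t \<in> borel_measurable Q" for t by (rule U_tilde_measurable)
  show "sigma_finite_subalgebra Q (past Q (U_tilde \<xi> \<eta>) s)" for s by (rule sigma_finite_past)
  fix s t :: real and f :: "real \<Rightarrow> ennreal" assume t: "0 \<le> t" and f: "f \<in> borel_measurable borel"
  let ?F = "past Q (U_tilde \<xi> \<eta>) s"
  let ?g = "transition t f"
  interpret sigma_finite_subalgebra Q ?F by (rule sigma_finite_past)
  have g: "?g \<in> borel_measurable borel" by (rule transition_measurable[OF f])
  have shift_back: "(\<integral>\<^sup>+\<omega>. k (U_tilde \<xi> \<eta> (s + r) \<omega>) * indicator A \<omega> \<partial>Q)
      = (\<integral>\<^sup>+\<omega>. indicator C (\<lambda>r\<in>{..s}. U_past \<omega> (r - s)) * k (U_map (X \<omega>) r) \<partial>Q)"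
    if k: "k \<in> borel_measurable borel" and C: "C \<in> sets (PiM {..s} (\<lambda>_. borel))"
      and A: "A = {\<omega> \<in> space M. (\<lambda>r\<in>{..s}. U_tilde \<xi> \<eta> r \<omega>) \<in> C}" for k :: "real \<Rightarrow> ennreal" and C A r
  proof -
    let ?\<Psi> = "\<lambda>u. indicator C (\<lambda>r\<in>{..s}. u (r - s)) * k (u r) :: ennreal"
    have "(\<lambda>u. \<lambda>r\<in>{..s}. u (r - s)) \<in> path_space \<rightarrow>\<^sub>M PiM {..s} (\<lambda>_. borel)"
      by (rule measurable_restrict) (rule eval_measurable)
    from measurable_compose[OF this borel_measurable_indicator[OF C]]
    have \<Psi>: "?\<Psi> \<in> borel_measurable path_space"
      by (rule borel_measurable_times_ennreal) (rule measurable_compose[OF eval_measurable k])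
    have "(\<integral>\<^sup>+\<omega>. k (U_tilde \<xi> \<eta> (s + r) \<omega>) * indicator A \<omega> \<partial>Q) = (\<integral>\<^sup>+\<omega>. ?\<Psi> (shift s (U_map (X \<omega>))) \<partial>Q)"
    proof (rule nn_integral_cong_AE)
      show "AE \<omega> in Q. k (U_tilde \<xi> \<eta> (s + r) \<omega>) * indicator A \<omega> = ?\<Psi> (shift s (U_map (X \<omega>)))"
        using U_tilde_AE AE_space
      proof eventually_elim
        case (elim \<omega>)
        have "U_tilde \<xi> \<eta> r \<omega> = U_map (X \<omega>) r" for r using fun_cong[OF elim(1), of r] .
        then have "\<omega> \<in> A \<longleftrightarrow> (\<lambda>r\<in>{..s}. U_map (X \<omega>) r) \<in> C" "U_tilde \<xi> \<eta> (s + r) \<omega> = U_map (X \<omega>) (s + r)"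
          using elim(2) by (simp_all add: A space_Q)
        then show ?case by (simp add: shift_def indicator_def mult.commute)
      qed
    qed
    also have "\<dots> = (\<integral>\<^sup>+u. ?\<Psi> (shift s u) \<partial>mu_U)"
      by (rule nn_integral_Q_path[OF measurable_compose[OF shift_measurable \<Psi>]])
    also have "\<dots> = (\<integral>\<^sup>+u. ?\<Psi> u \<partial>distr mu_U path_space (shift s))"
    proof (rule nn_integral_distr[symmetric])
      show "shift s \<in> mu_U \<rightarrow>\<^sub>M path_space" using shift_measurable measurable_cong_sets[OF sets_mu_U refl] by blast
      show "?\<Psi> \<in> borel_measurable (distr mu_U path_space (shift s))" using \<Psi> by simp
    qed
    also have "\<dots> = (\<integral>\<^sup>+u. ?\<Psi> u \<partial>mu_U)" by (simp only: distr_mu_U_shift)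
    also have "\<dots> = (\<integral>\<^sup>+\<omega>. ?\<Psi> (U_map (X \<omega>)) \<partial>Q)" by (rule nn_integral_Q_path[OF \<Psi>, symmetric])
    also have "\<dots> = (\<integral>\<^sup>+\<omega>. indicator C (\<lambda>r\<in>{..s}. U_past \<omega> (r - s)) * k (U_map (X \<omega>) r) \<partial>Q)"
    proof (rule nn_integral_cong_AE)
      have "AE \<omega> in Q. \<forall>r\<le>0. U_map (X \<omega>) r = U_past \<omega> r" unfolding AE_Q_iff by (rule U_past_eq)
      then show "AE \<omega> in Q. ?\<Psi> (U_map (X \<omega>)) = indicator C (\<lambda>r\<in>{..s}. U_past \<omega> (r - s)) * k (U_map (X \<omega>) r)"
      proof eventually_elim
        case (elim \<omega>)
        then have "(\<lambda>r\<in>{..s}. U_map (X \<omega>) (r - s)) = (\<lambda>r\<in>{..s}. U_past \<omega> (r - s))"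
          by (intro restrict_ext) simp
        then show ?case by simp
      qed
    qed
    finally show ?thesis .
  qed
  have gU: "(\<lambda>\<omega>. ?g (U_tilde \<xi> \<eta> s \<omega>)) \<in> borel_measurable ?F"
    by (rule measurable_compose[OF U_tilde_measurable_past g])
  have fU: "(\<lambda>\<omega>. f (U_tilde \<xi> \<eta> (s + t) \<omega>)) \<in> borel_measurable Q"
    by (rule measurable_compose[OF U_tilde_measurable f])
  have "AE \<omega> in Q. ?g (U_tilde \<xi> \<eta> s \<omega>) = nn_cond_exp Q ?F (\<lambda>\<omega>'. f (U_tilde \<xi> \<eta> (s + t) \<omega>')) \<omega>"
  proof (rule nn_cond_exp_charact[OF _ fU gU])
    fix A assume "A \<in> sets ?F"
    then obtain C where C: "C \<in> sets (PiM {..s} (\<lambda>_. borel))"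
      and A: "A = {\<omega> \<in> space M. (\<lambda>r\<in>{..s}. U_tilde \<xi> \<eta> r \<omega>) \<in> C}" by (rule sets_past)
    let ?H = "\<lambda>\<omega>. indicator C (\<lambda>r\<in>{..s}. U_past \<omega> (r - s)) :: ennreal"
    have "(\<lambda>\<omega>. \<lambda>r\<in>{..s}. U_past \<omega> (r - s)) \<in> Feta \<rightarrow>\<^sub>M PiM {..s} (\<lambda>_. borel)"
      by (rule measurable_restrict) (rule U_past_measurable)
    from measurable_compose[OF this borel_measurable_indicator[OF C]]
    have H: "?H \<in> borel_measurable Feta" .
    have "(\<integral>\<^sup>+\<omega>\<in>A. f (U_tilde \<xi> \<eta> (s + t) \<omega>) \<partial>Q) = (\<integral>\<^sup>+\<omega>. ?H \<omega> * f (U_map (X \<omega>) t) \<partial>Q)"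
      by (rule shift_back[OF f C A])
    also have "\<dots> = (\<integral>\<^sup>+\<omega>. ?H \<omega> * ?g (U_map (X \<omega>) 0) \<partial>Q)" by (rule markov_at_0[OF f H t])
    also have "\<dots> = (\<integral>\<^sup>+\<omega>\<in>A. ?g (U_tilde \<xi> \<eta> (s + 0) \<omega>) \<partial>Q)" by (rule shift_back[OF g C A, symmetric])
    finally show "(\<integral>\<^sup>+\<omega>\<in>A. f (U_tilde \<xi> \<eta> (s + t) \<omega>) \<partial>Q) = (\<integral>\<^sup>+\<omega>\<in>A. ?g (U_tilde \<xi> \<eta> s \<omega>) \<partial>Q)" by simp
  qed
  moreover have "AE \<omega> in Q. ?g (U_tilde \<xi> \<eta> s \<omega>) = ou_semigroup M \<xi> t f (U_tilde \<xi> \<eta> s \<omega>)"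
    unfolding AE_Q_iff using X_clock_path
  proof eventually_elim
    case (elim \<omega>)
    have "0 < U_tilde \<xi> \<eta> s \<omega>" unfolding U_tilde_eq by (rule clock_path.U_path_pos[OF elim])
    then show ?case by (rule transition_eq[OF _ t])
  qed
  ultimately show "AE \<omega> in Q. nn_cond_exp Q ?F (\<lambda>\<omega>'. f (U_tilde \<xi> \<eta> (s + t) \<omega>')) \<omega> = ou_semigroup M \<xi> t f (U_tilde \<xi> \<eta> s \<omega>)"
    by eventually_elim simp
qed

end

theorem theorem3p1:
  fixes M :: "'a measure" and \<xi> \<eta> :: "real \<Rightarrow> 'a \<Rightarrow> real"
  assumes levy: "levy_process M \<xi>"
    and drift: "drifts_to_infinity M \<xi>"
    and copy: "independent_negative_copy M \<xi> \<eta>"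
  defines "Q \<equiv> Q_measure M \<xi> \<eta>" and "\<nu> \<equiv> nu_measure M \<eta>"
  shows
    "(finite_measure Q \<longleftrightarrow> integrable M (\<xi> 1)) \<and>
     (finite_measure \<nu> \<longleftrightarrow> integrable M (\<xi> 1)) \<and>
     (integrable M (\<xi> 1) \<longrightarrow>
        measure Q (space M) = (\<integral>\<omega>. \<xi> 1 \<omega> \<partial>M) \<and> measure \<nu> {0<..} = (\<integral>\<omega>. \<xi> 1 \<omega> \<partial>M)) \<and>

     stationary_process Q (U_tilde \<xi> \<eta>) \<and>
     ergodic_process Q (U_tilde \<xi> \<eta>) \<and>
     markov_process_with_semigroup Q (U_tilde \<xi> \<eta>) (ou_semigroup M \<xi>) \<and>
     (\<forall>t. distr Q borel (U_tilde \<xi> \<eta> t) = \<nu>) \<and>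

     (\<forall>f g :: real \<Rightarrow> real. integrable \<nu> f \<and> integrable \<nu> g \<and> (\<integral>x. g x \<partial>\<nu>) \<noteq> 0 \<longrightarrow>
       (AE \<omega> in Q.
          ((\<lambda>t. (LBINT s=0..ereal t. f (U_tilde \<xi> \<eta> s \<omega>)) /
                (LBINT s=0..ereal t. g (U_tilde \<xi> \<eta> s \<omega>)))
             \<longlongrightarrow> (\<integral>x. f x \<partial>\<nu>) / (\<integral>x. g x \<partial>\<nu>)) at_top) \<and>
       (AE \<omega> in M.
          ((\<lambda>t. (LBINT s=0..ereal t. f (U_tilde \<xi> \<eta> s \<omega>)) /
                (LBINT s=0..ereal t. g (U_tilde \<xi> \<eta> s \<omega>)))
             \<longlongrightarrow> (\<integral>x. f x \<partial>\<nu>) / (\<integral>x. g x \<partial>\<nu>)) at_top))"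
proof -
  interpret L: two_sided_levy M \<xi> \<eta> by (rule two_sided_levy.intro[OF levy drift copy])
  have Q: "Q = L.Q" by (simp add: Q_def L.Q_def)
  have total: "measure L.Q (space M) = (\<integral>\<omega>. \<xi> 1 \<omega> \<partial>M) \<and> measure \<nu> {0<..} = (\<integral>\<omega>. \<xi> 1 \<omega> \<partial>M)"
    if "integrable M (\<xi> 1)"
    using L.mass_eq_mean[OF that] L.mean_nonneg[OF that]
    by (simp add: measure_def L.emeasure_Q_space L.emeasure_nu \<nu>_def)
  show ?thesis
    unfolding Q L.AE_Q_iff
    using total L.finite_measure_Q_iff L.finite_measure_nu_iff L.stationary_U_tilde L.ergodic_U_tilde L.markov_U_tilde
      L.distr_U_tilde L.ratio_limit
    unfolding \<nu>_def by blast
qed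

end
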